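(* Let $k\ge2$, $a<b$, $\vec w,\vec z\in\mathbb R^k$ with $w_1>\dots>w_k$ and $z_1>\dots>z_k$, and $t\in(0,\infty)$. Let $B=(B_1,\dots,B_k)\sim\mu^{\vec w,\vec z,-\infty}_{k,H_t}$. Let $A,E$ be Borel subsets of $\mathcal C([a,b],\mathbb R)$ with $A$ increasing (if $f\in A$ and $h\ge f$ pointwise then $h\in A$) and $\mathbb P(B_1\in E)>0$. Then $$\mathbb P(B_2\in A\mid B_1\in E)\le\mathbb P(B_1\in A).$$ In the zero-temperature case $t=\infty$, the same conclusion holds for $B\sim\mu^{\vec w,\vec z,g}_{k,H_\infty}$ with any measurable lower boundary $g:[a,b]\to\mathbb R\cup\{-\infty\}$ satisfying $g(a)<w_k$ and $g(b)<z_k$.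
   Context: For $t\in(0,\infty)$ let $H_t(r)=2t^{2/3}\exp(t^{1/3}r)$, and let $H_\infty(r)=+\infty\cdot\mathbf 1_{r>0}$. $\mu^{\vec w,\vec z,g}_{k,H_t}$ is the law of $k$ independent rate-two Brownian bridges $B_1,\dots,B_k$ on $[a,b]$ with $B_j(a)=w_j$, $B_j(b)=z_j$ (i.e. $B_j(u)=w_j+\frac{u-a}{b-a}(z_j-w_j)+\sqrt2W_j(u)$ with $W_j$ independent standard Brownian bridges), reweighted by the density proportional to $\exp\big(-\sum_{i=1}^{k}\int_a^bH_t(B_{i+1}(u)-B_i(u))\,\mathrm du\big)$ with $B_{k+1}:=g$ (the term is zero when $g\equiv-\infty$; for $t=\infty$ the reweighting is conditioning on $B_1>\dots>B_k>g$ on $[a,b]$). *)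

theory Defs
  imports "HOL-Probability.Probability"
begin

definition Cab :: "real \<Rightarrow> real \<Rightarrow> (real \<Rightarrow> real) set" where
  "Cab a b = {f. continuous_on {a..b} f \<and> (\<forall>u. u \<notin> {a..b} \<longrightarrow> f u = 0)}"

definition sup_dist :: "real \<Rightarrow> real \<Rightarrow> (real \<Rightarrow> real) \<Rightarrow> (real \<Rightarrow> real) \<Rightarrow> real" where
  "sup_dist a b f h = (SUP u\<in>{a..b}. \<bar>f u - h u\<bar>)"

definition open_Cab :: "real \<Rightarrow> real \<Rightarrow> (real \<Rightarrow> real) set \<Rightarrow> bool" where
  "open_Cab a b U \<longleftrightarrow> U \<subseteq> Cab a b \<and>
     (\<forall>f\<in>U. \<exists>e>0. \<forall>h\<in>Cab a b. sup_dist a b f h < e \<longrightarrow> h \<in> U)"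

definition borel_Cab :: "real \<Rightarrow> real \<Rightarrow> (real \<Rightarrow> real) set set" where
  "borel_Cab a b = sigma_sets (Cab a b) {U. open_Cab a b U}"

definition increasing_set :: "real \<Rightarrow> real \<Rightarrow> (real \<Rightarrow> real) set \<Rightarrow> bool" where
  "increasing_set a b A \<longleftrightarrow>
     (\<forall>f\<in>A. \<forall>h\<in>Cab a b. (\<forall>u\<in>{a..b}. f u \<le> h u) \<longrightarrow> h \<in> A)"

text \<open>Covariance of a standard Brownian bridge on [a,b] (pinned at 0 at both ends).\<close>
definition bb_cov :: "real \<Rightarrow> real \<Rightarrow> real \<Rightarrow> real \<Rightarrow> real" where
  "bb_cov a b s u = (min s u - a) * (b - max s u) / (b - a)"

text \<open>W_1,...,W_k are independent standard Brownian bridges on [a,b] on the probability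
space M: continuous paths, and all finite families W_j(u) (j in 1..k, u in [a,b]) are
jointly centred Gaussian with covariance delta_{ij} bb_cov (characteristic function).\<close>
definition indep_std_bridges ::
  "'s measure \<Rightarrow> nat \<Rightarrow> real \<Rightarrow> real \<Rightarrow> (nat \<Rightarrow> 's \<Rightarrow> real \<Rightarrow> real) \<Rightarrow> bool" where
  "indep_std_bridges M k a b W \<longleftrightarrow>
     (\<forall>j\<in>{1..k}. \<forall>\<omega>\<in>space M. continuous_on {a..b} (W j \<omega>)) \<and>
     (\<forall>j\<in>{1..k}. \<forall>u\<in>{a..b}. (\<lambda>\<omega>. W j \<omega> u) \<in> borel_measurable M) \<and>
     (\<forall>(n::nat) (J::nat \<Rightarrow> nat) (U::nat \<Rightarrow> real) (\<theta>::nat \<Rightarrow> real).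
        (\<forall>l<n. J l \<in> {1..k} \<and> U l \<in> {a..b}) \<longrightarrow>
        (\<integral>\<omega>. cis (\<Sum>l<n. \<theta> l * W (J l) \<omega> (U l)) \<partial>M) =
          complex_of_real (exp (-(1/2) * (\<Sum>l<n. \<Sum>m<n.
             \<theta> l * \<theta> m * (if J l = J m then bb_cov a b (U l) (U m) else 0)))))"

text \<open>Rate-two Brownian bridge from w_j to z_j built from W_j.\<close>
definition BB :: "real \<Rightarrow> real \<Rightarrow> (nat \<Rightarrow> real) \<Rightarrow> (nat \<Rightarrow> real) \<Rightarrow> (nat \<Rightarrow> 's \<Rightarrow> real \<Rightarrow> real)
                  \<Rightarrow> nat \<Rightarrow> 's \<Rightarrow> real \<Rightarrow> real" where
  "BB a b w z W j \<omega> u = w j + (u - a) / (b - a) * (z j - w j) + sqrt 2 * W j \<omega> u"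

definition BBpath :: "real \<Rightarrow> real \<Rightarrow> (nat \<Rightarrow> real) \<Rightarrow> (nat \<Rightarrow> real) \<Rightarrow> (nat \<Rightarrow> 's \<Rightarrow> real \<Rightarrow> real)
                  \<Rightarrow> nat \<Rightarrow> 's \<Rightarrow> real \<Rightarrow> real" where
  "BBpath a b w z W j \<omega> = (\<lambda>u. if u \<in> {a..b} then BB a b w z W j \<omega> u else 0)"

definition Ht :: "real \<Rightarrow> real \<Rightarrow> real" where
  "Ht t r = 2 * t powr (2/3) * exp (t powr (1/3) * r)"

text \<open>Boltzmann weight for mu^{w,z,-infinity}_{k,H_t} (the i = k term vanishes since g = -infinity).\<close>
definition weight_t :: "real \<Rightarrow> real \<Rightarrow> nat \<Rightarrow> (nat \<Rightarrow> real) \<Rightarrow> (nat \<Rightarrow> real)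
                     \<Rightarrow> (nat \<Rightarrow> 's \<Rightarrow> real \<Rightarrow> real) \<Rightarrow> real \<Rightarrow> 's \<Rightarrow> real" where
  "weight_t a b k w z W t \<omega> =
     exp (- (\<Sum>i\<in>{1..<k}. integral {a..b}
              (\<lambda>u. Ht t (BB a b w z W (Suc i) \<omega> u - BB a b w z W i \<omega> u))))"

definition prob_t :: "'s measure \<Rightarrow> real \<Rightarrow> real \<Rightarrow> nat \<Rightarrow> (nat \<Rightarrow> real) \<Rightarrow> (nat \<Rightarrow> real)
                     \<Rightarrow> (nat \<Rightarrow> 's \<Rightarrow> real \<Rightarrow> real) \<Rightarrow> real \<Rightarrow> 's set \<Rightarrow> real" where
  "prob_t M a b k w z W t S =
     (\<integral>\<omega>. indicator S \<omega> * weight_t a b k w z W t \<omega> \<partial>M) / (\<integral>\<omega>. weight_t a b k w z W t \<omega> \<partial>M)"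

definition ordered_event :: "'s measure \<Rightarrow> real \<Rightarrow> real \<Rightarrow> nat \<Rightarrow> (nat \<Rightarrow> real) \<Rightarrow> (nat \<Rightarrow> real)
                     \<Rightarrow> (nat \<Rightarrow> 's \<Rightarrow> real \<Rightarrow> real) \<Rightarrow> (real \<Rightarrow> ereal) \<Rightarrow> 's set" where
  "ordered_event M a b k w z W g = {\<omega> \<in> space M. \<forall>u\<in>{a..b}.
      (\<forall>i\<in>{1..<k}. BB a b w z W (Suc i) \<omega> u < BB a b w z W i \<omega> u) \<and>
      g u < ereal (BB a b w z W k \<omega> u)}"

definition prob_inf :: "'s measure \<Rightarrow> real \<Rightarrow> real \<Rightarrow> nat \<Rightarrow> (nat \<Rightarrow> real) \<Rightarrow> (nat \<Rightarrow> real)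
                     \<Rightarrow> (nat \<Rightarrow> 's \<Rightarrow> real \<Rightarrow> real) \<Rightarrow> (real \<Rightarrow> ereal) \<Rightarrow> 's set \<Rightarrow> real" where
  "prob_inf M a b k w z W g S =
     measure M (S \<inter> ordered_event M a b k w z W g) / measure M (ordered_event M a b k w z W g)"

end

theory Submission
  imports Defs
begin

text \<open>
  Write \<open>B\<close> and \<open>B'\<close> for two independent copies of the bridges and \<open>wt\<close> for the weight. The claim is
  \<open>E[1\<^sub>A(B\<^sub>2) 1\<^sub>E(B\<^sub>1) wt(B) wt(B')] \<le> E[1\<^sub>E(B\<^sub>1) wt(B) 1\<^sub>A(B'\<^sub>1) wt(B')]\<close>.
  Keep \<open>B\<^sub>1\<close> and \<open>B'\<^sub>k\<close> fixed and compare \<open>(B\<^sub>2, ..., B\<^sub>k)\<close> with \<open>(B'\<^sub>1, ..., B'\<^sub>k\<^sub>-\<^sub>1)\<close>, whose endpoints are larger,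
  by the four functions theorem of Ahlswede and Daykin: on a finite set of times the bridge densities are
  log-supermodular, and the weights are so because \<open>exp (- H)\<close> is decreasing and log-concave. The result passes to
  the limit of grids that become dense; \<open>A\<close> and \<open>E\<close> are approximated from inside by compact sets. At zero
  temperature one also needs that touching without crossing is a null event, since the barrier \<open>g\<close> is only
  measurable and the ordering can be tested only along a countable set of times.
\<close>

section \<open>A four functions theorem\<close>

text \<open>Keeping \<open>B\<^sub>1\<close> and \<open>B'\<^sub>k\<close> fixed costs nothing:
  lowering the lines under \<open>B\<^sub>1\<close> only helps the top interaction, and
  \<open>E\<close> sees only a line that does not move, so it needs no structure. The event on
  \<open>B\<^sub>2\<close> becomes one on \<open>B'\<^sub>1\<close>, which the join raises; this is
  where \<open>A\<close> must be increasing. The floor is the obstacle. Let \<open>x\<close> be the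
  bottom line of the first copy, facing \<open>y\<close>, and let \<open>v = B'\<^sub>k\<close>.
  Exchanging \<open>x\<close> and \<open>y\<close> when \<open>y < x\<close> requires
  \<open>H (g - y) + H (v - x) \<le> H (g - x) + H (v - y)\<close>. By convexity this holds when
  \<open>v \<ge> g\<close>, which a hard floor guarantees, but a soft floor lets \<open>v\<close>
  drop below \<open>g\<close>, where the inequality reverses. Hence there is no floor at finite
  \<open>t\<close> and an arbitrary one at \<open>t = \<infinity>\<close>. The bridges are given
  only by joint characteristic functions. Their grid densities, and the independence used for the
  touching event, have to be recovered from these by uniqueness theorems.\<close>

lemma add_le_add_of_mult_le_ennreal:
  fixes a b c d :: ennreal
  assumes "a \<le> c" "b \<le> c" "a * b \<le> c * d"
  shows "a + b \<le> c + d"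
proof (cases "c = \<top> \<or> d = \<top>")
  case True then show ?thesis by auto
next
  case False
  then have fin: "a \<noteq> \<top>" "b \<noteq> \<top>" "c \<noteq> \<top>" "d \<noteq> \<top>"
    using assms by (auto simp: top_unique)
  obtain a' b' c' d' where r: "a = ennreal a'" "b = ennreal b'" "c = ennreal c'" "d = ennreal d'"
    "0 \<le> a'" "0 \<le> b'" "0 \<le> c'" "0 \<le> d'"
    using fin by (metis ennreal_cases top_neq_ennreal)
  have le: "a' \<le> c'" "b' \<le> c'" "a' * b' \<le> c' * d'"
    using assms unfolding r by (simp_all add: r ennreal_mult[symmetric])
  have "a' + b' \<le> c' + d'"
  proof (cases "c' = 0")
    case True then show ?thesis using le r by simp
  next
    case False
    \<comment> \<open>Expanded, this bounds \<open>c' * (a' + b')\<close> by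
      \<open>c' * c' + a' * b'\<close>, whose last product is at most
      \<open>c' * d'\<close>.\<close>
    have "0 \<le> (c' - a') * (c' - b')" using le by simp
    then have "c' * (a' + b') \<le> c' * (c' + d')"
      using le(3) by (simp add: algebra_simps)
    then show ?thesis using False r by simp
  qed
  then show ?thesis unfolding r using r by (simp add: ennreal_plus[symmetric] del: ennreal_plus)
qed

text \<open>Twice a product of integrals is the double integral of
  \<open>f x * g y + f y * g x\<close>, so it suffices to compare symmetrized integrands at each
  pair. For \<open>y \<le> x\<close> the product \<open>f3 x * f4 y\<close> bounds both cross terms,
  and the diagonal hypotheses bound the product of the cross terms; the two-point inequality above
  applies.\<close>

lemma four_functions_linorder:
  fixes f1 f2 f3 f4 :: "'a :: linorder \<Rightarrow> ennreal"
  assumes [measurable]: "f1 \<in> borel_measurable M" "f2 \<in> borel_measurable M"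
      "f3 \<in> borel_measurable M" "f4 \<in> borel_measurable M"
    and le: "\<And>x y. f1 x * f2 y \<le> f3 (max x y) * f4 (min x y)"
  shows "(\<integral>\<^sup>+x. f1 x \<partial>M) * (\<integral>\<^sup>+x. f2 x \<partial>M) \<le> (\<integral>\<^sup>+x. f3 x \<partial>M) * (\<integral>\<^sup>+x. f4 x \<partial>M)"
proof -
  have sym: "f1 x * f2 y + f1 y * f2 x \<le> f3 x * f4 y + f3 y * f4 x" for x y
  proof -
    have *: "f1 x * f2 y + f1 y * f2 x \<le> f3 x * f4 y + f3 y * f4 x" if "y \<le> x" for x y
    proof (rule add_le_add_of_mult_le_ennreal)
      show "f1 x * f2 y \<le> f3 x * f4 y" "f1 y * f2 x \<le> f3 x * f4 y"
        using le[of x y] le[of y x] that by (simp_all add: max_def min_def split: if_splits)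
      have "(f1 x * f2 x) * (f1 y * f2 y) \<le> (f3 x * f4 x) * (f3 y * f4 y)"
        by (rule mult_mono) (use le[of x x] le[of y y] in simp_all)
      then show "f1 x * f2 y * (f1 y * f2 x) \<le> f3 x * f4 y * (f3 y * f4 x)"
        by (simp add: mult_ac)
    qed
    show ?thesis
    proof (cases "y \<le> x")
      case False then show ?thesis using *[of x y] by (simp add: add.commute)
    qed (rule *)
  qed
  have eq: "(\<integral>\<^sup>+x. \<integral>\<^sup>+y. (f x * g y + f y * g x) \<partial>M \<partial>M) = 2 * ((\<integral>\<^sup>+x. f x \<partial>M) * (\<integral>\<^sup>+x. g x \<partial>M))"
    if [measurable]: "f \<in> borel_measurable M" "g \<in> borel_measurable M" for f g :: "'a \<Rightarrow> ennreal"
    by (simp add: nn_integral_add nn_integral_cmult nn_integral_multc mult_2 mult.commute)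
  have "2 * ((\<integral>\<^sup>+x. f1 x \<partial>M) * (\<integral>\<^sup>+x. f2 x \<partial>M)) \<le> 2 * ((\<integral>\<^sup>+x. f3 x \<partial>M) * (\<integral>\<^sup>+x. f4 x \<partial>M))"
    unfolding eq[OF assms(1,2), symmetric] eq[OF assms(3,4), symmetric]
    by (intro nn_integral_mono sym)
  then show ?thesis
    by (subst (asm) ennreal_mult_le_mult_iff) auto
qed

abbreviation Leb :: "'i set \<Rightarrow> ('i \<Rightarrow> real) measure" where
  "Leb I \<equiv> PiM I (\<lambda>_. lborel)"

text \<open>Coordinates in \<open>D\<close> are not sorted: there the two arguments are merely exchanged.\<close>

definition join_off :: "'i set \<Rightarrow> ('i \<Rightarrow> real) \<Rightarrow> ('i \<Rightarrow> real) \<Rightarrow> 'i \<Rightarrow> real" where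
  "join_off D x y = (\<lambda>i. if i \<in> D then y i else max (x i) (y i))"

definition meet_off :: "'i set \<Rightarrow> ('i \<Rightarrow> real) \<Rightarrow> ('i \<Rightarrow> real) \<Rightarrow> 'i \<Rightarrow> real" where
  "meet_off D x y = (\<lambda>i. if i \<in> D then x i else min (x i) (y i))"

text \<open>Integrating out one coordinate preserves the hypothesis: with the other coordinates
  fixed, the one-dimensional inequality turns it into the same hypothesis for the four marginals.
  The functions therefore vary in the induction.\<close>

lemma four_functions_PiM:
  fixes f1 f2 f3 f4 :: "('i \<Rightarrow> real) \<Rightarrow> ennreal"
  assumes "finite I"
    and "f1 \<in> borel_measurable (Leb I)" "f2 \<in> borel_measurable (Leb I)"
      "f3 \<in> borel_measurable (Leb I)" "f4 \<in> borel_measurable (Leb I)"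
    and "\<And>x y. x \<in> space (Leb I) \<Longrightarrow> y \<in> space (Leb I) \<Longrightarrow>
      f1 x * f2 y \<le> f3 (join_off D x y) * f4 (meet_off D x y)"
  shows "(\<integral>\<^sup>+x. f1 x \<partial>Leb I) * (\<integral>\<^sup>+x. f2 x \<partial>Leb I)
    \<le> (\<integral>\<^sup>+x. f3 x \<partial>Leb I) * (\<integral>\<^sup>+x. f4 x \<partial>Leb I)"
  using assms
proof (induction I arbitrary: f1 f2 f3 f4 rule: finite_induct)
  case empty
  have e: "join_off D (\<lambda>_. undefined) (\<lambda>_. undefined) = (\<lambda>_. undefined)"
    "meet_off D (\<lambda>_. undefined) (\<lambda>_. undefined) = (\<lambda>_. undefined)"
    by (auto simp: join_off_def meet_off_def)
  show ?case
    using empty(5)[of "\<lambda>_. undefined" "\<lambda>_. undefined"]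
    by (simp add: e space_PiM PiM_empty nn_integral_count_space_finite)
next
  case (insert i I)
  interpret product_sigma_finite "\<lambda>_::'i. lborel :: real measure"
    by (simp add: product_sigma_finite_def sigma_finite_lborel)
  note [measurable] = insert.prems(1-4)
  have upd: "x(i := s) \<in> space (Leb (insert i I))"
    if "x \<in> space (Leb I)" for x and s :: real
    using that insert.hyps by (auto simp: space_PiM PiE_iff extensional_def)
  have m: "(\<lambda>s. f (x(i := s))) \<in> borel_measurable lborel"
    if "f \<in> borel_measurable (Leb (insert i I))" "x \<in> space (Leb I)"
    for f :: "('i \<Rightarrow> real) \<Rightarrow> ennreal" and x
    using measurable_compose[OF measurable_component_update[OF that(2) insert.hyps(2)] that(1)] by simp
  have m': "(\<lambda>x. \<integral>\<^sup>+s. f (x(i := s)) \<partial>lborel) \<in> borel_measurable (Leb I)"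
    if [measurable]: "f \<in> borel_measurable (Leb (insert i I))"
    for f :: "('i \<Rightarrow> real) \<Rightarrow> ennreal"
    by measurable
  show ?case
    unfolding product_nn_integral_insert[OF insert.hyps insert.prems(1)]
      product_nn_integral_insert[OF insert.hyps insert.prems(2)]
      product_nn_integral_insert[OF insert.hyps insert.prems(3)]
      product_nn_integral_insert[OF insert.hyps insert.prems(4)]
  proof (rule insert.IH)
    fix x y assume xy: "x \<in> space (Leb I)" "y \<in> space (Leb I)"
    let ?j = "join_off D x y" and ?m = "meet_off D x y"
    have jm: "?j \<in> space (Leb I)" "?m \<in> space (Leb I)"
      using xy by (auto simp: space_PiM PiE_iff extensional_def join_off_def meet_off_def)
    note le = insert.prems(5)[OF upd[OF xy(1)] upd[OF xy(2)]]
    show "(\<integral>\<^sup>+ s. f1 (x(i := s)) \<partial>lborel) * (\<integral>\<^sup>+ s. f2 (y(i := s)) \<partial>lborel)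
      \<le> (\<integral>\<^sup>+ s. f3 (?j(i := s)) \<partial>lborel) * (\<integral>\<^sup>+ s. f4 (?m(i := s)) \<partial>lborel)"
    proof (cases "i \<in> D")
      case True
      \<comment> \<open>In an exchanged coordinate \<open>f3\<close> receives only \<open>t\<close>
        and \<open>f4\<close> only \<open>s\<close>, so the double integral on the right factors at
        once.\<close>
      have "join_off D (x(i := s)) (y(i := t)) = ?j(i := t)"
        "meet_off D (x(i := s)) (y(i := t)) = ?m(i := s)" for s t
        using True by (auto simp: join_off_def meet_off_def)
      then have "f1 (x(i := s)) * f2 (y(i := t)) \<le> f3 (?j(i := t)) * f4 (?m(i := s))" for s t
        using le[of s t] by (simp only: )
      then have "(\<integral>\<^sup>+s. \<integral>\<^sup>+t. f1 (x(i := s)) * f2 (y(i := t)) \<partial>lborel \<partial>lborel)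
        \<le> (\<integral>\<^sup>+s. \<integral>\<^sup>+t. f3 (?j(i := t)) * f4 (?m(i := s)) \<partial>lborel \<partial>lborel)"
        by (intro nn_integral_mono)
      then show ?thesis
        using m[OF insert.prems(1) xy(1)] m[OF insert.prems(2) xy(2)]
          m[OF insert.prems(3) jm(1)] m[OF insert.prems(4) jm(2)]
        by (simp add: nn_integral_cmult nn_integral_multc)
    next
      case False
      have "join_off D (x(i := s)) (y(i := t)) = ?j(i := max s t)"
        "meet_off D (x(i := s)) (y(i := t)) = ?m(i := min s t)" for s t
        using False by (auto simp: join_off_def meet_off_def)
      then have "f1 (x(i := s)) * f2 (y(i := t)) \<le> f3 (?j(i := max s t)) * f4 (?m(i := min s t))" for s t
        using le[of s t] by (simp only: )
      then show ?thesis
        by (intro four_functions_linorder m insert.prems xy jm)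
    qed
  qed (rule m'; rule insert.prems)+
qed

section \<open>Joint characteristic functions\<close>

text \<open>Weights between \<open>1\<close> and \<open>3\<close> arise as \<open>2 + h\<close> with
  \<open>\<bar>h\<bar> \<le> 1\<close>. The shift turns a signed weight into a positive density, and
  after division by its mass \<open>c\<close> Levy uniqueness for probability laws applies.\<close>

lemma weighted_law:
  fixes X \<rho> :: "'a \<Rightarrow> real"
  assumes "prob_space M" and [measurable]: "X \<in> borel_measurable M" "\<rho> \<in> borel_measurable M"
    and bd: "\<And>\<omega>. 1 \<le> \<rho> \<omega>" "\<And>\<omega>. \<rho> \<omega> \<le> 3"
  defines "c \<equiv> \<integral>\<omega>. \<rho> \<omega> \<partial>M"
  defines "D \<equiv> distr (density M (\<lambda>\<omega>. ennreal (\<rho> \<omega> / c))) borel X"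
  shows "1 \<le> c" "real_distribution D"
    and "char D t = (\<integral>\<omega>. \<rho> \<omega> *\<^sub>R cis (t * X \<omega>) \<partial>M) /\<^sub>R c"
    and "B \<in> sets borel \<Longrightarrow> measure D B = (\<integral>\<omega>. \<rho> \<omega> * indicator B (X \<omega>) \<partial>M) / c"
proof -
  interpret prob_space M by fact
  have [measurable]: "cis \<in> borel_measurable borel"
    by (intro borel_measurable_continuous_onI continuous_intros)
  define N where "N = density M (\<lambda>\<omega>. ennreal (\<rho> \<omega> / c))"
  have D: "D = distr N borel X" by (simp add: D_def N_def)
  have abs3: "\<bar>\<rho> \<omega>\<bar> \<le> 3" for \<omega> using bd[of \<omega>] by auto
  have int: "integrable M \<rho>"
    using abs3 by (intro integrable_const_bound[where B=3]) auto
  have "(\<integral>\<omega>. 1 \<partial>M) \<le> c" unfolding c_def using bd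
    by (intro integral_mono_AE int) auto
  then show c: "1 \<le> c" by (simp add: prob_space)
  have pos: "0 \<le> \<rho> \<omega> / c" for \<omega> using bd(1)[of \<omega>] c by simp
  have "emeasure N (space N) = (\<integral>\<^sup>+\<omega>. ennreal (\<rho> \<omega> / c) \<partial>M)"
    unfolding N_def by (simp add: emeasure_density cong: nn_integral_cong)
  also have "\<dots> = ennreal (\<integral>\<omega>. \<rho> \<omega> / c \<partial>M)"
    using int pos by (intro nn_integral_eq_integral) auto
  also have "\<dots> = 1" using c by (simp add: c_def[symmetric])
  finally have "emeasure N (space N) = 1" .
  then interpret N: prob_space N by (rule prob_spaceI)
  have sN [measurable_cong]: "sets N = sets M" by (simp add: N_def)
  show "real_distribution D"
    unfolding D by (simp add: real_distribution_def real_distribution_axioms_def N.prob_space_distr)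
  have i: "integrable M (\<lambda>\<omega>. \<rho> \<omega> *\<^sub>R cis (t * X \<omega>))"
    using abs3 by (intro integrable_const_bound[where B=3]) auto
  have "char D t = (\<integral>\<omega>. cis (t * X \<omega>) \<partial>N)"
    unfolding char_def D by (subst integral_distr) (auto simp: cis_conv_exp)
  also have "\<dots> = (\<integral>\<omega>. (\<rho> \<omega> / c) *\<^sub>R cis (t * X \<omega>) \<partial>M)"
    unfolding N_def using pos by (subst integral_density) auto
  also have "\<dots> = (\<integral>\<omega>. inverse c *\<^sub>R (\<rho> \<omega> *\<^sub>R cis (t * X \<omega>)) \<partial>M)"
    by (simp add: divide_inverse mult.commute)
  also have "\<dots> = (\<integral>\<omega>. \<rho> \<omega> *\<^sub>R cis (t * X \<omega>) \<partial>M) /\<^sub>R c"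
    by (rule integral_scaleR_right)
  finally show "char D t = (\<integral>\<omega>. \<rho> \<omega> *\<^sub>R cis (t * X \<omega>) \<partial>M) /\<^sub>R c" .
  assume [measurable]: "B \<in> sets borel"
  have "measure D B = (\<integral>\<omega>. indicator B (X \<omega>) \<partial>N)"
  proof -
    have "measure D B = (\<integral>x. indicator B x \<partial>D)" by (simp add: D)
    also have "\<dots> = (\<integral>\<omega>. indicator B (X \<omega>) \<partial>N)" unfolding D by (rule integral_distr) auto
    finally show ?thesis .
  qed
  also have "\<dots> = (\<integral>\<omega>. (\<rho> \<omega> / c) *\<^sub>R indicator B (X \<omega>) \<partial>M)"
    unfolding N_def using pos by (subst integral_density) auto
  also have "\<dots> = (\<integral>\<omega>. \<rho> \<omega> * indicator B (X \<omega>) \<partial>M) / c"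
    by simp
  finally show "measure D B = (\<integral>\<omega>. \<rho> \<omega> * indicator B (X \<omega>) \<partial>M) / c" .
qed

lemma integral_indicator_eq_of_char_eq_pos:
  fixes X1 \<rho>1 :: "'a \<Rightarrow> real" and X2 \<rho>2 :: "'b \<Rightarrow> real"
  assumes "prob_space M1" "prob_space M2"
    and "X1 \<in> borel_measurable M1" "X2 \<in> borel_measurable M2"
      "\<rho>1 \<in> borel_measurable M1" "\<rho>2 \<in> borel_measurable M2"
    and bd: "\<And>\<omega>. 1 \<le> \<rho>1 \<omega>" "\<And>\<omega>. \<rho>1 \<omega> \<le> 3" "\<And>\<omega>. 1 \<le> \<rho>2 \<omega>" "\<And>\<omega>. \<rho>2 \<omega> \<le> 3"
    and eq: "\<And>t. (\<integral>\<omega>. \<rho>1 \<omega> *\<^sub>R cis (t * X1 \<omega>) \<partial>M1) = (\<integral>\<omega>. \<rho>2 \<omega> *\<^sub>R cis (t * X2 \<omega>) \<partial>M2)"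
    and B: "B \<in> sets borel"
  shows "(\<integral>\<omega>. \<rho>1 \<omega> * indicator B (X1 \<omega>) \<partial>M1) = (\<integral>\<omega>. \<rho>2 \<omega> * indicator B (X2 \<omega>) \<partial>M2)"
proof -
  note 1 = weighted_law[OF assms(1,3,5) bd(1,2)] and 2 = weighted_law[OF assms(2,4,6) bd(3,4)]
  \<comment> \<open>At \<open>t = 0\<close> the hypothesis compares total masses, so both laws are
    normalized by the same constant.\<close>
  have "complex_of_real (\<integral>\<omega>. \<rho>1 \<omega> \<partial>M1) = complex_of_real (\<integral>\<omega>. \<rho>2 \<omega> \<partial>M2)"
    using eq[of 0] by (simp add: scaleR_conv_of_real)
  then have c: "(\<integral>\<omega>. \<rho>1 \<omega> \<partial>M1) = (\<integral>\<omega>. \<rho>2 \<omega> \<partial>M2)" by simp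
  have D: "distr (density M1 (\<lambda>\<omega>. ennreal (\<rho>1 \<omega> / (\<integral>\<omega>. \<rho>1 \<omega> \<partial>M1)))) borel X1
    = distr (density M2 (\<lambda>\<omega>. ennreal (\<rho>2 \<omega> / (\<integral>\<omega>. \<rho>2 \<omega> \<partial>M2)))) borel X2"
    by (intro Levy_uniqueness 1(2) 2(2) ext) (simp only: 1(3) 2(3) eq, simp only: c)
  have "(\<integral>\<omega>. \<rho>1 \<omega> * indicator B (X1 \<omega>) \<partial>M1) / (\<integral>\<omega>. \<rho>1 \<omega> \<partial>M1)
    = (\<integral>\<omega>. \<rho>2 \<omega> * indicator B (X2 \<omega>) \<partial>M2) / (\<integral>\<omega>. \<rho>2 \<omega> \<partial>M2)"
    unfolding 1(4)[OF B, symmetric] 2(4)[OF B, symmetric] D ..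
  with 1(1) c show ?thesis by simp
qed

text \<open>The weight \<open>2 + h\<close> is covered by the positive case, and so is the weight
  \<open>1\<close>; subtracting twice the latter leaves the signed weight \<open>h\<close>.\<close>

lemma integral_indicator_eq_of_char_eq:
  fixes X1 h1 :: "'a \<Rightarrow> real" and X2 h2 :: "'b \<Rightarrow> real"
  assumes "prob_space M1" "prob_space M2"
    and [measurable]: "X1 \<in> borel_measurable M1" "X2 \<in> borel_measurable M2"
      "h1 \<in> borel_measurable M1" "h2 \<in> borel_measurable M2"
    and bd: "\<And>\<omega>. \<bar>h1 \<omega>\<bar> \<le> 1" "\<And>\<omega>. \<bar>h2 \<omega>\<bar> \<le> 1"
    and eqh: "\<And>t. (\<integral>\<omega>. h1 \<omega> *\<^sub>R cis (t * X1 \<omega>) \<partial>M1) = (\<integral>\<omega>. h2 \<omega> *\<^sub>R cis (t * X2 \<omega>) \<partial>M2)"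
    and eq: "\<And>t. (\<integral>\<omega>. cis (t * X1 \<omega>) \<partial>M1) = (\<integral>\<omega>. cis (t * X2 \<omega>) \<partial>M2)"
    and [measurable]: "B \<in> sets borel"
  shows "(\<integral>\<omega>. h1 \<omega> * indicator B (X1 \<omega>) \<partial>M1) = (\<integral>\<omega>. h2 \<omega> * indicator B (X2 \<omega>) \<partial>M2)"
proof -
  interpret M1: prob_space M1 by fact
  interpret M2: prob_space M2 by fact
  have [measurable]: "cis \<in> borel_measurable borel"
    by (intro borel_measurable_continuous_onI continuous_intros)
  have i1: "integrable M1 (\<lambda>\<omega>. h1 \<omega> *\<^sub>R cis (t * X1 \<omega>))" "integrable M1 (\<lambda>\<omega>. cis (t * X1 \<omega>))"
    "integrable M1 (\<lambda>\<omega>. h1 \<omega> * indicator B (X1 \<omega>))" "integrable M1 (\<lambda>\<omega>. indicator B (X1 \<omega>) :: real)" for t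
    using bd by (auto intro!: M1.integrable_const_bound[where B=1] AE_I2 simp: abs_mult indicator_def)
  have i2: "integrable M2 (\<lambda>\<omega>. h2 \<omega> *\<^sub>R cis (t * X2 \<omega>))" "integrable M2 (\<lambda>\<omega>. cis (t * X2 \<omega>))"
    "integrable M2 (\<lambda>\<omega>. h2 \<omega> * indicator B (X2 \<omega>))" "integrable M2 (\<lambda>\<omega>. indicator B (X2 \<omega>) :: real)" for t
    using bd by (auto intro!: M2.integrable_const_bound[where B=1] AE_I2 simp: abs_mult indicator_def)
  have bd3: "1 \<le> 2 + h1 \<omega>" "2 + h1 \<omega> \<le> 3" "1 \<le> 2 + h2 \<omega>'" "2 + h2 \<omega>' \<le> 3" for \<omega> \<omega>'
    using bd(1)[of \<omega>] bd(2)[of \<omega>'] by auto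
  have "(\<integral>\<omega>. (2 + h1 \<omega>) *\<^sub>R cis (t * X1 \<omega>) \<partial>M1) = (\<integral>\<omega>. (2 + h2 \<omega>) *\<^sub>R cis (t * X2 \<omega>) \<partial>M2)" for t
    unfolding scaleR_add_left using eqh[of t] eq[of t] i1 i2
    by (subst (1 2) Bochner_Integration.integral_add) auto
  then have "(\<integral>\<omega>. (2 + h1 \<omega>) * indicator B (X1 \<omega>) \<partial>M1) = (\<integral>\<omega>. (2 + h2 \<omega>) * indicator B (X2 \<omega>) \<partial>M2)"
    using bd3 by (intro integral_indicator_eq_of_char_eq_pos assms(1,2)) auto
  moreover have "(\<integral>\<omega>. 1 * indicator B (X1 \<omega>) \<partial>M1) = (\<integral>\<omega>. 1 * (indicator B (X2 \<omega>) :: real) \<partial>M2)"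
    using eq by (intro integral_indicator_eq_of_char_eq_pos assms(1,2)) auto
  ultimately show ?thesis
    using i1 i2 by (simp add: distrib_right Bochner_Integration.integral_add)
qed

text \<open>Multivariate Levy uniqueness is reduced to the one-dimensional theorem: exponentials are
  replaced by indicators one coordinate at a time, while the factors of all other coordinates act as
  a bounded weight.\<close>

theorem distr_PiM_eq_of_joint_char_eq:
  fixes X1 :: "'i \<Rightarrow> 'a \<Rightarrow> real" and X2 :: "'i \<Rightarrow> 'b \<Rightarrow> real"
  assumes "prob_space M1" "prob_space M2" and "finite I"
    and X1: "\<And>i. i \<in> I \<Longrightarrow> X1 i \<in> borel_measurable M1"
    and X2: "\<And>i. i \<in> I \<Longrightarrow> X2 i \<in> borel_measurable M2"
    and eq: "\<And>\<theta>. (\<integral>\<omega>. cis (\<Sum>i\<in>I. \<theta> i * X1 i \<omega>) \<partial>M1) = (\<integral>\<omega>. cis (\<Sum>i\<in>I. \<theta> i * X2 i \<omega>) \<partial>M2)"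
  shows "distr M1 (PiM I (\<lambda>_. borel)) (\<lambda>\<omega>. \<lambda>i\<in>I. X1 i \<omega>) = distr M2 (PiM I (\<lambda>_. borel)) (\<lambda>\<omega>. \<lambda>i\<in>I. X2 i \<omega>)"
proof -
  interpret M1: prob_space M1 by fact
  interpret M2: prob_space M2 by fact
  have [measurable]: "cis \<in> borel_measurable borel"
    by (intro borel_measurable_continuous_onI continuous_intros)
  \<comment> \<open>\<open>S\<close> holds the coordinates already turned into indicators.
    \<open>S = {}\<close> is the hypothesis, and \<open>S = I\<close> gives equality on
    boxes.\<close>
  have box: "(\<integral>\<omega>. (\<Prod>i\<in>S. indicator (B i) (X1 i \<omega>)) *\<^sub>R cis (\<Sum>i\<in>I - S. \<theta> i * X1 i \<omega>) \<partial>M1)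
      = (\<integral>\<omega>. (\<Prod>i\<in>S. indicator (B i) (X2 i \<omega>)) *\<^sub>R cis (\<Sum>i\<in>I - S. \<theta> i * X2 i \<omega>) \<partial>M2)"
    if "finite S" "S \<subseteq> I" "\<And>i. i \<in> I \<Longrightarrow> B i \<in> sets borel" for S B \<theta>
    using that
  proof (induction S arbitrary: \<theta> rule: finite_induct)
    case empty
    show ?case using eq[of \<theta>] by simp
  next
    case (insert x S)
    let ?I = "I - insert x S"
    let ?p1 = "\<lambda>\<omega>. \<Prod>i\<in>S. indicator (B i) (X1 i \<omega>) :: real" and ?s1 = "\<lambda>\<theta> \<omega>. \<Sum>i\<in>?I. \<theta> i * X1 i \<omega>"
    let ?p2 = "\<lambda>\<omega>. \<Prod>i\<in>S. indicator (B i) (X2 i \<omega>) :: real" and ?s2 = "\<lambda>\<theta> \<omega>. \<Sum>i\<in>?I. \<theta> i * X2 i \<omega>"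
    have x: "x \<in> I" "x \<notin> ?I" "I - S = insert x ?I" "finite ?I" "S \<subseteq> I"
      using insert.hyps insert.prems \<open>finite I\<close> by auto
    note [measurable] = X1[OF x(1)] X2[OF x(1)]
    have [measurable]: "B x \<in> sets borel" by (rule insert.prems(2)[OF x(1)])
    have IH: "(\<integral>\<omega>. ?p1 \<omega> *\<^sub>R cis (t * X1 x \<omega> + ?s1 \<theta> \<omega>) \<partial>M1) = (\<integral>\<omega>. ?p2 \<omega> *\<^sub>R cis (t * X2 x \<omega> + ?s2 \<theta> \<omega>) \<partial>M2)" for t \<theta>
    proof -
      have s: "(\<Sum>i\<in>I - S. (\<theta>(x := t)) i * Y i) = t * Y x + (\<Sum>i\<in>?I. \<theta> i * Y i)" for Y :: "'i \<Rightarrow> real"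
        unfolding x(3) sum.insert[OF x(4,2)] by (intro arg_cong2[of _ _ _ _ plus] sum.cong) auto
      show ?thesis using insert.IH[of "\<theta>(x := t)", OF x(5) insert.prems(2)] unfolding s .
    qed
    have [measurable]: "?p1 \<in> borel_measurable M1" "?s1 \<theta> \<in> borel_measurable M1"
      "?p2 \<in> borel_measurable M2" "?s2 \<theta> \<in> borel_measurable M2" for \<theta>
      using X1 X2 insert.prems x(5)
      by (auto intro!: borel_measurable_prod borel_measurable_sum borel_measurable_times
          measurable_compose[OF X1 borel_measurable_indicator] measurable_compose[OF X2 borel_measurable_indicator])
    have pb: "\<bar>\<Prod>i\<in>S. indicator (B i) (X i) :: real\<bar> \<le> 1" for X
      unfolding abs_prod by (intro prod_le_1) (auto simp: indicator_def)
    have b1: "\<bar>(\<Prod>i\<in>S. indicator (B i) (X i)) * y\<bar> \<le> 1" if "\<bar>y\<bar> \<le> 1" for X and y :: real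
      using mult_mono[OF pb[of X] that] by (simp add: abs_mult)
    define H1 where "H1 \<theta> t = (\<lambda>\<omega>. ?p1 \<omega> *\<^sub>R cis (t * X1 x \<omega> + ?s1 \<theta> \<omega>))" for \<theta> t
    define H2 where "H2 \<theta> t = (\<lambda>\<omega>. ?p2 \<omega> *\<^sub>R cis (t * X2 x \<omega> + ?s2 \<theta> \<omega>))" for \<theta> t
    have iH: "integrable M1 (H1 \<theta> t)" "integrable M2 (H2 \<theta> t)" for \<theta> t
      unfolding H1_def H2_def using pb
      by (auto intro!: M1.integrable_const_bound[where B=1] M2.integrable_const_bound[where B=1] AE_I2)
    have neg: "(\<Sum>i\<in>?I. - \<theta> i * Y i) = - (\<Sum>i\<in>?I. \<theta> i * Y i)" for Y :: "'i \<Rightarrow> real"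
      by (simp add: sum_negf)
    \<comment> \<open>The one-dimensional statement takes real weights, so the remaining exponential
      is split into cosine and sine. Each is a combination of \<open>cis\<close> at \<open>y\<close>
      and at \<open>- y\<close>, that is, of the induction hypothesis for \<open>\<theta>\<close>
      and for its negative.\<close>
    have trig: "(\<integral>\<omega>. (?p1 \<omega> * f (?s1 \<theta> \<omega>)) * indicator (B x) (X1 x \<omega>) \<partial>M1)
      = (\<integral>\<omega>. (?p2 \<omega> * f (?s2 \<theta> \<omega>)) * indicator (B x) (X2 x \<omega>) \<partial>M2)"
      if [measurable]: "f \<in> borel_measurable borel" and f1: "\<And>y. \<bar>f y\<bar> \<le> 1"
        and f: "\<And>p y s. (p * f y) *\<^sub>R cis s = c * (p *\<^sub>R cis (s + y)) + d * (p *\<^sub>R cis (s + - y))"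
      for f :: "real \<Rightarrow> real" and c d
    proof (rule integral_indicator_eq_of_char_eq[OF assms(1,2)])
      fix t
      have "(\<integral>\<omega>. (?p1 \<omega> * f (?s1 \<theta> \<omega>)) *\<^sub>R cis (t * X1 x \<omega>) \<partial>M1)
        = (\<integral>\<omega>. c * H1 \<theta> t \<omega> + d * H1 (\<lambda>i. - \<theta> i) t \<omega> \<partial>M1)"
        unfolding H1_def neg f ..
      also have "\<dots> = (\<integral>\<omega>. c * H2 \<theta> t \<omega> + d * H2 (\<lambda>i. - \<theta> i) t \<omega> \<partial>M2)"
        using iH IH[of t \<theta>] IH[of t "\<lambda>i. - \<theta> i"] unfolding H1_def[symmetric] H2_def[symmetric]
        by simp
      also have "\<dots> = (\<integral>\<omega>. (?p2 \<omega> * f (?s2 \<theta> \<omega>)) *\<^sub>R cis (t * X2 x \<omega>) \<partial>M2)"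
        unfolding H2_def neg f ..
      finally show "(\<integral>\<omega>. (?p1 \<omega> * f (?s1 \<theta> \<omega>)) *\<^sub>R cis (t * X1 x \<omega>) \<partial>M1)
        = (\<integral>\<omega>. (?p2 \<omega> * f (?s2 \<theta> \<omega>)) *\<^sub>R cis (t * X2 x \<omega>) \<partial>M2)" .
      have "(\<Sum>i\<in>I. (if i = x then t else 0) * Y i) = t * Y x" for Y :: "'i \<Rightarrow> real"
        using x(1) \<open>finite I\<close> by (simp add: if_distrib[of "\<lambda>c. c * _"] cong: if_cong)
      then show "(\<integral>\<omega>. cis (t * X1 x \<omega>) \<partial>M1) = (\<integral>\<omega>. cis (t * X2 x \<omega>) \<partial>M2)"
        using eq[of "\<lambda>i. if i = x then t else 0"] by simp
    qed (use b1 f1 in auto)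
    have C: "(p * cos y) *\<^sub>R cis s = (1 / 2) * (p *\<^sub>R cis (s + y)) + (1 / 2) * (p *\<^sub>R cis (s + - y))"
      and S: "(p * sin y) *\<^sub>R cis s = (- \<i> / 2) * (p *\<^sub>R cis (s + y)) + (\<i> / 2) * (p *\<^sub>R cis (s + - y))" for p y s :: real
      by (simp_all add: complex_eq_iff cos_add sin_add cos_diff sin_diff algebra_simps add_divide_distrib diff_divide_distrib)
    have split: "(\<Prod>i\<in>insert x S. indicator (B i) (Y i)) *\<^sub>R cis (\<Sum>i\<in>?I. \<theta> i * Y i)
      = complex_of_real ((\<Prod>i\<in>S. indicator (B i) (Y i)) * cos (\<Sum>i\<in>?I. \<theta> i * Y i) * indicator (B x) (Y x))
      + \<i> * complex_of_real ((\<Prod>i\<in>S. indicator (B i) (Y i)) * sin (\<Sum>i\<in>?I. \<theta> i * Y i) * indicator (B x) (Y x))" for Y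
      using insert.hyps by (simp add: complex_eq_iff del: of_real_prod)
    have bi: "\<bar>p * indicator (B x) y\<bar> \<le> 1" if "\<bar>p\<bar> \<le> 1" for p y :: real
      using that by (auto simp: indicator_def)
    have i: "integrable M1 (\<lambda>\<omega>. ?p1 \<omega> * f (?s1 \<theta> \<omega>) * indicator (B x) (X1 x \<omega>))"
      "integrable M2 (\<lambda>\<omega>. ?p2 \<omega> * f (?s2 \<theta> \<omega>) * indicator (B x) (X2 x \<omega>))"
      if [measurable]: "f \<in> borel_measurable borel" and f1: "\<And>y. \<bar>f y\<bar> \<le> 1" for f :: "real \<Rightarrow> real"
      by (auto intro!: M1.integrable_const_bound[where B=1] M2.integrable_const_bound[where B=1] AE_I2 bi b1 f1 simp del: abs_mult)
    show ?case
      unfolding split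
      using i[of cos] i[of sin] trig[OF _ _ C] trig[OF _ _ S]
      by (subst (1 2) Bochner_Integration.integral_add)
        (auto intro!: integrable_mult_right integrable_of_real simp del: of_real_mult)
  qed
  have m1: "(\<lambda>\<omega>. \<lambda>i\<in>I. X1 i \<omega>) \<in> measurable M1 (PiM I (\<lambda>_. borel))"
    and m2: "(\<lambda>\<omega>. \<lambda>i\<in>I. X2 i \<omega>) \<in> measurable M2 (PiM I (\<lambda>_. borel))"
    using X1 X2 by (auto intro!: measurable_restrict)
  show ?thesis
  proof (rule measure_eqI_PiM_finite[OF \<open>finite I\<close>, where A="\<lambda>_. space (PiM I (\<lambda>_. borel))"])
    fix A :: "'i \<Rightarrow> real set" assume A: "\<And>i. i \<in> I \<Longrightarrow> A i \<in> sets borel"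
    have ind: "indicator (Pi\<^sub>E I A) (\<lambda>i\<in>I. Y i) = (\<Prod>i\<in>I. indicator (A i) (Y i) :: real)" for Y
      using \<open>finite I\<close> by (auto simp: indicator_def PiE_iff prod_zero_iff)
    have PA: "Pi\<^sub>E I A \<in> sets (PiM I (\<lambda>_. borel))" using A \<open>finite I\<close> by (auto intro!: sets_PiM_I_finite)
    have "measure (distr M1 (PiM I (\<lambda>_. borel)) (\<lambda>\<omega>. \<lambda>i\<in>I. X1 i \<omega>)) (Pi\<^sub>E I A)
      = (\<integral>\<omega>. (\<Prod>i\<in>I. indicator (A i) (X1 i \<omega>)) \<partial>M1)"
      unfolding ind[symmetric] using m1 PA
      by (subst integral_distr[symmetric, where N="PiM I (\<lambda>_. borel)" and f="indicator (Pi\<^sub>E I A)"]) auto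
    moreover have "measure (distr M2 (PiM I (\<lambda>_. borel)) (\<lambda>\<omega>. \<lambda>i\<in>I. X2 i \<omega>)) (Pi\<^sub>E I A)
      = (\<integral>\<omega>. (\<Prod>i\<in>I. indicator (A i) (X2 i \<omega>)) \<partial>M2)"
      unfolding ind[symmetric] using m2 PA
      by (subst integral_distr[symmetric, where N="PiM I (\<lambda>_. borel)" and f="indicator (Pi\<^sub>E I A)"]) auto
    moreover have "complex_of_real (\<integral>\<omega>. (\<Prod>i\<in>I. indicator (A i) (X1 i \<omega>)) \<partial>M1)
      = complex_of_real (\<integral>\<omega>. (\<Prod>i\<in>I. indicator (A i) (X2 i \<omega>)) \<partial>M2)"
      using box[of I A "\<lambda>_. 0"] \<open>finite I\<close> A
      by (simp add: scaleR_conv_of_real del: of_real_prod)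
    ultimately show "emeasure (distr M1 (PiM I (\<lambda>_. borel)) (\<lambda>\<omega>. \<lambda>i\<in>I. X1 i \<omega>)) (Pi\<^sub>E I A)
      = emeasure (distr M2 (PiM I (\<lambda>_. borel)) (\<lambda>\<omega>. \<lambda>i\<in>I. X2 i \<omega>)) (Pi\<^sub>E I A)"
      using M1.prob_space_distr[OF m1] M2.prob_space_distr[OF m2]
      by (simp add: finite_measure.emeasure_eq_measure prob_space_def)
  next
    show "range (\<lambda>_. space (PiM I (\<lambda>_. borel :: real measure))) \<subseteq> prod_algebra I (\<lambda>_. borel)"
      using \<open>finite I\<close> by (auto simp: space_PiM intro!: prod_algebraI_finite)
    show "emeasure (distr M1 (PiM I (\<lambda>_. borel)) (\<lambda>\<omega>. \<lambda>i\<in>I. X1 i \<omega>)) (space (PiM I (\<lambda>_. borel))) \<noteq> \<infinity>"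
      using finite_measure.emeasure_finite[OF prob_space.finite_measure[OF M1.prob_space_distr[OF m1]]] by simp
  qed (use \<open>finite I\<close> in auto)
qed

section \<open>Densities of Gaussian recursions\<close>

lemma nn_integral_PiM_density:
  fixes F :: "('i \<Rightarrow> real) \<Rightarrow> ennreal"
  assumes "finite I" and "F \<in> borel_measurable (Leb I)"
    and [measurable]: "p \<in> borel_measurable borel" and "prob_space (density lborel p)"
  shows "(\<integral>\<^sup>+x. F x \<partial>PiM I (\<lambda>_. density lborel p)) = (\<integral>\<^sup>+x. F x * (\<Prod>i\<in>I. p (x i)) \<partial>Leb I)"
  using assms(1,2)
proof (induction I arbitrary: F rule: finite_induct)
  case empty
  then show ?case by (simp add: PiM_empty nn_integral_count_space_finite)
next
  case (insert i I)
  note [measurable] = insert.prems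
  interpret L: product_sigma_finite "\<lambda>_::'i. lborel :: real measure"
    by (simp add: product_sigma_finite_def sigma_finite_lborel)
  interpret P: product_sigma_finite "\<lambda>_::'i. density lborel p"
    using assms(4) by (simp add: product_sigma_finite_def prob_space_imp_sigma_finite)
  have sets_eq: "sets (PiM J (\<lambda>_. density lborel p)) = sets (Leb J)" for J :: "'i set"
    by (intro sets_PiM_cong) auto
  have upd: "(\<lambda>s. F (x(i := s))) \<in> borel_measurable borel" if "x \<in> space (Leb I)" for x
    using measurable_compose[OF measurable_component_update[OF that insert.hyps(2)] insert.prems]
    by (simp only: measurable_lborel1 measurable_lborel2)
  have pr: "(\<Prod>j\<in>I. p (if j = i then s else x j)) = (\<Prod>j\<in>I. p (x j))" for s x
    using insert.hyps by (intro prod.cong) auto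
  have "(\<integral>\<^sup>+x. F x \<partial>PiM (insert i I) (\<lambda>_. density lborel p))
    = (\<integral>\<^sup>+x. \<integral>\<^sup>+s. F (x(i := s)) \<partial>density lborel p \<partial>PiM I (\<lambda>_. density lborel p))"
    using insert.prems unfolding measurable_cong_sets[OF sets_eq[symmetric] refl]
    by (intro P.product_nn_integral_insert insert.hyps)
  also have "\<dots> = (\<integral>\<^sup>+x. \<integral>\<^sup>+s. p s * F (x(i := s)) \<partial>lborel \<partial>PiM I (\<lambda>_. density lborel p))"
  proof (intro nn_integral_cong nn_integral_density)
    fix x assume "x \<in> space (PiM I (\<lambda>_. density lborel p))"
    then show "(\<lambda>s. F (x(i := s))) \<in> borel_measurable lborel" using upd by (simp add: space_PiM)
  qed simp
  also have "\<dots> = (\<integral>\<^sup>+x. (\<integral>\<^sup>+s. p s * F (x(i := s)) \<partial>lborel) * (\<Prod>j\<in>I. p (x j)) \<partial>Leb I)"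
    by (intro insert.IH) measurable
  also have "\<dots> = (\<integral>\<^sup>+x. \<integral>\<^sup>+s. F (x(i := s)) * (\<Prod>j\<in>insert i I. p ((x(i := s)) j)) \<partial>lborel \<partial>Leb I)"
  proof (intro nn_integral_cong)
    fix x assume x: "x \<in> space (Leb I)"
    have "(\<integral>\<^sup>+s. p s * F (x(i := s)) \<partial>lborel) * (\<Prod>j\<in>I. p (x j))
      = (\<integral>\<^sup>+s. p s * F (x(i := s)) * (\<Prod>j\<in>I. p (x j)) \<partial>lborel)"
      using upd[OF x] by (intro nn_integral_multc[symmetric]) simp
    then show "(\<integral>\<^sup>+s. p s * F (x(i := s)) \<partial>lborel) * (\<Prod>j\<in>I. p (x j))
      = (\<integral>\<^sup>+s. F (x(i := s)) * (\<Prod>j\<in>insert i I. p ((x(i := s)) j)) \<partial>lborel)"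
      using insert.hyps by (simp add: pr mult_ac)
  qed
  also have "\<dots> = (\<integral>\<^sup>+x. F x * (\<Prod>j\<in>insert i I. p (x j)) \<partial>Leb (insert i I))"
    by (subst L.product_nn_integral_insert[OF insert.hyps]) auto
  finally show ?case .
qed

text \<open>\<open>Y\<close> is obtained from independent normal variables by a triangular recursion; its density follows
  by replacing the coordinates of \<open>N\<close> by those of \<open>Y\<close> one at a time, in the order of \<open>rk\<close>.\<close>

lemma nn_integral_gaussian_recursion:
  fixes N Y :: "'i \<Rightarrow> 'a \<Rightarrow> real" and g :: "'i \<Rightarrow> ('i \<Rightarrow> real) \<Rightarrow> real" and rk :: "'i \<Rightarrow> 'r :: linorder"
  assumes "finite I"
    and N: "\<And>i. i \<in> I \<Longrightarrow> N i \<in> borel_measurable M"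
    and Y: "\<And>i. i \<in> I \<Longrightarrow> Y i \<in> borel_measurable M"
    and law: "distr M (PiM I (\<lambda>_. borel)) (\<lambda>\<omega>. \<lambda>i\<in>I. N i \<omega>) = PiM I (\<lambda>_. std_normal_distribution)"
    and g: "\<And>i. i \<in> I \<Longrightarrow> g i \<in> borel_measurable (Leb I)"
    and g_cong: "\<And>i x y. i \<in> I \<Longrightarrow> (\<And>j. j \<in> I \<Longrightarrow> rk j < rk i \<Longrightarrow> x j = y j) \<Longrightarrow> g i x = g i y"
    and \<sigma>: "\<And>i. i \<in> I \<Longrightarrow> 0 < \<sigma> i"
    and rec: "AE \<omega> in M. \<forall>i\<in>I. Y i \<omega> = g i (\<lambda>i\<in>I. Y i \<omega>) + \<sigma> i * N i \<omega>"
    and F: "F \<in> borel_measurable (Leb I)"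
  shows "(\<integral>\<^sup>+\<omega>. F (\<lambda>i\<in>I. Y i \<omega>) \<partial>M)
    = (\<integral>\<^sup>+x. F x * (\<Prod>i\<in>I. ennreal (normal_density (g i x) (\<sigma> i) (x i))) \<partial>Leb I)"
proof -
  define mix where "mix S \<omega> = (\<lambda>i\<in>I. if i \<in> S then Y i \<omega> else N i \<omega>)" for S \<omega>
  define G where "G S x = (\<Prod>i\<in>S. ennreal (normal_density (g i x) (\<sigma> i) (x i))) * (\<Prod>i\<in>I - S. ennreal (std_normal_density (x i)))" for S x
  have comp [measurable]: "(\<lambda>x. x i) \<in> borel_measurable (Leb I)" if "i \<in> I" for i
    using measurable_component_singleton[OF that, of "\<lambda>_. lborel :: real measure"] by simp
  have nd: "(\<lambda>x. ennreal (normal_density (g i x) (\<sigma> i) (x i))) \<in> borel_measurable (Leb I)" if "i \<in> I" for i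
    using g[OF that] comp[OF that] unfolding normal_density_def by measurable
  have G_meas: "G S \<in> borel_measurable (Leb I)" if "S \<subseteq> I" for S
    unfolding G_def
    by (intro borel_measurable_times_ennreal borel_measurable_prod_ennreal measurable_compose[OF comp]) (use that nd in auto)
  \<comment> \<open>\<open>S\<close> runs through initial segments of the ranking. Ties are harmless
    because \<open>g i\<close> reads only strictly smaller ranks: when \<open>x\<close> is added,
    everything it depends on is already in \<open>S\<close>, and nothing in \<open>S\<close> depends
    on \<open>x\<close>.\<close>
  have "(\<forall>i\<in>S. \<forall>j\<in>I. rk j < rk i \<longrightarrow> j \<in> S) \<longrightarrow> S \<subseteq> I \<longrightarrow>
      (\<forall>F. F \<in> borel_measurable (Leb I) \<longrightarrow>
        (\<integral>\<^sup>+\<omega>. F (mix S \<omega>) \<partial>M) = (\<integral>\<^sup>+x. F x * G S x \<partial>Leb I))"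
    if "finite S" for S
    using that
  proof (induction S rule: finite_ranking_induct[where f=rk])
    case empty
    show ?case
    proof (intro impI allI)
      fix F :: "('i \<Rightarrow> real) \<Rightarrow> ennreal" assume F: "F \<in> borel_measurable (Leb I)"
      have s: "sets (PiM I (\<lambda>_. borel :: real measure)) = sets (Leb I)"
        by (intro sets_PiM_cong) auto
      have F': "F \<in> borel_measurable (PiM I (\<lambda>_. borel))"
        using F unfolding measurable_cong_sets[OF s refl] .
      have mN: "(\<lambda>\<omega>. \<lambda>i\<in>I. N i \<omega>) \<in> measurable M (PiM I (\<lambda>_. borel))"
        using N by (intro measurable_restrict) auto
      have "(\<integral>\<^sup>+\<omega>. F (mix {} \<omega>) \<partial>M) = (\<integral>\<^sup>+x. F x \<partial>distr M (PiM I (\<lambda>_. borel)) (\<lambda>\<omega>. \<lambda>i\<in>I. N i \<omega>))"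
        unfolding mix_def by (subst nn_integral_distr[OF mN]) (simp_all add: F')
      also have "\<dots> = (\<integral>\<^sup>+x. F x * G {} x \<partial>Leb I)"
        unfolding law G_def using prob_space_normal_density[of 1 0]
        by (subst nn_integral_PiM_density[OF \<open>finite I\<close> F]) auto
      finally show "(\<integral>\<^sup>+\<omega>. F (mix {} \<omega>) \<partial>M) = (\<integral>\<^sup>+x. F x * G {} x \<partial>Leb I)" .
    qed
  next
    case (insert x S)
    show ?case
    proof (cases "x \<in> S")
      case True
      then show ?thesis using insert by (simp add: insert_absorb)
    next
      case False
      show ?thesis
      proof (intro impI allI)
        fix F :: "('i \<Rightarrow> real) \<Rightarrow> ennreal" assume F: "F \<in> borel_measurable (Leb I)"
        assume down: "\<forall>i\<in>insert x S. \<forall>j\<in>I. rk j < rk i \<longrightarrow> j \<in> insert x S" and sub: "insert x S \<subseteq> I"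
        have downS: "\<forall>i\<in>S. \<forall>j\<in>I. rk j < rk i \<longrightarrow> j \<in> S"
          using down insert.hyps by (metis insert_iff leD)
        have below: "\<And>j. j \<in> I \<Longrightarrow> rk j < rk x \<Longrightarrow> j \<in> S" using down by auto
        have x: "x \<in> I" and SI: "S \<subseteq> I" using sub by auto
        define J where "J = I - {x}"
        have J: "finite J" "x \<notin> J" "I = insert x J" "S \<subseteq> J"
          using \<open>finite I\<close> x False SI by (auto simp: J_def)
        interpret L: product_sigma_finite "\<lambda>_::'i. lborel :: real measure"
          by (simp add: product_sigma_finite_def sigma_finite_lborel)
        \<comment> \<open>Replaces the noise \<open>N x\<close> by \<open>Y x\<close>. Since
          \<open>g x\<close> ignores coordinate \<open>x\<close>, this is an affine map of slope
          \<open>\<sigma> x\<close> on each line parallel to that coordinate.\<close>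
        define T where "T y = y(x := g x y + \<sigma> x * y x)" for y
        have T: "T \<in> measurable (Leb I) (Leb I)"
        proof -
          have "T y = (\<lambda>i\<in>I. if i = x then g x y + \<sigma> x * y x else y i)" if "y \<in> space (Leb I)" for y
            using that x by (auto simp: T_def space_PiM PiE_iff extensional_def)
          moreover have "(\<lambda>y. \<lambda>i\<in>I. if i = x then g x y + \<sigma> x * y x else y i) \<in> measurable (Leb I) (Leb I)"
            using g[OF x] comp x by (intro measurable_restrict) auto
          ultimately show ?thesis by (simp cong: measurable_cong)
        qed
        have FT: "(\<lambda>y. F (T y)) \<in> borel_measurable (Leb I)"
          using T F by (rule measurable_compose)
        have "(\<integral>\<^sup>+\<omega>. F (mix (insert x S) \<omega>) \<partial>M) = (\<integral>\<^sup>+\<omega>. F (T (mix S \<omega>)) \<partial>M)"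
        proof (rule nn_integral_cong_AE)
          show "AE \<omega> in M. F (mix (insert x S) \<omega>) = F (T (mix S \<omega>))"
            using rec
          proof (rule AE_mp, intro AE_I2 impI)
            fix \<omega> assume r: "\<forall>i\<in>I. Y i \<omega> = g i (\<lambda>i\<in>I. Y i \<omega>) + \<sigma> i * N i \<omega>"
            have "g x (\<lambda>i\<in>I. Y i \<omega>) = g x (mix S \<omega>)"
              by (rule g_cong[OF x]) (simp add: mix_def below)
            then have "mix (insert x S) \<omega> = T (mix S \<omega>)"
              using r x False by (auto simp: T_def mix_def fun_eq_iff)
            then show "F (mix (insert x S) \<omega>) = F (T (mix S \<omega>))" by simp
          qed
        qed
        also have "\<dots> = (\<integral>\<^sup>+y. F (T y) * G S y \<partial>Leb I)"
          using insert.IH downS SI FT by blast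
        also have "\<dots> = (\<integral>\<^sup>+y. \<integral>\<^sup>+s. F (T (y(x := s))) * G S (y(x := s)) \<partial>lborel \<partial>Leb J)"
          unfolding J(3) using FT G_meas[OF SI]
          by (intro L.product_nn_integral_insert J borel_measurable_times_ennreal) (auto simp: J(3))
        also have "\<dots> = (\<integral>\<^sup>+y. \<integral>\<^sup>+s. F (y(x := s)) * G (insert x S) (y(x := s)) \<partial>lborel \<partial>Leb J)"
        proof (rule nn_integral_cong)
          fix y assume y: "y \<in> space (Leb J)"
          define m where "m = g x (y(x := 0))"
          define C where "C = (\<Prod>i\<in>S. ennreal (normal_density (g i (y(x := 0))) (\<sigma> i) (y i)))
            * (\<Prod>i\<in>I - insert x S. ennreal (std_normal_density (y i)))"
          have gx: "g x (y(x := s)) = m" for s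
            unfolding m_def by (rule g_cong[OF x]) auto
          have gi: "g i (y(x := s)) = g i (y(x := 0))" if "i \<in> S" for i s
            using that insert.hyps(2)[OF that] SI by (intro g_cong) auto
          have IS: "I - S = insert x (I - insert x S)" using x False by auto
          have pS: "(\<Prod>i\<in>S. ennreal (normal_density (g i (y(x := s))) (\<sigma> i) ((y(x := s)) i)))
              = (\<Prod>i\<in>S. ennreal (normal_density (g i (y(x := 0))) (\<sigma> i) (y i)))" for s
          proof (intro prod.cong refl)
            fix i assume i: "i \<in> S"
            then have "(y(x := s)) i = y i" using False by auto
            then show "ennreal (normal_density (g i (y(x := s))) (\<sigma> i) ((y(x := s)) i))
              = ennreal (normal_density (g i (y(x := 0))) (\<sigma> i) (y i))"
              by (simp only: gi[OF i, of s])
          qed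
          have pI: "(\<Prod>i\<in>I - insert x S. ennreal (std_normal_density ((y(x := s)) i)))
              = (\<Prod>i\<in>I - insert x S. ennreal (std_normal_density (y i)))" for s
            by (intro prod.cong) auto
          have GS: "G S (y(x := s)) = ennreal (std_normal_density s) * C" for s
          proof -
            have "(\<Prod>i\<in>I - S. ennreal (std_normal_density ((y(x := s)) i)))
              = ennreal (std_normal_density s) * (\<Prod>i\<in>I - insert x S. ennreal (std_normal_density ((y(x := s)) i)))"
              unfolding IS by (subst prod.insert) (use \<open>finite I\<close> in auto)
            then show ?thesis unfolding G_def C_def pS pI by (simp add: mult_ac)
          qed
          have GxS: "G (insert x S) (y(x := s)) = ennreal (normal_density m (\<sigma> x) s) * C" for s
            unfolding G_def C_def using insert.hyps(1) False
            by (subst prod.insert) (simp_all only: pS pI gx fun_upd_same mult.assoc simp_thms)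
          have Fm [measurable]: "(\<lambda>s. F (y(x := s))) \<in> borel_measurable borel"
            using measurable_compose[OF measurable_component_update[OF y J(2)] F[unfolded J(3)]]
            by (simp only: measurable_lborel1 measurable_lborel2)
          have T': "T (y(x := s)) = y(x := m + \<sigma> x * s)" for s
            unfolding T_def gx by simp
          \<comment> \<open>The Jacobian \<open>\<sigma> x\<close> of the substitution is exactly
            what turns the normal density of deviation \<open>\<sigma> x\<close> into the standard
            one.\<close>
          have nds: "ennreal (\<sigma> x) * ennreal (normal_density m (\<sigma> x) (m + \<sigma> x * s)) = ennreal (std_normal_density s)" for s
            using \<sigma>[OF x]
            by (simp add: ennreal_mult[symmetric] normal_density_def power_mult_distrib real_sqrt_mult)
          have "(\<integral>\<^sup>+s. F (y(x := s)) * G (insert x S) (y(x := s)) \<partial>lborel)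
            = (\<integral>\<^sup>+s. F (y(x := s)) * (ennreal (normal_density m (\<sigma> x) s) * C) \<partial>lborel)"
            unfolding GxS ..
          also have "\<dots> = ennreal \<bar>\<sigma> x\<bar> * (\<integral>\<^sup>+s. F (y(x := m + \<sigma> x * s)) * (ennreal (normal_density m (\<sigma> x) (m + \<sigma> x * s)) * C) \<partial>lborel)"
            using \<sigma>[OF x] by (intro nn_integral_real_affine[where c="\<sigma> x" and t=m]) auto
          also have "\<dots> = (\<integral>\<^sup>+s. ennreal (\<sigma> x) * (F (y(x := m + \<sigma> x * s)) * (ennreal (normal_density m (\<sigma> x) (m + \<sigma> x * s)) * C)) \<partial>lborel)"
            using \<sigma>[OF x] by (subst nn_integral_cmult[symmetric]) (auto intro!: borel_measurable_times_ennreal measurable_compose[OF _ Fm])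
          also have "\<dots> = (\<integral>\<^sup>+s. F (T (y(x := s))) * G S (y(x := s)) \<partial>lborel)"
            unfolding T' GS nds[symmetric] by (simp only: mult_ac)
          finally show "(\<integral>\<^sup>+s. F (T (y(x := s))) * G S (y(x := s)) \<partial>lborel)
            = (\<integral>\<^sup>+s. F (y(x := s)) * G (insert x S) (y(x := s)) \<partial>lborel)" by simp
        qed
        also have "\<dots> = (\<integral>\<^sup>+y. F y * G (insert x S) y \<partial>Leb I)"
          unfolding J(3) using F G_meas[OF sub]
          by (intro L.product_nn_integral_insert[symmetric] J borel_measurable_times_ennreal) (auto simp: J(3))
        finally show "(\<integral>\<^sup>+\<omega>. F (mix (insert x S) \<omega>) \<partial>M) = (\<integral>\<^sup>+y. F y * G (insert x S) y \<partial>Leb I)" .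
      qed
    qed
  qed
  from this[OF \<open>finite I\<close>] F have "(\<integral>\<^sup>+\<omega>. F (mix I \<omega>) \<partial>M) = (\<integral>\<^sup>+x. F x * G I x \<partial>Leb I)"
    by blast
  then show ?thesis by (simp add: mix_def G_def cong: restrict_cong)
qed

section \<open>Brownian bridges on a finite grid\<close>

text \<open>Enumerating \<open>S\<close> transports the definition from indices \<open>l < n\<close>
  to arbitrary finite index sets. The labels \<open>(J s, U s)\<close> may repeat, which matters
  because a grid time occurs both as itself and as the predecessor of the next one.\<close>

lemma bridge_char_finite:
  assumes br: "indep_std_bridges M k a b W" and "finite S"
    and J: "\<And>s. s \<in> S \<Longrightarrow> J s \<in> {1..k}" and U: "\<And>s. s \<in> S \<Longrightarrow> U s \<in> {a..b}"
  shows "(\<integral>\<omega>. cis (\<Sum>s\<in>S. \<theta> s * W (J s) \<omega> (U s)) \<partial>M) =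
    complex_of_real (exp (-(1/2) * (\<Sum>s\<in>S. \<Sum>r\<in>S. \<theta> s * \<theta> r * (if J s = J r then bb_cov a b (U s) (U r) else 0))))"
proof -
  obtain h where h: "bij_betw h {..<card S} S"
    using ex_bij_betw_nat_finite[OF \<open>finite S\<close>] by (auto simp: atLeast0LessThan)
  have hS: "h l \<in> S" if "l < card S" for l using h that by (auto simp: bij_betw_def)
  have c: "\<forall>l<card S. (J \<circ> h) l \<in> {1..k} \<and> (U \<circ> h) l \<in> {a..b}" using J U hS by auto
  have char: "(\<integral>\<omega>. cis (\<Sum>l<card S. (\<theta> \<circ> h) l * W ((J \<circ> h) l) \<omega> ((U \<circ> h) l)) \<partial>M) =
    complex_of_real (exp (-(1/2) * (\<Sum>l<card S. \<Sum>m<card S. (\<theta> \<circ> h) l * (\<theta> \<circ> h) m *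
      (if (J \<circ> h) l = (J \<circ> h) m then bb_cov a b ((U \<circ> h) l) ((U \<circ> h) m) else 0))))"
    using br c unfolding indep_std_bridges_def by blast
  have "(\<Sum>s\<in>S. f s) = (\<Sum>l<card S. f (h l))" for f :: "'b \<Rightarrow> real"
    by (rule sum.reindex_bij_betw[OF h, symmetric])
  with char[unfolded o_def] show ?thesis by simp
qed

text \<open>The variance of \<open>W u / (b - u)\<close> for a standard bridge \<open>W\<close>: the
  clock in which the rescaled bridge is a Brownian motion. It starts at \<open>0\<close> in
  \<open>a\<close> and tends to infinity at \<open>b\<close>.\<close>

definition tau :: "real \<Rightarrow> real \<Rightarrow> real \<Rightarrow> real" where
  "tau a b u = (u - a) / ((b - a) * (b - u))"

definition prd :: "real \<Rightarrow> real set \<Rightarrow> real \<Rightarrow> real" where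
  "prd a U u = Max (insert a {v\<in>U. v < u})"

definition dtau :: "real \<Rightarrow> real \<Rightarrow> real set \<Rightarrow> real \<Rightarrow> real" where
  "dtau a b U u = tau a b u - tau a b (prd a U u)"

lemma tau_strict_mono: "a \<le> u \<Longrightarrow> u < v \<Longrightarrow> v < b \<Longrightarrow> tau a b u < tau a b v"
proof -
  assume u: "a \<le> u" "u < v" "v < b"
  then have "(u - a) * (b - v) < (v - a) * (b - u)"
    by (smt (verit, best) mult_less_cancel_right mult_le_cancel_left mult_less_cancel_left)
  then show ?thesis using u
    by (simp add: tau_def divide_simps mult_ac)
qed

lemma tau_self [simp]: "tau a b a = 0"
  by (simp add: tau_def)

section \<open>Increments along a finite grid\<close>

context
  fixes a b :: real and U :: "real set"
  assumes U: "finite U" "U \<subseteq> {a<..<b}"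
begin

lemma prd_bounds:
  assumes "u \<in> U"
  shows "a \<le> prd a U u" "prd a U u < u" "prd a U u \<in> insert a U"
    and "\<And>v. v \<in> U \<Longrightarrow> v < u \<Longrightarrow> v \<le> prd a U u" "prd a U u < b"
proof -
  have f: "finite (insert a {v\<in>U. v < u})" using U by simp
  have m: "prd a U u \<in> insert a {v\<in>U. v < u}" unfolding prd_def by (rule Max_in[OF f]) auto
  show "a \<le> prd a U u" unfolding prd_def by (rule Max_ge[OF f]) auto
  show lt: "prd a U u < u" "prd a U u \<in> insert a U" using m assms U by auto
  show "\<And>v. v \<in> U \<Longrightarrow> v < u \<Longrightarrow> v \<le> prd a U u" unfolding prd_def by (rule Max_ge[OF f]) auto
  show "prd a U u < b" using lt(1) assms U by force
qed

lemma dtau_pos: "u \<in> U \<Longrightarrow> 0 < dtau a b U u"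
  using prd_bounds[of u] U by (auto simp: dtau_def intro!: tau_strict_mono)

text \<open>Because \<open>(b - s) * (b - t)\<close> is also the product over the minimum and the
  maximum of \<open>s\<close> and \<open>t\<close>, the rescaled covariance collapses to
  \<open>tau\<close> of the minimum, as for Brownian motion. Increments over distinct grid steps are
  then uncorrelated.\<close>

lemma cov_increments:
  assumes "u \<in> U" "v \<in> U"
  defines "c \<equiv> \<lambda>s t. bb_cov a b s t / ((b - s) * (b - t))"
  shows "c u v - c u (prd a U v) - c (prd a U u) v + c (prd a U u) (prd a U v)
    = (if u = v then dtau a b U u else 0)"
proof -
  have c: "c s t = tau a b (min s t)" if "a \<le> s" "a \<le> t" "s < b" "t < b" for s t
  proof -
    have "(b - s) * (b - t) = (b - min s t) * (b - max s t)" by (auto simp: min_def max_def)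
    moreover have "b - max s t \<noteq> 0" "b - min s t \<noteq> 0" using that by auto
    ultimately show ?thesis unfolding c_def bb_cov_def tau_def by (simp add: divide_simps)
  qed
  note b = prd_bounds[OF assms(1)] prd_bounds[OF assms(2)]
  have ab: "a < u" "u < b" "a < v" "v < b" using U assms by auto
  consider "u < v" | "v < u" | "u = v" by linarith
  then show ?thesis
  proof cases
    case 1
    then have "u \<le> prd a U v" "prd a U u < prd a U v" using b assms by force+
    then show ?thesis using 1 b ab by (simp add: c min_absorb1 min_absorb2)
  next
    case 2
    then have "v \<le> prd a U u" "prd a U v < prd a U u" using b assms by force+
    then show ?thesis using 2 b ab by (simp add: c min_absorb1 min_absorb2)
  next
    case 3
    then show ?thesis using b ab by (simp add: c min_absorb1 min_absorb2 dtau_def)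
  qed
qed

text \<open>Telescoping from \<open>a\<close> to the last grid time. It evaluates the total drift
  term in the lattice inequality for bridge densities.\<close>

lemma sum_diff_prd: "(\<Sum>u\<in>U. \<psi> u - \<psi> (prd a U u)) = \<psi> (Max (insert a U)) - \<psi> (a :: real)" for \<psi> :: "real \<Rightarrow> real"
  using U
proof (induction U rule: finite_linorder_max_induct)
  case empty
  then show ?case by simp
next
  case (insert v A)
  have "prd a (insert v A) u = prd a A u" if "u \<in> A" for u
  proof -
    have "{x\<in>insert v A. x < u} = {x\<in>A. x < u}" using insert(2)[rule_format, OF that] by auto
    then show ?thesis by (simp add: prd_def)
  qed
  moreover have "prd a (insert v A) v = Max (insert a A)"
  proof -
    have "{x\<in>insert v A. x < v} = A" using insert(2) by auto
    then show ?thesis by (simp add: prd_def)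
  qed
  moreover have "Max (insert a (insert v A)) = v"
    using insert by (intro Max_eqI) (auto intro: less_imp_le)
  moreover have "v \<notin> A" using insert(2) by auto
  ultimately show ?case using insert by simp
qed

end

text \<open>The increment of the rescaled bridge over one grid step, divided by its standard
  deviation. The map \<open>\<tau>\<close> tells which line sits at a coordinate, so that one
  construction serves both copies.\<close>

definition incr :: "real \<Rightarrow> real \<Rightarrow> real set \<Rightarrow> (nat \<Rightarrow> 's \<Rightarrow> real \<Rightarrow> real) \<Rightarrow> (nat \<Rightarrow> nat) \<Rightarrow> nat \<times> real \<Rightarrow> 's \<Rightarrow> real" where
  "incr a b U W \<tau> i \<omega> = (W (\<tau> (fst i)) \<omega> (snd i) / (b - snd i) -
     W (\<tau> (fst i)) \<omega> (prd a U (snd i)) / (b - prd a U (snd i))) / sqrt (dtau a b U (snd i))"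

lemma incr_char:
  assumes br: "indep_std_bridges M k a b W" and U: "finite U" "U \<subseteq> {a<..<b}"
    and L: "finite L" "inj_on \<tau> L" "\<tau> ` L \<subseteq> {1..k}"
  shows "(\<integral>\<omega>. cis (\<Sum>i\<in>L \<times> U. \<theta> i * incr a b U W \<tau> i \<omega>) \<partial>M) = complex_of_real (exp (-(1/2) * (\<Sum>i\<in>L \<times> U. (\<theta> i)\<^sup>2)))"
proof -
  \<comment> \<open>Each increment consists of two evaluations of a bridge: the flag
    \<open>True\<close> marks the grid time itself, \<open>False\<close> its predecessor, which
    enters with the opposite sign.\<close>
  define V where "V s = (if snd s then snd (fst s) else prd a U (snd (fst s)))" for s :: "(nat \<times> real) \<times> bool"
  define J where "J s = \<tau> (fst (fst s))" for s :: "(nat \<times> real) \<times> bool"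
  define c where "c s = (if snd s then 1 else -1) * \<theta> (fst s) / sqrt (dtau a b U (snd (fst s))) / (b - V s)"
    for s :: "(nat \<times> real) \<times> bool"
  define S where "S = (L \<times> U) \<times> (UNIV :: bool set)"
  have lin: "(\<Sum>i\<in>L \<times> U. \<theta> i * incr a b U W \<tau> i \<omega>) = (\<Sum>s\<in>S. c s * W (J s) \<omega> (V s))" for \<omega>
  proof -
    have "(\<Sum>s\<in>S. c s * W (J s) \<omega> (V s)) = (\<Sum>i\<in>L \<times> U. \<Sum>e\<in>UNIV. c (i, e) * W (J (i, e)) \<omega> (V (i, e)))"
      unfolding S_def by (rule sum.cartesian_product')
    also have "\<dots> = (\<Sum>i\<in>L \<times> U. \<theta> i * incr a b U W \<tau> i \<omega>)"
      by (intro sum.cong refl) (simp add: UNIV_bool c_def J_def V_def incr_def diff_divide_distrib algebra_simps)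
    finally show ?thesis ..
  qed
  have quad: "(\<Sum>s\<in>S. \<Sum>r\<in>S. c s * c r * (if J s = J r then bb_cov a b (V s) (V r) else 0)) = (\<Sum>i\<in>L \<times> U. (\<theta> i)\<^sup>2)"
  proof -
    define q where "q s r = c s * c r * (if J s = J r then bb_cov a b (V s) (V r) else 0)" for s r
    have "(\<Sum>s\<in>S. \<Sum>r\<in>S. q s r) = (\<Sum>i\<in>L \<times> U. \<Sum>e\<in>UNIV. \<Sum>i'\<in>L \<times> U. \<Sum>e'\<in>UNIV. q (i, e) (i', e'))"
      unfolding S_def by (simp only: sum.cartesian_product')
    also have "\<dots> = (\<Sum>i\<in>L \<times> U. \<Sum>i'\<in>L \<times> U. \<Sum>e\<in>UNIV. \<Sum>e'\<in>UNIV. q (i, e) (i', e'))"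
      by (intro sum.cong refl sum.swap)
    also have "\<dots> = (\<Sum>i\<in>L \<times> U. \<Sum>i'\<in>L \<times> U. if i = i' then (\<theta> i)\<^sup>2 else 0)"
    proof (intro sum.cong refl)
      fix i i' assume i: "i \<in> L \<times> U" "i' \<in> L \<times> U"
      obtain j u where iu: "i = (j, u)" "j \<in> L" "u \<in> U" using i(1) by auto
      obtain j' v where iv: "i' = (j', v)" "j' \<in> L" "v \<in> U" using i(2) by auto
      define K where "K s t = bb_cov a b s t / ((b - s) * (b - t))" for s t
      let ?A = "\<theta> i / sqrt (dtau a b U u)" and ?B = "\<theta> i' / sqrt (dtau a b U v)"
      show "(\<Sum>e\<in>UNIV. \<Sum>e'\<in>UNIV. q (i, e) (i', e')) = (if i = i' then (\<theta> i)\<^sup>2 else 0)"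
      proof (cases "j = j'")
        case False
        then have "\<tau> j \<noteq> \<tau> j'" using L(2) iu iv by (auto simp: inj_on_def)
        then show ?thesis using False by (simp add: q_def J_def iu iv)
      next
        case True
        have "(\<Sum>e\<in>UNIV. \<Sum>e'\<in>UNIV. q (i, e) (i', e'))
          = ?A * ?B * (K u v - K u (prd a U v) - K (prd a U u) v + K (prd a U u) (prd a U v))"
        proof -
          define R where "R = ?A * ?B"
          have "q (i, e) (i', e') = (if e then 1 else -1) * (if e' then 1 else -1) * R
            * K (if e then u else prd a U u) (if e' then v else prd a U v)" for e e'
            unfolding R_def q_def J_def c_def V_def K_def iu iv by (simp add: True mult_ac)
          then show ?thesis unfolding R_def[symmetric] by (simp add: UNIV_bool algebra_simps)
        qed
        also have "\<dots> = ?A * ?B * (if u = v then dtau a b U u else 0)"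
          unfolding K_def cov_increments[OF U iu(3) iv(3)] ..
        also have "\<dots> = (if i = i' then (\<theta> i)\<^sup>2 else 0)"
          using dtau_pos[OF U iu(3)] True by (auto simp: iu iv power2_eq_square)
        finally show ?thesis .
      qed
    qed
    also have "\<dots> = (\<Sum>i\<in>L \<times> U. (\<theta> i)\<^sup>2)" using L(1) U(1) by (simp add: sum.delta)
    finally show ?thesis unfolding q_def .
  qed
  have "J s \<in> {1..k}" "V s \<in> {a..b}" if "s \<in> S" for s
    using that L(3) prd_bounds[OF U, of "snd (fst s)"] U(2) by (auto simp: S_def J_def V_def intro: less_imp_le)
  then show ?thesis
    unfolding lin using bridge_char_finite[OF br, of S J V c] L(1) U(1) by (simp add: quad) (simp add: S_def)
qed

section \<open>Laws on the grid: independent normal increments and degenerate endpoints\<close>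

lemma std_normal_PiM_char:
  assumes "finite I"
  shows "(\<integral>x. cis (\<Sum>i\<in>I. \<theta> i * x i) \<partial>PiM I (\<lambda>_. std_normal_distribution)) = complex_of_real (exp (-(1/2) * (\<Sum>i\<in>I. (\<theta> i)\<^sup>2)))"
proof -
  interpret P: product_sigma_finite "\<lambda>_::'a. std_normal_distribution"
    using prob_space_normal_density[of 1 0] by (simp add: product_sigma_finite_def prob_space_imp_sigma_finite)
  interpret N: real_distribution std_normal_distribution by (rule real_dist_normal_dist)
  have [measurable]: "cis \<in> borel_measurable borel"
    by (intro borel_measurable_continuous_onI continuous_intros)
  have cs: "cis (\<Sum>i\<in>I. \<theta> i * x i) = (\<Prod>i\<in>I. cis (\<theta> i * x i))" for x :: "'a \<Rightarrow> real"
    using assms by (simp add: cis_conv_exp exp_sum sum_distrib_left)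
  have "(\<integral>x. cis (\<Sum>i\<in>I. \<theta> i * x i) \<partial>PiM I (\<lambda>_. std_normal_distribution)) = (\<Prod>i\<in>I. \<integral>x. cis (\<theta> i * x) \<partial>std_normal_distribution)"
    unfolding cs by (intro P.product_integral_prod assms N.integrable_const_bound[where B=1]) auto
  also have "\<dots> = (\<Prod>i\<in>I. char std_normal_distribution (\<theta> i))"
    by (simp add: char_def cis_conv_exp)
  also have "\<dots> = complex_of_real (exp (\<Sum>i\<in>I. - (\<theta> i)\<^sup>2 / 2))"
    unfolding char_std_normal_distribution using assms by (simp add: exp_sum)
  also have "(\<Sum>i\<in>I. - (\<theta> i)\<^sup>2 / 2) = -(1/2) * (\<Sum>i\<in>I. (\<theta> i)\<^sup>2)"
    by (simp add: sum_distrib_left)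
  finally show ?thesis .
qed

lemma W_measurable:
  "indep_std_bridges M k a b W \<Longrightarrow> j \<in> {1..k} \<Longrightarrow> u \<in> {a..b} \<Longrightarrow> (\<lambda>\<omega>. W j \<omega> u) \<in> borel_measurable M"
  by (simp add: indep_std_bridges_def)

lemma incr_law:
  assumes "prob_space M" and br: "indep_std_bridges M k a b W" and U: "finite U" "U \<subseteq> {a<..<b}"
    and L: "finite L" "inj_on \<tau> L" "\<tau> ` L \<subseteq> {1..k}"
  shows "distr M (PiM (L \<times> U) (\<lambda>_. borel)) (\<lambda>\<omega>. \<lambda>i\<in>L \<times> U. incr a b U W \<tau> i \<omega>) = PiM (L \<times> U) (\<lambda>_. std_normal_distribution)"
    and "i \<in> L \<times> U \<Longrightarrow> incr a b U W \<tau> i \<in> borel_measurable M"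
proof -
  let ?I = "L \<times> U" and ?P = "PiM (L \<times> U) (\<lambda>_. std_normal_distribution)"
  have fin: "finite ?I" using U(1) L(1) by simp
  have m: "incr a b U W \<tau> i \<in> borel_measurable M" if "i \<in> ?I" for i
  proof -
    have "\<tau> (fst i) \<in> {1..k}" "snd i \<in> {a..b}" "prd a U (snd i) \<in> {a..b}"
      using that L(3) U(2) prd_bounds[OF U, of "snd i"] by (auto intro: less_imp_le)
    then have [measurable]: "(\<lambda>\<omega>. W (\<tau> (fst i)) \<omega> (snd i)) \<in> borel_measurable M"
      "(\<lambda>\<omega>. W (\<tau> (fst i)) \<omega> (prd a U (snd i))) \<in> borel_measurable M"
      using W_measurable[OF br] by blast+
    show ?thesis unfolding incr_def by measurable
  qed
  show "i \<in> ?I \<Longrightarrow> incr a b U W \<tau> i \<in> borel_measurable M" by (rule m)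
  have "prob_space std_normal_distribution" using prob_space_normal_density[of 1 0] by simp
  then have pP: "prob_space ?P" by (intro prob_space_PiM)
  have s: "sets (PiM ?I (\<lambda>_. borel :: real measure)) = sets ?P" by (intro sets_PiM_cong) auto
  have "distr M (PiM ?I (\<lambda>_. borel)) (\<lambda>\<omega>. \<lambda>i\<in>?I. incr a b U W \<tau> i \<omega>) = distr ?P (PiM ?I (\<lambda>_. borel)) (\<lambda>x. \<lambda>i\<in>?I. x i)"
  proof (rule distr_PiM_eq_of_joint_char_eq[OF assms(1) pP fin m])
    fix i assume "i \<in> ?I"
    then show "(\<lambda>x. x i) \<in> borel_measurable ?P"
      using measurable_component_singleton[of i ?I "\<lambda>_. std_normal_distribution"] by simp
  qed (simp_all add: incr_char[OF br U L] std_normal_PiM_char[OF fin])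
  also have "\<dots> = distr ?P ?P (\<lambda>x. x)"
    by (intro distr_cong s) (auto simp: space_PiM PiE_iff extensional_restrict)
  finally show "distr M (PiM ?I (\<lambda>_. borel)) (\<lambda>\<omega>. \<lambda>i\<in>?I. incr a b U W \<tau> i \<omega>) = ?P"
    by simp
qed

text \<open>The definition does not pin the paths; it only makes the variance vanish at
  \<open>a\<close> and at \<open>b\<close>. The characteristic function is then constantly
  \<open>1\<close>, so the law is a point mass. The case \<open>a\<close> starts the recursion; both
  ends are used for the ordering at zero temperature.\<close>

lemma AE_bridge_start:
  assumes "prob_space M" and br: "indep_std_bridges M k a b W" and j: "j \<in> {1..k}" and u: "u \<in> {a, b}" and ab: "a < b"
  shows "AE \<omega> in M. W j \<omega> u = 0"
proof -
  interpret prob_space M by fact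
  have [measurable]: "(\<lambda>\<omega>. W j \<omega> u) \<in> borel_measurable M" using W_measurable[OF br j] u ab by auto
  have "bb_cov a b u u = 0" using u by (auto simp: bb_cov_def)
  then have c: "(\<integral>\<omega>. cis (t * W j \<omega> u) \<partial>M) = 1" for t
    using bridge_char_finite[OF br, of "{()}" "\<lambda>_. j" "\<lambda>_. u" "\<lambda>_. t"] j u ab by auto
  have "distr M borel (\<lambda>\<omega>. W j \<omega> u) = return borel 0"
  proof (rule Levy_uniqueness)
    show "real_distribution (distr M borel (\<lambda>\<omega>. W j \<omega> u))" "real_distribution (return borel (0::real))"
      by (auto simp: real_distribution_def real_distribution_axioms_def prob_space_distr prob_space_return)
    have "char (distr M borel (\<lambda>\<omega>. W j \<omega> u)) t = 1" for t
      using c[of t] by (simp add: char_def integral_distr cis_conv_exp)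
    moreover have "char (return borel 0) t = 1" for t
      by (simp add: char_def integral_return)
    ultimately show "char (distr M borel (\<lambda>\<omega>. W j \<omega> u)) = char (return borel 0)" by auto
  qed
  then have "AE x in distr M borel (\<lambda>\<omega>. W j \<omega> u). x = 0"
    by (simp only:) (simp add: AE_return)
  then show ?thesis by (subst (asm) AE_distr_iff) auto
qed

text \<open>Mean of the rescaled line at \<open>u\<close> given its value at the preceding grid
  time. For the first grid time that value is the constant \<open>w / (b - a)\<close>, as no
  coordinate belongs to \<open>a\<close>.\<close>

definition line_mean :: "real \<Rightarrow> real \<Rightarrow> real set \<Rightarrow> real \<Rightarrow> real \<Rightarrow> (real \<Rightarrow> real) \<Rightarrow> real \<Rightarrow> real" where
  "line_mean a b U w z \<xi> u = (if prd a U u = a then w / (b - a) else \<xi> (prd a U u)) + z * dtau a b U u"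

text \<open>A product of Brownian transition densities in the clock \<open>tau\<close>; the
  \<open>2\<close> is the rate of the bridges. There is no factor for the stretch up to
  \<open>b\<close>, since the endpoint \<open>z\<close> enters as a drift.\<close>

definition line_dens :: "real \<Rightarrow> real \<Rightarrow> real set \<Rightarrow> real \<Rightarrow> real \<Rightarrow> (real \<Rightarrow> real) \<Rightarrow> real" where
  "line_dens a b U w z \<xi> = (\<Prod>u\<in>U. normal_density (line_mean a b U w z \<xi> u) (sqrt (2 * dtau a b U u)) (\<xi> u))"

text \<open>After division by \<open>b - u\<close> a rate-two Brownian bridge from \<open>w\<close> to \<open>z\<close> is a Brownian motion with drift \<open>z\<close>
  in the time scale \<open>tau\<close>, started at \<open>w / (b - a)\<close>.\<close>

lemma nn_integral_bridge_grid:
  fixes \<tau> :: "nat \<Rightarrow> nat" and L :: "nat set"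
  assumes "prob_space M" and br: "indep_std_bridges M k a b W" and ab: "a < b" and U: "finite U" "U \<subseteq> {a<..<b}"
    and L: "finite L" "inj_on \<tau> L" "\<tau> ` L \<subseteq> {1..k}"
    and F: "F \<in> borel_measurable (Leb (L \<times> U))"
  shows "(\<integral>\<^sup>+\<omega>. F (\<lambda>i\<in>L \<times> U. BB a b w z W (\<tau> (fst i)) \<omega> (snd i) / (b - snd i)) \<partial>M)
    = (\<integral>\<^sup>+x. F x * ennreal (\<Prod>j\<in>L. line_dens a b U (w (\<tau> j)) (z (\<tau> j)) (\<lambda>u. x (j, u))) \<partial>Leb (L \<times> U))"
proof -
  let ?I = "L \<times> U"
  define Y where "Y i \<omega> = BB a b w z W (\<tau> (fst i)) \<omega> (snd i) / (b - snd i)" for i :: "nat \<times> real" and \<omega>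
  define g where "g i x = line_mean a b U (w (\<tau> (fst i))) (z (\<tau> (fst i))) (\<lambda>u. x (fst i, u)) (snd i)" for i :: "nat \<times> real" and x
  define \<sigma> where "\<sigma> i = sqrt (2 * dtau a b U (snd i))" for i :: "nat \<times> real"
  have fin: "finite ?I" using U(1) L(1) by simp
  have pI: "(fst i, prd a U (snd i)) \<in> ?I" "prd a U (snd i) \<in> U" if "i \<in> ?I" "prd a U (snd i) \<noteq> a" for i
    using that prd_bounds(3)[OF U, of "snd i"] by auto
  have key: "Y i \<omega> = g i (\<lambda>i\<in>?I. Y i \<omega>) + \<sigma> i * incr a b U W \<tau> i \<omega>"
    if W0: "\<forall>j\<in>L. W (\<tau> j) \<omega> a = 0" and i: "i \<in> ?I" for i \<omega>
  proof -
    obtain j u where ju: "i = (j, u)" "j \<in> L" "u \<in> U" using i by auto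
    define p where "p = prd a U u"
    have ub: "a < u" "u < b" using U ju by auto
    note pb = prd_bounds[OF U ju(3), folded p_def]
    have BBv: "BB a b w z W (\<tau> j) \<omega> v / (b - v) = w (\<tau> j) / (b - a) + z (\<tau> j) * tau a b v + sqrt 2 * (W (\<tau> j) \<omega> v / (b - v))"
      if "v < b" for v
    proof -
      \<comment> \<open>The interpolated mean is \<open>w\<close> times
        \<open>(b - v) / (b - a)\<close> plus \<open>z\<close> times
        \<open>(v - a) / (b - a)\<close>. Division by \<open>b - v\<close> makes the first term
        constant and the second \<open>z\<close> times the clock.\<close>
      have "w (\<tau> j) + (v - a) / (b - a) * (z (\<tau> j) - w (\<tau> j))
        = w (\<tau> j) / (b - a) * (b - v) + z (\<tau> j) * tau a b v * (b - v)"
        using that ab unfolding tau_def by (simp add: divide_simps) (simp add: algebra_simps)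
      then show ?thesis using that by (simp add: BB_def field_simps)
    qed
    have s: "\<sigma> i * incr a b U W \<tau> i \<omega> = sqrt 2 * (W (\<tau> j) \<omega> u / (b - u) - W (\<tau> j) \<omega> p / (b - p))"
      using dtau_pos[OF U ju(3)] by (simp add: \<sigma>_def incr_def ju p_def real_sqrt_mult)
    have "g i (\<lambda>i\<in>?I. Y i \<omega>) = BB a b w z W (\<tau> j) \<omega> p / (b - p) + z (\<tau> j) * (tau a b u - tau a b p)"
    proof (cases "p = a")
      case True
      then show ?thesis using BBv[of a] ab W0 ju
        by (simp add: g_def line_mean_def dtau_def p_def[symmetric])
    next
      case False
      then have "(j, p) \<in> ?I" using pb ju by auto
      then show ?thesis using False
        by (simp add: g_def line_mean_def dtau_def ju p_def[symmetric] Y_def)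
    qed
    then show ?thesis unfolding s using BBv[OF ub(2)] BBv[OF pb(5)]
      by (simp add: Y_def ju algebra_simps)
  qed
  have Wm: "(\<lambda>\<omega>. W (\<tau> (fst i)) \<omega> (snd i)) \<in> borel_measurable M" if "i \<in> ?I" for i
    using that L(3) U(2) by (intro W_measurable[OF br]) (auto intro: less_imp_le)
  have comp: "(\<lambda>x. x i) \<in> borel_measurable (Leb ?I)" if "i \<in> ?I" for i
    using measurable_component_singleton[OF that, of "\<lambda>_. lborel :: real measure"] by simp
  have "(\<integral>\<^sup>+\<omega>. F (\<lambda>i\<in>?I. Y i \<omega>) \<partial>M)
    = (\<integral>\<^sup>+x. F x * (\<Prod>i\<in>?I. ennreal (normal_density (g i x) (\<sigma> i) (x i))) \<partial>Leb ?I)"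
  \<comment> \<open>Ranking by time fits because each coordinate depends only on the same line at
    the preceding grid time; different lines at one time are ties.\<close>
  proof (rule nn_integral_gaussian_recursion[where rk=snd and N="incr a b U W \<tau>", OF fin])
    show "incr a b U W \<tau> i \<in> borel_measurable M" if "i \<in> ?I" for i
      using incr_law(2)[OF assms(1) br U L that] .
    show "Y i \<in> borel_measurable M" if "i \<in> ?I" for i
      unfolding Y_def BB_def using Wm[OF that] by measurable
    show "distr M (PiM ?I (\<lambda>_. borel)) (\<lambda>\<omega>. \<lambda>i\<in>?I. incr a b U W \<tau> i \<omega>) = PiM ?I (\<lambda>_. std_normal_distribution)"
      using incr_law(1)[OF assms(1) br U L] .
    show "g i \<in> borel_measurable (Leb ?I)" if "i \<in> ?I" for i
      using comp[OF pI(1)[OF that]] unfolding g_def line_mean_def by (cases "prd a U (snd i) = a") auto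
    show "g i x = g i y" if "i \<in> ?I" "\<And>j. j \<in> ?I \<Longrightarrow> snd j < snd i \<Longrightarrow> x j = y j" for i x y
      using that(2)[OF pI(1)[OF that(1)]] prd_bounds(2)[OF U, of "snd i"] that(1)
      by (auto simp: g_def line_mean_def)
    show "0 < \<sigma> i" if "i \<in> ?I" for i using that dtau_pos[OF U, of "snd i"] by (auto simp: \<sigma>_def)
    have "AE \<omega> in M. \<forall>j\<in>L. W (\<tau> j) \<omega> a = 0"
      using L(1,3) by (intro AE_finite_allI AE_bridge_start[OF assms(1) br _ _ ab]) auto
    then show "AE \<omega> in M. \<forall>i\<in>?I. Y i \<omega> = g i (\<lambda>i\<in>?I. Y i \<omega>) + \<sigma> i * incr a b U W \<tau> i \<omega>"
      by (rule AE_mp) (intro AE_I2 impI ballI, erule (1) key)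
  qed (rule F)
  also have "\<dots> = (\<integral>\<^sup>+x. F x * ennreal (\<Prod>j\<in>L. line_dens a b U (w (\<tau> j)) (z (\<tau> j)) (\<lambda>u. x (j, u))) \<partial>Leb ?I)"
    by (intro nn_integral_cong arg_cong2[of _ _ _ _ times] refl)
      (simp add: prod_ennreal line_dens_def prod.cartesian_product case_prod_beta g_def \<sigma>_def)
  finally show ?thesis unfolding Y_def .
qed

lemma line_dens_nonneg: "0 \<le> line_dens a b U w z \<xi>"
  unfolding line_dens_def by (intro prod_nonneg) auto

text \<open>In the exponent each grid step contributes the square of an increment, and this is
  submodular. The two different drifts add a multiple of the increments of \<open>\<psi>\<close>;
  their sum telescopes and has the right sign, because \<open>\<psi>\<close> is \<open>0\<close> at
  \<open>a\<close> and nonnegative afterwards.\<close>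

lemma line_dens_lattice:
  assumes ab: "a < b" and U: "finite U" "U \<subseteq> {a<..<b}" and w: "w \<le> w'" and z: "z \<le> z'"
  shows "line_dens a b U w z \<xi> * line_dens a b U w' z' \<eta>
    \<le> line_dens a b U w' z' (\<lambda>u. max (\<xi> u) (\<eta> u)) * line_dens a b U w z (\<lambda>u. min (\<xi> u) (\<eta> u))"
proof -
  define C where "C = (\<Prod>u\<in>U. 1 / sqrt (2 * pi * (sqrt (2 * dtau a b U u))\<^sup>2))"
  define start where "start w \<xi> u = (if u = a then w / (b - a) else \<xi> u)" for w :: real and \<xi> u
  define h where "h w z \<xi> u = (\<xi> u - start w \<xi> (prd a U u) - z * dtau a b U u)\<^sup>2 / (4 * dtau a b U u)" for w z \<xi> u
  have ld: "line_dens a b U w z \<xi> = C * exp (- (\<Sum>u\<in>U. h w z \<xi> u))" for w z \<xi>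
  proof -
    have "line_dens a b U w z \<xi> = (\<Prod>u\<in>U. 1 / sqrt (2 * pi * (sqrt (2 * dtau a b U u))\<^sup>2) * exp (- h w z \<xi> u))"
      unfolding line_dens_def
    proof (intro prod.cong refl)
      fix u assume "u \<in> U"
      then have d: "0 < dtau a b U u" by (rule dtau_pos[OF U])
      have "h w z \<xi> u = (\<xi> u - line_mean a b U w z \<xi> u)\<^sup>2 / (2 * (sqrt (2 * dtau a b U u))\<^sup>2)"
        using d by (simp add: h_def line_mean_def start_def algebra_simps)
      then show "normal_density (line_mean a b U w z \<xi> u) (sqrt (2 * dtau a b U u)) (\<xi> u)
        = 1 / sqrt (2 * pi * (sqrt (2 * dtau a b U u))\<^sup>2) * exp (- h w z \<xi> u)"
        unfolding normal_density_def by simp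
    qed
    then show ?thesis using U(1) by (simp add: prod.distrib[symmetric] C_def exp_sum sum_negf[symmetric])
  qed
  have C: "0 \<le> C" unfolding C_def by (intro prod_nonneg) auto
  let ?x = "start w \<xi>" and ?y = "start w' \<eta>"
  \<comment> \<open>The positive part of the first path minus the second, hence the amount by which
    the join exceeds the path with drift \<open>z'\<close>.\<close>
  define \<psi> where "\<psi> u = max (?x u) (?y u) - ?y u" for u
  have ww: "w / (b - a) \<le> w' / (b - a)" using w ab by (simp add: divide_right_mono)
  have stm: "start w' (\<lambda>u. max (\<xi> u) (\<eta> u)) u = max (?x u) (?y u)"
    "start w (\<lambda>u. min (\<xi> u) (\<eta> u)) u = min (?x u) (?y u)" for u
    using ww by (auto simp: start_def)
  have step: "h w' z' (\<lambda>u. max (\<xi> u) (\<eta> u)) u + h w z (\<lambda>u. min (\<xi> u) (\<eta> u)) u + (z' - z) / 2 * (\<psi> u - \<psi> (prd a U u))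
    \<le> h w z \<xi> u + h w' z' \<eta> u" if "u \<in> U" for u
  proof -
    define d where "d = dtau a b U u"
    have d: "0 < d" unfolding d_def using that by (rule dtau_pos[OF U])
    have "u \<noteq> a" using that U by auto
    then have xu: "\<xi> u = ?x u" "\<eta> u = ?y u" by (auto simp: start_def)
    define x y p q where "x = ?x u" and "y = ?y u" and "p = ?x (prd a U u)" and "q = ?y (prd a U u)"
    \<comment> \<open>Separates quadratic, drift and constant parts. The constants of join and meet
      together are those of the two given paths.\<close>
    have ex: "(r - z * d)\<^sup>2 / (4 * d) = r\<^sup>2 / (4 * d) - z * r / 2 + z\<^sup>2 * d / 4" for r z
      using d by (simp add: field_simps power2_eq_square)
    have sq: "(max x y - max p q)\<^sup>2 + (min x y - min p q)\<^sup>2 \<le> (x - p)\<^sup>2 + (y - q)\<^sup>2"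
    proof -
      \<comment> \<open>If the order of the two paths flips during the step, join and meet pair
        \<open>x\<close> with \<open>q\<close> and \<open>y\<close> with \<open>p\<close>, and the
        sum of squares drops by twice the nonnegative product
        \<open>(x - y) * (q - p)\<close>.\<close>
      have cross: "(x - q)\<^sup>2 + (y - p)\<^sup>2 = (x - p)\<^sup>2 + (y - q)\<^sup>2 - 2 * ((x - y) * (q - p))"
        by (simp add: power2_eq_square algebra_simps)
      show ?thesis
      proof (cases "(x \<le> y) = (p \<le> q)")
        case True
        then show ?thesis by (cases "x \<le> y") (simp_all add: max_def min_def)
      next
        case False
        then have "0 \<le> (x - y) * (q - p)" by (cases "x \<le> y") (auto intro: mult_nonneg_nonneg mult_nonpos_nonpos)
        then show ?thesis using False cross by (cases "x \<le> y") (auto simp: max_def min_def)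
      qed
    qed
    have "(max x y - max p q)\<^sup>2 / (4 * d) + (min x y - min p q)\<^sup>2 / (4 * d) \<le> (x - p)\<^sup>2 / (4 * d) + (y - q)\<^sup>2 / (4 * d)"
      using divide_right_mono[OF sq, of "4 * d"] d by (simp add: add_divide_distrib)
    moreover have "z' * (max x y - max p q) / 2 + z * (min x y - min p q) / 2
      = z * (x - p) / 2 + z' * (y - q) / 2 + (z' - z) / 2 * (max x y - y - (max p q - q))"
    proof -
      have E: "min x y - min p q = (x - p) + (y - q) - (max x y - max p q)" by (simp add: max_def min_def)
      show ?thesis unfolding E by (simp add: field_simps)
    qed
    ultimately show ?thesis
      unfolding h_def stm xu \<psi>_def d_def[symmetric] x_def[symmetric] y_def[symmetric] p_def[symmetric] q_def[symmetric] ex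
      by linarith
  qed
  have "\<psi> a = 0" using ww by (simp add: \<psi>_def start_def)
  moreover have "0 \<le> \<psi> u" for u by (simp add: \<psi>_def)
  ultimately have "0 \<le> (\<Sum>u\<in>U. \<psi> u - \<psi> (prd a U u))" by (simp add: sum_diff_prd[OF U])
  then have "0 \<le> (\<Sum>u\<in>U. (z' - z) / 2 * (\<psi> u - \<psi> (prd a U u)))"
    unfolding sum_distrib_left[symmetric] using z by (intro mult_nonneg_nonneg) auto
  moreover have "(\<Sum>u\<in>U. h w' z' (\<lambda>u. max (\<xi> u) (\<eta> u)) u + h w z (\<lambda>u. min (\<xi> u) (\<eta> u)) u + (z' - z) / 2 * (\<psi> u - \<psi> (prd a U u)))
    \<le> (\<Sum>u\<in>U. h w z \<xi> u + h w' z' \<eta> u)"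
    by (intro sum_mono step)
  ultimately have "(\<Sum>u\<in>U. h w' z' (\<lambda>u. max (\<xi> u) (\<eta> u)) u) + (\<Sum>u\<in>U. h w z (\<lambda>u. min (\<xi> u) (\<eta> u)) u)
    \<le> (\<Sum>u\<in>U. h w z \<xi> u) + (\<Sum>u\<in>U. h w' z' \<eta> u)"
    by (simp add: sum.distrib)
  then have "exp (- (\<Sum>u\<in>U. h w z \<xi> u)) * exp (- (\<Sum>u\<in>U. h w' z' \<eta> u))
    \<le> exp (- (\<Sum>u\<in>U. h w' z' (\<lambda>u. max (\<xi> u) (\<eta> u)) u)) * exp (- (\<Sum>u\<in>U. h w z (\<lambda>u. min (\<xi> u) (\<eta> u)) u))"
    by (simp add: exp_add[symmetric])
  then have "C * C * (exp (- (\<Sum>u\<in>U. h w z \<xi> u)) * exp (- (\<Sum>u\<in>U. h w' z' \<eta> u)))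
    \<le> C * C * (exp (- (\<Sum>u\<in>U. h w' z' (\<lambda>u. max (\<xi> u) (\<eta> u)) u)) * exp (- (\<Sum>u\<in>U. h w z (\<lambda>u. min (\<xi> u) (\<eta> u)) u)))"
    using C by (intro mult_left_mono) auto
  then show ?thesis unfolding ld by (simp only: mult_ac)
qed

section \<open>The inequality on a finite grid\<close>

lemma line_dens_measurable:
  assumes U: "finite U" "U \<subseteq> {a<..<b}" and j: "j \<in> L"
  shows "(\<lambda>x. line_dens a b U w z (\<lambda>u. x (j, u))) \<in> borel_measurable (Leb (L \<times> U))"
proof -
  have comp: "(\<lambda>x. x i) \<in> borel_measurable (Leb (L \<times> U))" if "i \<in> L \<times> U" for i
    using measurable_component_singleton[OF that, of "\<lambda>_. lborel :: real measure"] by simp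
  show ?thesis
    unfolding line_dens_def
  proof (intro borel_measurable_prod)
    fix u assume u: "u \<in> U"
    have [measurable]: "(\<lambda>x. x (j, u)) \<in> borel_measurable (Leb (L \<times> U))"
      using u j by (intro comp) auto
    have [measurable]: "(\<lambda>x. line_mean a b U w z (\<lambda>u. x (j, u)) u) \<in> borel_measurable (Leb (L \<times> U))"
    proof (cases "prd a U u = a")
      case False
      then have "(j, prd a U u) \<in> L \<times> U" using j prd_bounds(3)[OF U u] by auto
      from comp[OF this] show ?thesis using False by (simp add: line_mean_def)
    qed (simp add: line_mean_def)
    show "(\<lambda>x. normal_density (line_mean a b U w z (\<lambda>u. x (j, u)) u) (sqrt (2 * dtau a b U u)) (x (j, u)))
      \<in> borel_measurable (Leb (L \<times> U))"
      unfolding normal_density_def by measurable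
  qed
qed

text \<open>One form for both temperatures. \<open>\<Psi> u\<close> acts on the difference of a line
  and the line above it, \<open>\<kappa> u\<close> on the bottom line. They will be exponentials of
  \<open>Ht\<close> with trivial \<open>\<kappa>\<close>, or indicators of the ordering
  constraints.\<close>

definition gibbs_weight :: "nat \<Rightarrow> real set \<Rightarrow> (real \<Rightarrow> real \<Rightarrow> real) \<Rightarrow> (real \<Rightarrow> real \<Rightarrow> real) \<Rightarrow> (nat \<Rightarrow> real \<Rightarrow> real) \<Rightarrow> real" where
  "gibbs_weight k U \<Psi> \<kappa> f = (\<Prod>u\<in>U. (\<Prod>i\<in>{1..<k}. \<Psi> u (f (Suc i) u - f i u)) * \<kappa> u (f k u))"

definition lattice_weights :: "real set \<Rightarrow> (real \<Rightarrow> real \<Rightarrow> real) \<Rightarrow> (real \<Rightarrow> real \<Rightarrow> real) \<Rightarrow> bool" where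
  "lattice_weights U \<Psi> \<kappa> \<longleftrightarrow> (\<forall>u\<in>U.
     \<Psi> u \<in> borel_measurable borel \<and> \<kappa> u \<in> borel_measurable borel \<and>
     (\<forall>r. 0 \<le> \<Psi> u r \<and> \<Psi> u r \<le> 1 \<and> 0 \<le> \<kappa> u r \<and> \<kappa> u r \<le> 1) \<and>
     (\<forall>r s. r \<le> s \<longrightarrow> \<Psi> u s \<le> \<Psi> u r) \<and>
     (\<forall>x x' y y'. \<Psi> u (x' - x) * \<Psi> u (y' - y) \<le> \<Psi> u (max x' y' - max x y) * \<Psi> u (min x' y' - min x y)) \<and>
     (\<forall>x y v. \<kappa> u x * \<Psi> u (v - y) * \<kappa> u v \<le> \<kappa> u (min x y) * \<Psi> u (v - max x y) * \<kappa> u v))"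

lemma gibbs_weight_bounds:
  assumes "lattice_weights U \<Psi> \<kappa>"
  shows "0 \<le> gibbs_weight k U \<Psi> \<kappa> f" "gibbs_weight k U \<Psi> \<kappa> f \<le> 1"
  using assms unfolding gibbs_weight_def lattice_weights_def
  by (auto intro!: prod_nonneg prod_le_1 mult_nonneg_nonneg mult_le_one)

lemma gibbs_weight_measurable:
  assumes "lattice_weights U \<Psi> \<kappa>" "1 \<le> k"
    and f: "\<And>i u. i \<in> {1..k} \<Longrightarrow> u \<in> U \<Longrightarrow> (\<lambda>x. f x i u) \<in> borel_measurable N"
  shows "(\<lambda>x. gibbs_weight k U \<Psi> \<kappa> (f x)) \<in> borel_measurable N"
  unfolding gibbs_weight_def
proof (intro borel_measurable_prod borel_measurable_times)
  fix u i assume u: "u \<in> U"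
  have [measurable]: "\<Psi> u \<in> borel_measurable borel" "\<kappa> u \<in> borel_measurable borel"
    using assms(1) u by (auto simp: lattice_weights_def)
  have [measurable]: "(\<lambda>x. f x k u) \<in> borel_measurable N" using f u assms(2) by auto
  show "(\<lambda>x. \<kappa> u (f x k u)) \<in> borel_measurable N" by measurable
  assume "i \<in> {1..<k}"
  then have [measurable]: "(\<lambda>x. f x i u) \<in> borel_measurable N" "(\<lambda>x. f x (Suc i) u) \<in> borel_measurable N"
    using f u by auto
  show "(\<lambda>x. \<Psi> u (f x (Suc i) u - f x i u)) \<in> borel_measurable N" by measurable
qed

text \<open>In the first copy line \<open>l\<close> sits at coordinate \<open>l - 1\<close>; in the second copy it sits at coordinate \<open>l\<close>, except
  that the bottom line \<open>k\<close> takes the free place \<open>0\<close>. So lines \<open>2..k\<close> of the first copy face lines \<open>1..k-1\<close> of the second.\<close>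

definition place2 :: "nat \<Rightarrow> nat \<Rightarrow> nat" where
  "place2 k l = (if l = k then 0 else l)"

text \<open>Coordinate \<open>0\<close> carries the fixed lines and is exchanged: the join keeps the
  bottom line \<open>Y 0\<close>, the meet the top line \<open>X 0\<close>. The factors then fall
  into three kinds, one for each of the three inequalities between weights in
  \<open>lattice_weights\<close>.\<close>

lemma gibbs_weight_lattice:
  assumes lw: "lattice_weights U \<Psi> \<kappa>" and k: "k \<ge> 2"
    and J: "\<And>u. u \<in> U \<Longrightarrow> J 0 u = Y 0 u" "\<And>u j. u \<in> U \<Longrightarrow> j \<noteq> 0 \<Longrightarrow> J j u = max (X j u) (Y j u)"
    and M: "\<And>u. u \<in> U \<Longrightarrow> M 0 u = X 0 u" "\<And>u j. u \<in> U \<Longrightarrow> j \<noteq> 0 \<Longrightarrow> M j u = min (X j u) (Y j u)"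
  shows "gibbs_weight k U \<Psi> \<kappa> (\<lambda>l. X (l - 1)) * gibbs_weight k U \<Psi> \<kappa> (\<lambda>l. Y (place2 k l))
    \<le> gibbs_weight k U \<Psi> \<kappa> (\<lambda>l. J (place2 k l)) * gibbs_weight k U \<Psi> \<kappa> (\<lambda>l. M (l - 1))"
proof -
  \<comment> \<open>The moving coordinates are \<open>1..m+1\<close>, with \<open>m\<close> inner
    gaps in each copy; the top gap of the first copy and the bottom gap of the second are split off
    from these.\<close>
  obtain m where m: "k = Suc (Suc m)" using k by (metis add_2_eq_Suc le_Suc_ex)
  have first: "(\<Prod>i\<in>{1..<k}. \<Psi> u (X (Suc i - 1) u - X (i - 1) u)) = \<Psi> u (X 1 u - X 0 u) * (\<Prod>i\<in>{1..<Suc m}. \<Psi> u (X (Suc i) u - X i u))"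
    for X :: "nat \<Rightarrow> real \<Rightarrow> real" and u
  proof -
    have "(\<Prod>i\<in>{1..<k}. \<Psi> u (X (Suc i - 1) u - X (i - 1) u)) = (\<Prod>i\<in>{0..<Suc m}. \<Psi> u (X (Suc i) u - X i u))"
      unfolding m using prod.shift_bounds_Suc_ivl[of "\<lambda>i. \<Psi> u (X (Suc i - 1) u - X (i - 1) u)" 0 "Suc m"] by simp
    then show ?thesis by (simp add: prod.atLeast_Suc_lessThan)
  qed
  have second: "(\<Prod>i\<in>{1..<k}. \<Psi> u (Y (place2 k (Suc i)) u - Y (place2 k i) u))
      = (\<Prod>i\<in>{1..<Suc m}. \<Psi> u (Y (Suc i) u - Y i u)) * \<Psi> u (Y 0 u - Y (Suc m) u)"
    for Y :: "nat \<Rightarrow> real \<Rightarrow> real" and u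
  proof -
    have "(\<Prod>i\<in>{1..<Suc m}. \<Psi> u (Y (place2 k (Suc i)) u - Y (place2 k i) u)) = (\<Prod>i\<in>{1..<Suc m}. \<Psi> u (Y (Suc i) u - Y i u))"
      by (intro prod.cong) (auto simp: place2_def m)
    then show ?thesis by (simp add: m place2_def)
  qed
  have pk: "place2 k k = 0" "k - 1 = Suc m" by (auto simp: place2_def m)
  have step: "(\<Psi> u (X 1 u - X 0 u) * (\<Prod>i\<in>{1..<Suc m}. \<Psi> u (X (Suc i) u - X i u)) * \<kappa> u (X (Suc m) u)) *
      ((\<Prod>i\<in>{1..<Suc m}. \<Psi> u (Y (Suc i) u - Y i u)) * \<Psi> u (Y 0 u - Y (Suc m) u) * \<kappa> u (Y 0 u))
    \<le> ((\<Prod>i\<in>{1..<Suc m}. \<Psi> u (J (Suc i) u - J i u)) * \<Psi> u (J 0 u - J (Suc m) u) * \<kappa> u (J 0 u)) *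
      (\<Psi> u (M 1 u - M 0 u) * (\<Prod>i\<in>{1..<Suc m}. \<Psi> u (M (Suc i) u - M i u)) * \<kappa> u (M (Suc m) u))"
    (is "?L \<le> ?R") if u: "u \<in> U" for u
  proof -
    have l: "\<And>r. 0 \<le> \<Psi> u r" "\<And>r. 0 \<le> \<kappa> u r" "\<And>r s. r \<le> s \<Longrightarrow> \<Psi> u s \<le> \<Psi> u r"
      "\<And>x x' y y'. \<Psi> u (x' - x) * \<Psi> u (y' - y) \<le> \<Psi> u (max x' y' - max x y) * \<Psi> u (min x' y' - min x y)"
      "\<And>x y v. \<kappa> u x * \<Psi> u (v - y) * \<kappa> u v \<le> \<kappa> u (min x y) * \<Psi> u (v - max x y) * \<kappa> u v"
      using lw u by (auto simp: lattice_weights_def)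
    \<comment> \<open>The meet may lower the line under the fixed \<open>X 0\<close>, which
      decreases the difference and so cannot decrease \<open>\<Psi>\<close>.\<close>
    have 1: "\<Psi> u (X 1 u - X 0 u) \<le> \<Psi> u (M 1 u - M 0 u)"
      using u by (intro l(3)) (auto simp: M)
    have 2: "(\<Prod>i\<in>{1..<Suc m}. \<Psi> u (X (Suc i) u - X i u)) * (\<Prod>i\<in>{1..<Suc m}. \<Psi> u (Y (Suc i) u - Y i u))
      \<le> (\<Prod>i\<in>{1..<Suc m}. \<Psi> u (J (Suc i) u - J i u)) * (\<Prod>i\<in>{1..<Suc m}. \<Psi> u (M (Suc i) u - M i u))"
      unfolding prod.distrib[symmetric]
    proof (intro prod_mono conjI)
      fix i assume "i \<in> {1..<Suc m}"
      then show "\<Psi> u (X (Suc i) u - X i u) * \<Psi> u (Y (Suc i) u - Y i u) \<le> \<Psi> u (J (Suc i) u - J i u) * \<Psi> u (M (Suc i) u - M i u)"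
        using l(4)[of "X (Suc i) u" "X i u" "Y (Suc i) u" "Y i u"] u by (simp add: J M)
    qed (simp add: l)
    have 3: "\<kappa> u (X (Suc m) u) * \<Psi> u (Y 0 u - Y (Suc m) u) * \<kappa> u (Y 0 u) \<le> \<kappa> u (M (Suc m) u) * \<Psi> u (J 0 u - J (Suc m) u) * \<kappa> u (J 0 u)"
      using l(5)[of "X (Suc m) u" "Y 0 u" "Y (Suc m) u"] u by (simp add: J M)
    have "?L = \<Psi> u (X 1 u - X 0 u) * ((\<Prod>i\<in>{1..<Suc m}. \<Psi> u (X (Suc i) u - X i u)) * (\<Prod>i\<in>{1..<Suc m}. \<Psi> u (Y (Suc i) u - Y i u)))
      * (\<kappa> u (X (Suc m) u) * \<Psi> u (Y 0 u - Y (Suc m) u) * \<kappa> u (Y 0 u))"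
      by (simp only: mult_ac)
    also have "\<dots> \<le> \<Psi> u (M 1 u - M 0 u) * ((\<Prod>i\<in>{1..<Suc m}. \<Psi> u (J (Suc i) u - J i u)) * (\<Prod>i\<in>{1..<Suc m}. \<Psi> u (M (Suc i) u - M i u)))
      * (\<kappa> u (M (Suc m) u) * \<Psi> u (J 0 u - J (Suc m) u) * \<kappa> u (J 0 u))"
      by (rule mult_mono[OF mult_mono[OF 1 2] 3]) (auto intro!: mult_nonneg_nonneg prod_nonneg l)
    also have "\<dots> = ?R" by (simp only: mult_ac)
    finally show ?thesis .
  qed
  have nn: "0 \<le> \<Psi> u r" "0 \<le> \<kappa> u r" if "u \<in> U" for u r using lw that by (auto simp: lattice_weights_def)
  show ?thesis
    unfolding gibbs_weight_def first second pk prod.distrib[symmetric]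
    by (intro prod_mono conjI step) (auto intro!: mult_nonneg_nonneg prod_nonneg nn)
qed

text \<open>The four functions theorem is applied to the densities of the two copies.
  \<open>\<Phi>A\<close> reads coordinate \<open>1\<close>, where the second line of the first copy
  faces the top line of the second, and grows under the join. \<open>\<Phi>E\<close> reads
  coordinate \<open>0\<close> of the first copy, which the meet returns unchanged.\<close>

lemma finite_grid_inequality:
  assumes "prob_space M" and br: "indep_std_bridges M k a b W" and ab: "a < b" and k: "k \<ge> 2"
    and w: "\<forall>i\<in>{1..<k}. w (Suc i) < w i" and z: "\<forall>i\<in>{1..<k}. z (Suc i) < z i"
    and U: "finite U" "U \<subseteq> {a<..<b}"
    and \<Phi>m: "\<Phi>A \<in> borel_measurable (PiM U (\<lambda>_. borel))" "\<Phi>E \<in> borel_measurable (PiM U (\<lambda>_. borel))"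
    and \<Phi>b: "\<And>f. 0 \<le> \<Phi>A f \<and> \<Phi>A f \<le> (1::real)" "\<And>f. 0 \<le> \<Phi>E f \<and> \<Phi>E f \<le> (1::real)"
    and mono: "\<And>f h. (\<And>u. u \<in> U \<Longrightarrow> f u \<le> h u) \<Longrightarrow> \<Phi>A f \<le> \<Phi>A h"
    and lw: "lattice_weights U \<Psi> \<kappa>"
  defines "B \<equiv> BB a b w z W"
  defines "wt \<equiv> \<lambda>\<omega>. gibbs_weight k U \<Psi> \<kappa> (\<lambda>l. B l \<omega>)"
  shows "(\<integral>\<omega>. \<Phi>A (\<lambda>u\<in>U. B 2 \<omega> u) * \<Phi>E (\<lambda>u\<in>U. B 1 \<omega> u) * wt \<omega> \<partial>M) * (\<integral>\<omega>. wt \<omega> \<partial>M)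
    \<le> (\<integral>\<omega>. \<Phi>E (\<lambda>u\<in>U. B 1 \<omega> u) * wt \<omega> \<partial>M) * (\<integral>\<omega>. \<Phi>A (\<lambda>u\<in>U. B 1 \<omega> u) * wt \<omega> \<partial>M)"
proof -
  interpret prob_space M by fact
  define L where "L = {..<k}"
  define I where "I = L \<times> U"
  define D where "D = {i :: nat \<times> real. fst i = 0}"
  \<comment> \<open>Inverse of \<open>place2 k\<close>: the line at a given coordinate of the second
    copy. For the first copy this map is \<open>Suc\<close>.\<close>
  define \<tau> where "\<tau> j = (if j = 0 then k else j)" for j
  define p where "p \<tau> x = (\<Prod>j\<in>L. line_dens a b U (w (\<tau> j)) (z (\<tau> j)) (\<lambda>u. x (j, u)))" for \<tau> :: "nat \<Rightarrow> nat" and x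
  \<comment> \<open>Undoes the division by \<open>b - u\<close>: densities live in rescaled
    coordinates, weights and events in original heights. Since \<open>b - u\<close> is positive,
    \<open>R\<close> commutes with maximum and minimum.\<close>
  define R where "R x j u = (b - u) * x (j, u)" for x :: "nat \<times> real \<Rightarrow> real" and j u
  \<comment> \<open>\<open>f1\<close> and \<open>f4\<close> belong to the first copy,
    \<open>f2\<close> and \<open>f3\<close> to the second. From the pair \<open>f1, f2\<close> to
    the pair \<open>f3, f4\<close> the factor \<open>\<Phi>A\<close> is handed over to the second
    copy.\<close>
  define f1 where "f1 x = \<Phi>A (\<lambda>u\<in>U. R x 1 u) * \<Phi>E (\<lambda>u\<in>U. R x 0 u) * gibbs_weight k U \<Psi> \<kappa> (\<lambda>l. R x (l - 1))" for x
  define f2 where "f2 x = gibbs_weight k U \<Psi> \<kappa> (\<lambda>l. R x (place2 k l))" for x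
  define f3 where "f3 x = \<Phi>A (\<lambda>u\<in>U. R x 1 u) * gibbs_weight k U \<Psi> \<kappa> (\<lambda>l. R x (place2 k l))" for x
  define f4 where "f4 x = \<Phi>E (\<lambda>u\<in>U. R x 0 u) * gibbs_weight k U \<Psi> \<kappa> (\<lambda>l. R x (l - 1))" for x
  have k1: "1 \<le> k" "0 \<in> L" "1 \<in> L" "1 \<noteq> k" using k by (auto simp: L_def)
  have finL: "finite L" by (simp add: L_def)
  have \<tau>1: "inj_on Suc L" "Suc ` L \<subseteq> {1..k}" by (auto simp: L_def)
  have \<tau>2: "inj_on \<tau> L" "\<tau> ` L \<subseteq> {1..k}" using k by (auto simp: L_def \<tau>_def inj_on_def split: if_splits)
  have wb: "0 \<le> gibbs_weight k U \<Psi> \<kappa> f" "gibbs_weight k U \<Psi> \<kappa> f \<le> 1" for f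
    using gibbs_weight_bounds[OF lw] by auto
  have fb: "0 \<le> f1 x" "0 \<le> f2 x" "0 \<le> f3 x" "0 \<le> f4 x" for x
    unfolding f1_def f2_def f3_def f4_def using \<Phi>b wb by auto
  have Rm: "(\<lambda>x. R x j u) \<in> borel_measurable (Leb I)" if "j \<in> L" "u \<in> U" for j u
    using measurable_component_singleton[of "(j, u)" I "\<lambda>_. lborel :: real measure"] that
    unfolding R_def I_def by (intro borel_measurable_times) auto
  have Rr: "(\<lambda>x. \<lambda>u\<in>U. R x j u) \<in> measurable (Leb I) (PiM U (\<lambda>_. borel))" if "j \<in> L" for j
    using Rm[OF that] by (intro measurable_restrict) auto
  have gm: "(\<lambda>x. gibbs_weight k U \<Psi> \<kappa> (\<lambda>l. R x (l - 1))) \<in> borel_measurable (Leb I)"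
    "(\<lambda>x. gibbs_weight k U \<Psi> \<kappa> (\<lambda>l. R x (place2 k l))) \<in> borel_measurable (Leb I)"
    using k by (auto intro!: gibbs_weight_measurable[OF lw k1(1)] Rm simp: L_def place2_def)
  have fm: "f1 \<in> borel_measurable (Leb I)" "f2 \<in> borel_measurable (Leb I)"
    "f3 \<in> borel_measurable (Leb I)" "f4 \<in> borel_measurable (Leb I)"
    unfolding f1_def f2_def f3_def f4_def using gm k1
    by (auto intro!: borel_measurable_times measurable_compose[OF Rr \<Phi>m(1)] measurable_compose[OF Rr \<Phi>m(2)])
  have pm: "p \<tau> \<in> borel_measurable (Leb I)" for \<tau>
    unfolding p_def I_def by (intro borel_measurable_prod line_dens_measurable[OF U])
  have p0: "0 \<le> p \<tau> x" for \<tau> x unfolding p_def by (intro prod_nonneg line_dens_nonneg)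
  have transfer: "(\<integral>\<^sup>+x. ennreal (f x * p \<tau> x) \<partial>Leb I) = ennreal (\<integral>\<omega>. h \<omega> \<partial>M)"
    if f: "f \<in> borel_measurable (Leb I)" "\<And>x. 0 \<le> f x"
      and \<tau>: "inj_on \<tau> L" "\<tau> ` L \<subseteq> {1..k}"
      and h: "\<And>\<omega>. f (\<lambda>i\<in>I. B (\<tau> (fst i)) \<omega> (snd i) / (b - snd i)) = h \<omega>" "h \<in> borel_measurable M" "\<And>\<omega>. h \<omega> \<le> 1"
    for f h \<tau>
  proof -
    have "(\<integral>\<^sup>+x. ennreal (f x * p \<tau> x) \<partial>Leb I) = (\<integral>\<^sup>+x. ennreal (f x) * ennreal (p \<tau> x) \<partial>Leb I)"
      by (simp add: ennreal_mult f p0)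
    also have "\<dots> = (\<integral>\<^sup>+\<omega>. ennreal (f (\<lambda>i\<in>I. B (\<tau> (fst i)) \<omega> (snd i) / (b - snd i))) \<partial>M)"
      unfolding I_def p_def B_def
      using f(1) by (intro nn_integral_bridge_grid[OF assms(1) br ab U finL \<tau>, symmetric]) (auto simp: I_def)
    also have "\<dots> = (\<integral>\<^sup>+\<omega>. ennreal (h \<omega>) \<partial>M)" by (simp only: h(1))
    also have "\<dots> = ennreal (\<integral>\<omega>. h \<omega> \<partial>M)"
    proof (rule nn_integral_eq_integral)
      have nn: "0 \<le> h \<omega>" for \<omega> using h(1)[of \<omega>] f(2) by metis
      then show "AE \<omega> in M. 0 \<le> h \<omega>" by simp
      show "integrable M h" using h(2,3) nn by (intro integrable_const_bound[where B=1]) auto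
    qed
    finally show ?thesis .
  qed
  have Bm: "(\<lambda>\<omega>. B l \<omega> u) \<in> borel_measurable M" if "l \<in> {1..k}" "u \<in> U" for l u
    unfolding B_def BB_def using W_measurable[OF br that(1), of u] that(2) U(2) by (auto intro: less_imp_le)
  have Br: "(\<lambda>\<omega>. \<lambda>u\<in>U. B l \<omega> u) \<in> measurable M (PiM U (\<lambda>_. borel))" if "l \<in> {1..k}" for l
    using Bm[OF that] by (intro measurable_restrict) auto
  have wtm: "wt \<in> borel_measurable M" unfolding wt_def
    by (intro gibbs_weight_measurable[OF lw k1(1)] Bm)
  have k12: "1 \<in> {1..k}" "2 \<in> {1..k}" using k by auto
  have RB: "R (\<lambda>i\<in>I. B (\<tau> (fst i)) \<omega> (snd i) / (b - snd i)) j u = B (\<tau> j) \<omega> u" if "j \<in> L" "u \<in> U" for j u \<omega> \<tau>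
    using that U(2) by (auto simp: R_def I_def)
  have rB: "(\<lambda>u\<in>U. R (\<lambda>i\<in>I. B (\<tau> (fst i)) \<omega> (snd i) / (b - snd i)) j u) = (\<lambda>u\<in>U. B (\<tau> j) \<omega> u)" if "j \<in> L" for j \<omega> \<tau>
    using that by (intro restrict_ext RB)
  have gB: "gibbs_weight k U \<Psi> \<kappa> (\<lambda>l. R (\<lambda>i\<in>I. B (\<tau> (fst i)) \<omega> (snd i) / (b - snd i)) (c l)) = wt \<omega>"
    if "\<And>l. l \<in> {1..k} \<Longrightarrow> c l \<in> L \<and> \<tau> (c l) = l" for \<omega> \<tau> c
  proof -
    have "R (\<lambda>i\<in>I. B (\<tau> (fst i)) \<omega> (snd i) / (b - snd i)) (c l) u = B l \<omega> u" if "l \<in> {1..k}" "u \<in> U" for l u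
      using RB[of "c l" u \<tau> \<omega>] that \<open>\<And>l. l \<in> {1..k} \<Longrightarrow> c l \<in> L \<and> \<tau> (c l) = l\<close>[of l] by simp
    then show ?thesis unfolding gibbs_weight_def wt_def
      using k1(1) by (intro prod.cong refl arg_cong2[of _ _ _ _ times]) auto
  qed
  have c1: "l - 1 \<in> L \<and> Suc (l - 1) = l" if "l \<in> {1..k}" for l using that by (auto simp: L_def)
  have c2: "place2 k l \<in> L \<and> \<tau> (place2 k l) = l" if "l \<in> {1..k}" for l using that k by (auto simp: L_def place2_def \<tau>_def)
  have \<tau>01: "\<tau> 1 = 1" "Suc 0 = 1" "Suc 1 = 2" by (auto simp: \<tau>_def)
  have b01: "0 \<le> x * y \<and> x * y \<le> 1" if "0 \<le> x \<and> x \<le> 1" "0 \<le> y \<and> y \<le> 1" for x y :: real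
    using that by (simp add: mult_le_one)
  have wt01: "0 \<le> wt \<omega> \<and> wt \<omega> \<le> 1" for \<omega> unfolding wt_def using wb by blast
  have AE_m [measurable]: "(\<lambda>\<omega>. \<Phi>A (\<lambda>u\<in>U. B 1 \<omega> u)) \<in> borel_measurable M" "(\<lambda>\<omega>. \<Phi>A (\<lambda>u\<in>U. B 2 \<omega> u)) \<in> borel_measurable M"
    "(\<lambda>\<omega>. \<Phi>E (\<lambda>u\<in>U. B 1 \<omega> u)) \<in> borel_measurable M"
    using measurable_compose[OF Br \<Phi>m(1)] measurable_compose[OF Br \<Phi>m(2)] k12 by auto
  note wtm [measurable]
  have g1: "gibbs_weight k U \<Psi> \<kappa> (\<lambda>l. R (\<lambda>i\<in>I. B (Suc (fst i)) \<omega> (snd i) / (b - snd i)) (l - 1)) = wt \<omega>" for \<omega>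
    by (rule gB) (rule c1)
  have g2: "gibbs_weight k U \<Psi> \<kappa> (\<lambda>l. R (\<lambda>i\<in>I. B (\<tau> (fst i)) \<omega> (snd i) / (b - snd i)) (place2 k l)) = wt \<omega>" for \<omega>
    by (rule gB) (rule c2)
  have e1: "f1 (\<lambda>i\<in>I. B (Suc (fst i)) \<omega> (snd i) / (b - snd i)) = \<Phi>A (\<lambda>u\<in>U. B 2 \<omega> u) * \<Phi>E (\<lambda>u\<in>U. B 1 \<omega> u) * wt \<omega>" for \<omega>
    using rB[OF k1(2), of Suc \<omega>] rB[OF k1(3), of Suc \<omega>] g1
    by (simp only: f1_def \<tau>01)
  have e2: "f2 (\<lambda>i\<in>I. B (\<tau> (fst i)) \<omega> (snd i) / (b - snd i)) = wt \<omega>" for \<omega>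
    using g2 by (simp only: f2_def)
  have e3: "f3 (\<lambda>i\<in>I. B (\<tau> (fst i)) \<omega> (snd i) / (b - snd i)) = \<Phi>A (\<lambda>u\<in>U. B 1 \<omega> u) * wt \<omega>" for \<omega>
    using rB[OF k1(3), of \<tau> \<omega>] g2 by (simp only: f3_def \<tau>01)
  have e4: "f4 (\<lambda>i\<in>I. B (Suc (fst i)) \<omega> (snd i) / (b - snd i)) = \<Phi>E (\<lambda>u\<in>U. B 1 \<omega> u) * wt \<omega>" for \<omega>
    using rB[OF k1(2), of Suc \<omega>] g1 by (simp only: f4_def \<tau>01)
  have "ennreal (\<integral>\<omega>. \<Phi>A (\<lambda>u\<in>U. B 2 \<omega> u) * \<Phi>E (\<lambda>u\<in>U. B 1 \<omega> u) * wt \<omega> \<partial>M) = (\<integral>\<^sup>+x. ennreal (f1 x * p Suc x) \<partial>Leb I)"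
    by (rule transfer[OF fm(1) fb(1) \<tau>1 e1, symmetric])
      (measurable, intro conjunct2[OF b01] b01 wt01 \<Phi>b)
  moreover have "ennreal (\<integral>\<omega>. wt \<omega> \<partial>M) = (\<integral>\<^sup>+x. ennreal (f2 x * p \<tau> x) \<partial>Leb I)"
    by (rule transfer[OF fm(2) fb(2) \<tau>2 e2, symmetric]) (measurable, intro conjunct2[OF wt01])
  moreover have "ennreal (\<integral>\<omega>. \<Phi>A (\<lambda>u\<in>U. B 1 \<omega> u) * wt \<omega> \<partial>M) = (\<integral>\<^sup>+x. ennreal (f3 x * p \<tau> x) \<partial>Leb I)"
    by (rule transfer[OF fm(3) fb(3) \<tau>2 e3, symmetric])
      (measurable, intro conjunct2[OF b01] wt01 \<Phi>b)
  moreover have "ennreal (\<integral>\<omega>. \<Phi>E (\<lambda>u\<in>U. B 1 \<omega> u) * wt \<omega> \<partial>M) = (\<integral>\<^sup>+x. ennreal (f4 x * p Suc x) \<partial>Leb I)"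
    by (rule transfer[OF fm(4) fb(4) \<tau>1 e4, symmetric])
      (measurable, intro conjunct2[OF b01] wt01 \<Phi>b)
  moreover have "(\<integral>\<^sup>+x. ennreal (f1 x * p Suc x) \<partial>Leb I) * (\<integral>\<^sup>+x. ennreal (f2 x * p \<tau> x) \<partial>Leb I)
    \<le> (\<integral>\<^sup>+x. ennreal (f3 x * p \<tau> x) \<partial>Leb I) * (\<integral>\<^sup>+x. ennreal (f4 x * p Suc x) \<partial>Leb I)"
  proof (rule four_functions_PiM[where D=D])
    show "finite I" by (simp add: I_def finL U)
    fix x y :: "nat \<times> real \<Rightarrow> real"
    let ?j = "join_off D x y" and ?m = "meet_off D x y"
    have ub: "0 \<le> b - u" if "u \<in> U" for u using that U(2) by auto
    have Rj: "R ?j 0 u = R y 0 u" "j \<noteq> 0 \<Longrightarrow> u \<in> U \<Longrightarrow> R ?j j u = max (R x j u) (R y j u)" for j u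
      using ub by (auto simp: R_def join_off_def D_def max_mult_distrib_left)
    have Rmt: "R ?m 0 u = R x 0 u" "j \<noteq> 0 \<Longrightarrow> u \<in> U \<Longrightarrow> R ?m j u = min (R x j u) (R y j u)" for j u
      using ub by (auto simp: R_def meet_off_def D_def min_mult_distrib_left)
    have G: "gibbs_weight k U \<Psi> \<kappa> (\<lambda>l. R x (l - 1)) * gibbs_weight k U \<Psi> \<kappa> (\<lambda>l. R y (place2 k l))
      \<le> gibbs_weight k U \<Psi> \<kappa> (\<lambda>l. R ?j (place2 k l)) * gibbs_weight k U \<Psi> \<kappa> (\<lambda>l. R ?m (l - 1))"
      by (rule gibbs_weight_lattice[OF lw k]) (auto simp: Rj Rmt)
    have E: "(\<lambda>u\<in>U. R ?m 0 u) = (\<lambda>u\<in>U. R x 0 u)" by (simp add: Rmt)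
    have A: "\<Phi>A (\<lambda>u\<in>U. R x 1 u) \<le> \<Phi>A (\<lambda>u\<in>U. R ?j 1 u)" by (rule mono) (simp add: Rj)
    have P: "p Suc x * p \<tau> y \<le> p \<tau> ?j * p Suc ?m"
      unfolding p_def prod.distrib[symmetric]
    proof (intro prod_mono conjI mult_nonneg_nonneg line_dens_nonneg)
      fix j assume j: "j \<in> L"
      show "line_dens a b U (w (Suc j)) (z (Suc j)) (\<lambda>u. x (j, u)) * line_dens a b U (w (\<tau> j)) (z (\<tau> j)) (\<lambda>u. y (j, u))
        \<le> line_dens a b U (w (\<tau> j)) (z (\<tau> j)) (\<lambda>u. ?j (j, u)) * line_dens a b U (w (Suc j)) (z (Suc j)) (\<lambda>u. ?m (j, u))"
      \<comment> \<open>At coordinate \<open>0\<close> the two densities are merely exchanged.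
        Elsewhere line \<open>j + 1\<close> is compared with line \<open>j\<close>, and the endpoint
        order is exactly the hypothesis on \<open>w\<close> and \<open>z\<close>.\<close>
      proof (cases "j = 0")
        case True
        then show ?thesis by (simp add: join_off_def meet_off_def D_def mult.commute)
      next
        case False
        then have "w (Suc j) \<le> w (\<tau> j)" "z (Suc j) \<le> z (\<tau> j)"
          using j w z by (auto simp: \<tau>_def L_def intro!: less_imp_le)
        from line_dens_lattice[OF ab U this] False show ?thesis
          by (simp add: join_off_def meet_off_def D_def)
      qed
    qed
    have "f1 x * p Suc x * (f2 y * p \<tau> y) = \<Phi>A (\<lambda>u\<in>U. R x 1 u) * \<Phi>E (\<lambda>u\<in>U. R x 0 u) *
        (gibbs_weight k U \<Psi> \<kappa> (\<lambda>l. R x (l - 1)) * gibbs_weight k U \<Psi> \<kappa> (\<lambda>l. R y (place2 k l))) * (p Suc x * p \<tau> y)"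
      unfolding f1_def f2_def by (simp only: mult_ac)
    also have "\<dots> \<le> \<Phi>A (\<lambda>u\<in>U. R ?j 1 u) * \<Phi>E (\<lambda>u\<in>U. R ?m 0 u) *
        (gibbs_weight k U \<Psi> \<kappa> (\<lambda>l. R ?j (place2 k l)) * gibbs_weight k U \<Psi> \<kappa> (\<lambda>l. R ?m (l - 1))) * (p \<tau> ?j * p Suc ?m)"
      unfolding E by (intro mult_mono A G P order_refl mult_nonneg_nonneg p0 wb conjunct1[OF \<Phi>b(1)] conjunct1[OF \<Phi>b(2)])
    also have "\<dots> = f3 ?j * p \<tau> ?j * (f4 ?m * p Suc ?m)"
      unfolding f3_def f4_def by (simp only: mult_ac)
    finally show "ennreal (f1 x * p Suc x) * ennreal (f2 y * p \<tau> y) \<le> ennreal (f3 ?j * p \<tau> ?j) * ennreal (f4 ?m * p Suc ?m)"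
      using fb p0 by (simp add: ennreal_mult[symmetric] ennreal_leI)
  qed (use fm pm in \<open>auto intro!: measurable_compose[OF _ measurable_ennreal] borel_measurable_times\<close>)
  ultimately have "ennreal (\<integral>\<omega>. \<Phi>A (\<lambda>u\<in>U. B 2 \<omega> u) * \<Phi>E (\<lambda>u\<in>U. B 1 \<omega> u) * wt \<omega> \<partial>M) * ennreal (\<integral>\<omega>. wt \<omega> \<partial>M)
    \<le> ennreal (\<integral>\<omega>. \<Phi>A (\<lambda>u\<in>U. B 1 \<omega> u) * wt \<omega> \<partial>M) * ennreal (\<integral>\<omega>. \<Phi>E (\<lambda>u\<in>U. B 1 \<omega> u) * wt \<omega> \<partial>M)"
    by simp
  moreover have "0 \<le> (\<integral>\<omega>. wt \<omega> \<partial>M)" "0 \<le> (\<integral>\<omega>. \<Phi>A (\<lambda>u\<in>U. B 2 \<omega> u) * \<Phi>E (\<lambda>u\<in>U. B 1 \<omega> u) * wt \<omega> \<partial>M)"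
    "0 \<le> (\<integral>\<omega>. \<Phi>A (\<lambda>u\<in>U. B 1 \<omega> u) * wt \<omega> \<partial>M)" "0 \<le> (\<integral>\<omega>. \<Phi>E (\<lambda>u\<in>U. B 1 \<omega> u) * wt \<omega> \<partial>M)"
    using wt01 \<Phi>b by (auto intro!: Bochner_Integration.integral_nonneg mult_nonneg_nonneg)
  ultimately show ?thesis
    by (simp add: ennreal_mult[symmetric] mult.commute)
qed

section \<open>Borel sets of continuous functions\<close>

lemma tendsto_coordinate:
  fixes x :: "'a \<Rightarrow> nat \<Rightarrow> real"
  shows "(x \<longlongrightarrow> y) F \<Longrightarrow> ((\<lambda>m. x m l) \<longlongrightarrow> y l) F"
  by (rule continuous_on_tendsto_compose[OF continuous_on_product_coordinates]) auto

lemma borel_measurable_coordinate [measurable]: "(\<lambda>x :: nat \<Rightarrow> real. x l) \<in> borel_measurable borel"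
  by (intro borel_measurable_continuous_onI continuous_on_product_coordinates)

text \<open>Bernstein polynomials transported to \<open>[a,b]\<close>. Rational coefficients and
  \<open>rat list\<close> as index type make the family countable; it serves as a dense set for the
  uniform distance.\<close>

definition bern :: "real \<Rightarrow> real \<Rightarrow> rat list \<Rightarrow> real \<Rightarrow> real" where
  "bern a b cs u = (\<Sum>i<length cs. of_rat (cs ! i) * Bernstein (length cs - 1) i ((u - a) / (b - a)))"

lemma bern_dense:
  assumes ab: "a < b" and f: "continuous_on {a..b} f" and e: "0 < e"
  shows "\<exists>cs. \<forall>u\<in>{a..b}. \<bar>f u - bern a b cs u\<bar> \<le> e"
proof -
  define g where "g x = f (a + x * (b - a))" for x
  have im: "a + x * (b - a) \<in> {a..b}" if "x \<in> {0..1}" for x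
  proof -
    have "0 \<le> x * (b - a)" "x * (b - a) \<le> 1 * (b - a)" using that ab by (auto intro!: mult_right_mono)
    then show ?thesis by auto
  qed
  have "continuous_on {0..1} g" unfolding g_def
    by (rule continuous_on_compose2[OF f]) (use im in \<open>auto intro!: continuous_intros\<close>)
  then obtain n where n: "\<And>x. x \<in> {0..1} \<Longrightarrow> \<bar>g x - (\<Sum>i\<le>n. g (i / n) * Bernstein n i x)\<bar> < e / 2"
    using Bernstein_Weierstrass[of g "e / 2"] e by auto
  \<comment> \<open>Rounding all coefficients costs at most \<open>e / 2\<close>, because the
    Bernstein basis is nonnegative with sum one.\<close>
  have "\<exists>r. \<bar>of_rat r - g (real i / n)\<bar> \<le> e / 2" for i
  proof -
    obtain r where "g (real i / n) < of_rat r" "of_rat r < g (real i / n) + e / 2"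
      using of_rat_dense[of "g (real i / n)" "g (real i / n) + e / 2"] e by auto
    then show ?thesis by (intro exI[of _ r]) auto
  qed
  then obtain r where r: "\<And>i. \<bar>of_rat (r i) - g (real i / n)\<bar> \<le> e / 2" by metis
  have "\<bar>f u - bern a b (map r [0..<Suc n]) u\<bar> \<le> e" if u: "u \<in> {a..b}" for u
  proof -
    define x where "x = (u - a) / (b - a)"
    have x: "x \<in> {0..1}" "f u = g x" using u ab by (auto simp: x_def g_def)
    have bern: "bern a b (map r [0..<Suc n]) u = (\<Sum>i\<le>n. of_rat (r i) * Bernstein n i x)"
      unfolding bern_def x_def[symmetric]
      by (rule sum.cong) (auto simp del: upt_Suc)
    have "\<bar>(\<Sum>i\<le>n. g (i / n) * Bernstein n i x) - (\<Sum>i\<le>n. of_rat (r i) * Bernstein n i x)\<bar>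
      = \<bar>\<Sum>i\<le>n. (g (i / n) - of_rat (r i)) * Bernstein n i x\<bar>"
      by (simp add: sum_subtractf left_diff_distrib)
    also have "\<dots> \<le> (\<Sum>i\<le>n. e / 2 * Bernstein n i x)"
    proof (rule order_trans[OF sum_abs], intro sum_mono)
      fix i
      show "\<bar>(g (i / n) - of_rat (r i)) * Bernstein n i x\<bar> \<le> e / 2 * Bernstein n i x"
        using mult_right_mono[OF r[of i] Bernstein_nonneg[of x n i]] Bernstein_nonneg[of x n i] x(1)
        by (simp add: abs_mult abs_minus_commute)
    qed
    also have "\<dots> = e / 2" unfolding sum_distrib_left[symmetric] by simp
    finally show ?thesis using n[OF x(1)] unfolding bern x(2) by linarith
  qed
  then show ?thesis by blast
qed

text \<open>The times are interior because the grid densities divide by \<open>b - u\<close> and by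
  \<open>dtau\<close>; the closure still recovers both endpoints.\<close>

definition dense_seq :: "real \<Rightarrow> real \<Rightarrow> (nat \<Rightarrow> real) \<Rightarrow> bool" where
  "dense_seq a b q \<longleftrightarrow> range q \<subseteq> {a<..<b} \<and> {a..b} \<subseteq> closure (range q)"

lemma closure_dense_seq:
  assumes "dense_seq a b q"
  shows "closure (range q) = {a..b}"
proof
  have "range q \<subseteq> {a..b}"
    using assms greaterThanLessThan_subseteq_atLeastAtMost_iff[of a b a b] unfolding dense_seq_def by blast
  then show "closure (range q) \<subseteq> {a..b}" by (rule closure_minimal) auto
qed (use assms in \<open>simp add: dense_seq_def\<close>)

lemma dense_seq_in: "dense_seq a b q \<Longrightarrow> q l \<in> {a..b}"
  using closure_dense_seq[of a b q] closure_subset[of "range q"] by blast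

lemma le_of_dense:
  fixes f h :: "real \<Rightarrow> real"
  assumes "dense_seq a b q" "continuous_on {a..b} f" "continuous_on {a..b} h" "\<And>l. f (q l) \<le> h (q l)" "u \<in> {a..b}"
  shows "f u \<le> h u"
proof -
  have "0 \<le> h u - f u"
  proof (rule continuous_ge_on_closure[where f="\<lambda>u. h u - f u" and S="range q"])
    show "continuous_on (closure (range q)) (\<lambda>u. h u - f u)"
      unfolding closure_dense_seq[OF assms(1)] by (intro continuous_intros assms)
    show "u \<in> closure (range q)" using assms(1,5) by (auto simp: dense_seq_def)
  qed (use assms(4) in auto)
  then show ?thesis by simp
qed

lemma Cab_eqI:
  assumes "dense_seq a b q" "f \<in> Cab a b" "h \<in> Cab a b" "(\<lambda>l. f (q l)) = (\<lambda>l. h (q l))"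
  shows "f = h"
proof
  fix u
  have e: "f (q l) = h (q l)" for l using fun_cong[OF assms(4), of l] by simp
  show "f u = h u"
  proof (cases "u \<in> {a..b}")
    case True
    have c: "continuous_on {a..b} f" "continuous_on {a..b} h" using assms(2,3) by (auto simp: Cab_def)
    show ?thesis
    proof (rule antisym)
      show "f u \<le> h u" by (rule le_of_dense[OF assms(1) c _ True]) (simp add: e)
      show "h u \<le> f u" by (rule le_of_dense[OF assms(1) c(2,1) _ True]) (simp add: e)
    qed
  qed (use assms(2,3) in \<open>simp add: Cab_def\<close>)
qed

text \<open>By separability an open set is a countable union of closed balls around functions
  \<open>bern a b c\<close>, and by continuity a closed ball is described by the values at the times
  \<open>q l\<close>. Complements and countable unions inherit such a description.\<close>

lemma borel_Cab_trace:
  assumes ab: "a < b" and q: "dense_seq a b q" and A: "A \<in> borel_Cab a b"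
  shows "\<exists>A'\<in>sets borel. A = {f\<in>Cab a b. (\<lambda>l. f (q l)) \<in> A'}"
  using A unfolding borel_Cab_def
proof (induction rule: sigma_sets.induct)
  case (Basic G)
  define N where "N c n = {x :: nat \<Rightarrow> real. \<forall>l. \<bar>x l - bern a b c (q l)\<bar> \<le> 1 / real (Suc n)}" for c n
  define T where "T = {(c, n). \<forall>h\<in>Cab a b. (\<lambda>l. h (q l)) \<in> N c n \<longrightarrow> h \<in> G}"
  have Nm: "N c n \<in> sets borel" for c n
  proof -
    have "{x \<in> space borel. \<forall>l. \<bar>x l - bern a b c (q l)\<bar> \<le> 1 / real (Suc n)} \<in> sets (borel :: (nat \<Rightarrow> real) measure)"
      by measurable
    then show ?thesis by (simp add: N_def)
  qed
  have G: "G \<subseteq> Cab a b" "\<And>f. f \<in> G \<Longrightarrow> \<exists>e>0. \<forall>h\<in>Cab a b. sup_dist a b f h < e \<longrightarrow> h \<in> G"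
    using Basic by (auto simp: open_Cab_def)
  have bc: "continuous_on {a..b} (bern a b c)" for c
    unfolding bern_def Bernstein_def using ab by (intro continuous_intros) auto
  have "\<exists>t\<in>T. (\<lambda>l. f (q l)) \<in> (case t of (c, n) \<Rightarrow> N c n)" if f: "f \<in> G" for f
  proof -
    have fC: "f \<in> Cab a b" "continuous_on {a..b} f" using f G by (auto simp: Cab_def)
    obtain e where e: "0 < e" "\<And>h. h \<in> Cab a b \<Longrightarrow> sup_dist a b f h < e \<Longrightarrow> h \<in> G" using G(2)[OF f] by blast
    \<comment> \<open>Two members of one ball differ by at most twice its radius, so a ball
      containing \<open>f\<close> stays inside \<open>G\<close>.\<close>
    obtain n where n: "1 / real (Suc n) < e / 2"
      using nat_approx_posE[OF half_gt_zero[OF e(1)]] by blast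
    have "\<exists>c. \<forall>u\<in>{a..b}. \<bar>f u - bern a b c u\<bar> \<le> 1 / real (Suc n)"
      by (rule bern_dense[OF ab fC(2)]) simp
    then obtain c where c: "\<And>u. u \<in> {a..b} \<Longrightarrow> \<bar>f u - bern a b c u\<bar> \<le> 1 / real (Suc n)" by blast
    have "h \<in> G" if h: "h \<in> Cab a b" "(\<lambda>l. h (q l)) \<in> N c n" for h
    proof (rule e(2)[OF h(1)])
      have hc: "continuous_on {a..b} h" using h by (simp add: Cab_def)
      have "\<bar>h u - bern a b c u\<bar> \<le> 1 / real (Suc n)" if u: "u \<in> {a..b}" for u
        by (rule le_of_dense[OF q _ _ _ u, of "\<lambda>u. \<bar>h u - bern a b c u\<bar>"])
          (use h(2) in \<open>auto intro!: continuous_intros hc bc simp: N_def\<close>)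
      then have "\<bar>f u - h u\<bar> \<le> 2 * (1 / real (Suc n))" if u: "u \<in> {a..b}" for u
        using c[OF u] u by (smt (verit))
      then have "sup_dist a b f h \<le> 2 * (1 / real (Suc n))"
        unfolding sup_dist_def using ab by (intro cSUP_least) auto
      then show "sup_dist a b f h < e" using n by simp
    qed
    then have "(c, n) \<in> T" by (auto simp: T_def)
    moreover have "(\<lambda>l. f (q l)) \<in> N c n" using c dense_seq_in[OF q] by (auto simp: N_def)
    ultimately show ?thesis by (intro bexI[of _ "(c, n)"]) auto
  qed
  then have "G = {f\<in>Cab a b. (\<lambda>l. f (q l)) \<in> (\<Union>t\<in>T. case t of (c, n) \<Rightarrow> N c n)}"
    using G(1) by (fastforce simp: T_def)
  moreover have "(\<Union>t\<in>T. case t of (c, n) \<Rightarrow> N c n) \<in> sets borel"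
    by (intro sets.countable_UN') (auto simp: Nm)
  ultimately show ?case by blast
next
  case Empty
  then show ?case by (intro bexI[of _ "{}"]) auto
next
  case (Compl G)
  then obtain G' where "G' \<in> sets borel" "G = {f\<in>Cab a b. (\<lambda>l. f (q l)) \<in> G'}" by blast
  then show ?case by (intro bexI[of _ "- G'"]) auto
next
  case (Union G)
  then have "\<forall>i. \<exists>G'. G' \<in> sets borel \<and> G i = {f\<in>Cab a b. (\<lambda>l. f (q l)) \<in> G'}" by blast
  from choice[OF this] obtain G' where "\<And>i. G' i \<in> sets borel" "\<And>i. G i = {f\<in>Cab a b. (\<lambda>l. f (q l)) \<in> G' i}"
    by blast
  then show ?case by (intro bexI[of _ "\<Union>i. G' i"]) auto
qed

text \<open>A sequence consists of the values of a continuous function at the times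
  \<open>q l\<close> exactly if it is uniformly continuous along \<open>q\<close>: one direction is
  compactness of \<open>[a,b]\<close>, the other extension to the closure. The condition needs only
  countable quantifiers.\<close>

lemma range_Cab_borel:
  assumes ab: "a < b" and q: "dense_seq a b q"
  shows "(\<lambda>f l. f (q l)) ` Cab a b \<in> sets borel"
proof -
  define C where "C = {x :: nat \<Rightarrow> real. \<forall>m. \<exists>n. \<forall>i j. \<bar>q i - q j\<bar> < 1 / real (Suc n) \<longrightarrow> \<bar>x i - x j\<bar> \<le> 1 / real (Suc m)}"
  have "{x \<in> space borel. \<forall>m. \<exists>n. \<forall>i j. \<bar>q i - q j\<bar> < 1 / real (Suc n) \<longrightarrow> \<bar>x i - x j\<bar> \<le> 1 / real (Suc m)} \<in> sets (borel :: (nat \<Rightarrow> real) measure)"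
    by measurable
  then have Cm: "C \<in> sets borel" by (simp add: C_def)
  have "(\<lambda>f l. f (q l)) ` Cab a b = C"
  proof (intro subset_antisym subsetI)
    fix x assume "x \<in> (\<lambda>f l. f (q l)) ` Cab a b"
    then obtain f where f: "continuous_on {a..b} f" "x = (\<lambda>l. f (q l))" by (auto simp: Cab_def)
    have uc: "uniformly_continuous_on {a..b} f" using f(1) by (intro compact_uniformly_continuous) auto
    show "x \<in> C" unfolding C_def
    proof (intro CollectI allI)
      fix m
      obtain d where d: "0 < d" "\<And>u v. u \<in> {a..b} \<Longrightarrow> v \<in> {a..b} \<Longrightarrow> dist v u < d \<Longrightarrow> dist (f v) (f u) < 1 / real (Suc m)"
        using uc[unfolded uniformly_continuous_on_def, rule_format, of "1 / real (Suc m)"] by auto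
      obtain n where n: "1 / real (Suc n) < d" using nat_approx_posE[OF d(1)] by blast
      have "\<bar>x i - x j\<bar> \<le> 1 / real (Suc m)" if "\<bar>q i - q j\<bar> < 1 / real (Suc n)" for i j
        using d(2)[of "q j" "q i"] dense_seq_in[OF q] that n by (auto simp: dist_real_def f(2) less_imp_le)
      then show "\<exists>n. \<forall>i j. \<bar>q i - q j\<bar> < 1 / real (Suc n) \<longrightarrow> \<bar>x i - x j\<bar> \<le> 1 / real (Suc m)" by blast
    qed
  next
    fix x assume x: "x \<in> C"
    \<comment> \<open>The sequence \<open>q\<close> may repeat times, so an index has to be chosen;
      membership in \<open>C\<close> forces equal values at equal times.\<close>
    define F where "F u = x (SOME i. q i = u)" for u
    have close: "\<exists>n. \<forall>i j. \<bar>q i - q j\<bar> < 1 / real (Suc n) \<longrightarrow> \<bar>x i - x j\<bar> < e" if e: "0 < e" for e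
    proof -
      obtain m where m: "1 / real (Suc m) < e" using nat_approx_posE[OF e] by blast
      obtain n where "\<forall>i j. \<bar>q i - q j\<bar> < 1 / real (Suc n) \<longrightarrow> \<bar>x i - x j\<bar> \<le> 1 / real (Suc m)"
        using x unfolding C_def by blast
      then show ?thesis using le_less_trans[OF _ m] by blast
    qed
    have Fq: "F (q i) = x i" for i
    proof -
      define j where "j = (SOME j. q j = q i)"
      have j: "q j = q i" unfolding j_def by (rule someI[of _ i]) simp
      have "\<bar>x j - x i\<bar> < e" if "0 < e" for e
      proof -
        obtain n where n: "\<forall>i j. \<bar>q i - q j\<bar> < 1 / real (Suc n) \<longrightarrow> \<bar>x i - x j\<bar> < e" using close[OF \<open>0 < e\<close>] by blast
        show ?thesis using n[rule_format, of j i] j by simp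
      qed
      then have "x j = x i" by (metis abs_ge_zero eq_iff_diff_eq_0 less_irrefl zero_less_abs_iff)
      then show ?thesis by (simp add: F_def j_def)
    qed
    have "uniformly_continuous_on (range q) F"
      unfolding uniformly_continuous_on_def
    proof (intro allI impI)
      fix e :: real assume "0 < e"
      then obtain n where n: "\<forall>i j. \<bar>q i - q j\<bar> < 1 / real (Suc n) \<longrightarrow> \<bar>x i - x j\<bar> < e" using close by blast
      show "\<exists>d>0. \<forall>u\<in>range q. \<forall>v\<in>range q. dist v u < d \<longrightarrow> dist (F v) (F u) < e"
        using n by (intro exI[of _ "1 / real (Suc n)"]) (auto simp: Fq dist_real_def)
    qed
    then obtain g where g: "uniformly_continuous_on (closure (range q)) g" "\<And>u. u \<in> range q \<Longrightarrow> F u = g u"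
      by (rule uniformly_continuous_on_extension_on_closure) blast
    define f where "f u = (if u \<in> {a..b} then g u else 0)" for u
    have "continuous_on {a..b} g" using g(1) closure_dense_seq[OF q] uniformly_continuous_imp_continuous by metis
    then have "continuous_on {a..b} f" by (rule continuous_on_eq) (simp add: f_def)
    then have "f \<in> Cab a b" by (simp add: Cab_def f_def)
    moreover have "f (q l) = x l" for l using dense_seq_in[OF q, of l] g(2)[of "q l"] Fq[of l] by (simp add: f_def)
    ultimately show "x \<in> (\<lambda>f l. f (q l)) ` Cab a b" by (intro image_eqI[of _ _ f]) auto
  qed
  then show ?thesis using Cm by simp
qed

text \<open>The image is the trace set cut with the range of the restriction map, and both are
  Borel. This moves \<open>A\<close> and \<open>E\<close> into the Polish space of sequences, where
  finite measures are inner regular.\<close>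

lemma image_borel_Cab:
  assumes ab: "a < b" and q: "dense_seq a b q" and A: "A \<in> borel_Cab a b"
  shows "(\<lambda>f l. f (q l)) ` A \<in> sets borel" "A \<subseteq> Cab a b"
proof -
  obtain A' where A': "A' \<in> sets borel" "A = {f\<in>Cab a b. (\<lambda>l. f (q l)) \<in> A'}"
    using borel_Cab_trace[OF assms] by blast
  then have "(\<lambda>f l. f (q l)) ` A = A' \<inter> (\<lambda>f l. f (q l)) ` Cab a b" by auto
  then show "(\<lambda>f l. f (q l)) ` A \<in> sets borel" using A'(1) range_Cab_borel[OF ab q] by simp
  show "A \<subseteq> Cab a b" using A' by auto
qed

section \<open>Compact approximation from inside and cylinder sets\<close>

lemma inner_compact:
  fixes M :: "(nat \<Rightarrow> real) measure"
  assumes "finite_measure M" and s: "sets M = sets borel" and A: "A \<in> sets borel" and e: "0 < e"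
  obtains K where "K \<subseteq> A" "compact K" "measure M (A - K) < e"
proof -
  interpret finite_measure M by fact
  have reg: "emeasure M A = (SUP K \<in> {K. K \<subseteq> A \<and> compact K}. emeasure M K)"
    by (rule inner_regular[OF s _ A]) simp
  have "\<exists>K. K \<subseteq> A \<and> compact K \<and> measure M A - e < measure M K"
  proof (cases "measure M A < e")
    case True
    then show ?thesis by (intro exI[of _ "{}"]) auto
  next
    case False
    then have "ennreal (measure M A - e) < emeasure M A"
      using e by (simp add: emeasure_eq_measure ennreal_less_iff)
    then obtain K where "K \<subseteq> A" "compact K" "ennreal (measure M A - e) < emeasure M K"
      unfolding reg less_SUP_iff by blast
    then show ?thesis using False by (auto simp: emeasure_eq_measure ennreal_less_iff)
  qed
  then obtain K where K: "K \<subseteq> A" "compact K" "measure M A - e < measure M K" by blast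
  have Km: "K \<in> sets M" using K(2) s by (simp add: borel_closed compact_imp_closed)
  then have "measure M (A - K) < e" using K A s by (subst finite_measure_Diff) auto
  then show thesis using K that by blast
qed

text \<open>With \<open>R\<close> equality these sets shrink to \<open>K\<close>, with
  \<open>R\<close> the order they shrink to the up-closure of \<open>K\<close>. Each depends on
  finitely many times only, as the grid inequality demands.\<close>

definition cyl :: "(real \<Rightarrow> real \<Rightarrow> bool) \<Rightarrow> (nat \<Rightarrow> real) set \<Rightarrow> nat \<Rightarrow> (nat \<Rightarrow> real) set" where
  "cyl R K n = {x. \<exists>h\<in>K. \<forall>l<n. R (h l) (x l)}"

lemma closed_rel_limit:
  assumes "closed {(s, t). R s (t::real)}" "X \<longlonglongrightarrow> (s::real)" "Y \<longlonglongrightarrow> t" "eventually (\<lambda>n. R (X n) (Y n)) sequentially"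
  shows "R s t"
proof -
  have "(\<lambda>n. (X n, Y n)) \<longlonglongrightarrow> (s, t)" by (intro tendsto_intros assms)
  then have "(s, t) \<in> {(s, t). R s t}"
    using assms(4) by (intro Lim_in_closed_set[OF assms(1), of "\<lambda>n. (X n, Y n)" sequentially]) auto
  then show ?thesis by simp
qed

text \<open>Witnesses in \<open>K\<close> for the members of a convergent sequence have a convergent
  subsequence, and closedness of \<open>R\<close> passes to the limit in each coordinate.\<close>

lemma closed_cyl:
  assumes K: "compact K" and R: "closed {(s, t). R s t}"
  shows "closed (cyl R K n)"
  unfolding closed_sequential_limits
proof (intro allI impI, elim conjE)
  fix x y assume x: "\<forall>m. x m \<in> cyl R K n" and lim: "x \<longlonglongrightarrow> y"
  then have "\<forall>m. \<exists>h\<in>K. \<forall>l<n. R (h l) (x m l)" by (simp add: cyl_def)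
  then obtain h where h: "\<And>m. h m \<in> K" "\<And>m l. l < n \<Longrightarrow> R (h m l) (x m l)" by metis
  obtain h' r where h': "h' \<in> K" "strict_mono r" "(h \<circ> r) \<longlonglongrightarrow> h'"
    using compact_imp_seq_compact[OF K] h(1) unfolding seq_compact_def by blast
  have "R (h' l) (y l)" if "l < n" for l
  proof (rule closed_rel_limit[OF R])
    show "(\<lambda>m. (h \<circ> r) m l) \<longlonglongrightarrow> h' l" using h'(3) by (rule tendsto_coordinate)
    show "(\<lambda>m. (x \<circ> r) m l) \<longlonglongrightarrow> y l" using LIMSEQ_subseq_LIMSEQ[OF lim h'(2)] by (rule tendsto_coordinate)
  qed (use h(2) that in auto)
  then show "y \<in> cyl R K n" using h'(1) by (auto simp: cyl_def)
qed

text \<open>The witness may change with \<open>n\<close>. Compactness provides a limit witness, and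
  every single coordinate condition holds along all sufficiently late witnesses.\<close>

lemma cyl_Inter:
  assumes K: "compact K" and R: "closed {(s, t). R s t}" and x: "\<And>n. x \<in> cyl R K n"
  shows "\<exists>h\<in>K. \<forall>l. R (h l) (x l)"
proof -
  have "\<forall>n. \<exists>h\<in>K. \<forall>l<n. R (h l) (x l)" using x by (simp add: cyl_def)
  then obtain h where h: "\<And>m. h m \<in> K" "\<And>m l. l < m \<Longrightarrow> R (h m l) (x l)" by metis
  obtain h' r where h': "h' \<in> K" "strict_mono r" "(h \<circ> r) \<longlonglongrightarrow> h'"
    using compact_imp_seq_compact[OF K] h(1) unfolding seq_compact_def by blast
  have "R (h' l) (x l)" for l
  proof (rule closed_rel_limit[OF R])
    show "(\<lambda>m. (h \<circ> r) m l) \<longlonglongrightarrow> h' l" using h'(3) by (rule tendsto_coordinate)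
    show "(\<lambda>m. x l) \<longlonglongrightarrow> x l" by simp
    have "R ((h \<circ> r) m l) (x l)" if "Suc l \<le> m" for m
      using h(2)[of l "r m"] that seq_suble[OF h'(2), of m] by auto
    then show "eventually (\<lambda>m. R ((h \<circ> r) m l) (x l)) sequentially" unfolding eventually_sequentially by blast
  qed
  then show ?thesis using h'(1) by blast
qed

lemma cyl_tendsto:
  assumes K: "compact K" and R: "closed {(s, t). R s t}"
  shows "(\<lambda>n. indicator (cyl R K n) x :: real) \<longlonglongrightarrow> indicator {x. \<exists>h\<in>K. \<forall>l. R (h l) (x l)} x"
proof (cases "\<forall>n. x \<in> cyl R K n")
  case True
  then show ?thesis using cyl_Inter[OF K R, of x] by simp
next
  case False
  then obtain n where n: "x \<notin> cyl R K n" by blast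
  have "x \<notin> cyl R K m" if "n \<le> m" for m using n that unfolding cyl_def by force
  then have "eventually (\<lambda>m. indicator (cyl R K m) x = (0::real)) sequentially"
    unfolding eventually_sequentially by (intro exI[of _ n]) simp
  moreover have "x \<notin> {x. \<exists>h\<in>K. \<forall>l. R (h l) (x l)}" using n by (auto simp: cyl_def)
  ultimately show ?thesis by (simp add: tendsto_eventually)
qed

section \<open>Passage to the limit\<close>

lemma BBpath_Cab:
  assumes br: "indep_std_bridges M k a b W" and ab: "a < b" and j: "j \<in> {1..k}" and \<omega>: "\<omega> \<in> space M"
  shows "continuous_on {a..b} (BB a b w z W j \<omega>)" "BBpath a b w z W j \<omega> \<in> Cab a b"
proof -
  have "continuous_on {a..b} (W j \<omega>)" using br j \<omega> by (auto simp: indep_std_bridges_def)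
  then show c: "continuous_on {a..b} (BB a b w z W j \<omega>)"
    unfolding BB_def using ab by (intro continuous_intros) auto
  then have "continuous_on {a..b} (BBpath a b w z W j \<omega>)"
    by (rule continuous_on_eq) (simp add: BBpath_def)
  then show "BBpath a b w z W j \<omega> \<in> Cab a b" by (simp add: Cab_def BBpath_def)
qed

lemma BB_measurable:
  assumes br: "indep_std_bridges M k a b W" and j: "j \<in> {1..k}" and u: "u \<in> {a..b}"
  shows "(\<lambda>\<omega>. BB a b w z W j \<omega> u) \<in> borel_measurable M"
  using W_measurable[OF br j u] unfolding BB_def by measurable

lemma integral_mult_tendsto:
  assumes "prob_space M"
    and f: "\<And>n. f n \<in> borel_measurable M" "\<And>n \<omega>. 0 \<le> f n \<omega> \<and> f n \<omega> \<le> (1::real)" "\<And>\<omega>. (\<lambda>n. f n \<omega>) \<longlonglongrightarrow> f' \<omega>"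
    and g: "\<And>n. g n \<in> borel_measurable M" "\<And>n \<omega>. 0 \<le> g n \<omega> \<and> g n \<omega> \<le> (1::real)" "AE \<omega> in M. (\<lambda>n. g n \<omega>) \<longlonglongrightarrow> g' \<omega>"
      "g' \<in> borel_measurable M"
  shows "(\<lambda>n. \<integral>\<omega>. f n \<omega> * g n \<omega> \<partial>M) \<longlonglongrightarrow> (\<integral>\<omega>. f' \<omega> * g' \<omega> \<partial>M)"
proof (rule integral_dominated_convergence[where w="\<lambda>_. 1"])
  interpret prob_space M by fact
  show "integrable M (\<lambda>_. 1 :: real)" by simp
  have "f' \<in> borel_measurable M" by (rule borel_measurable_LIMSEQ_metric[OF f(1,3)])
  then show "(\<lambda>\<omega>. f' \<omega> * g' \<omega>) \<in> borel_measurable M" using g(4) by measurable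
  show "(\<lambda>\<omega>. f n \<omega> * g n \<omega>) \<in> borel_measurable M" for n using f(1) g(1) by measurable
  show "AE \<omega> in M. (\<lambda>n. f n \<omega> * g n \<omega>) \<longlonglongrightarrow> f' \<omega> * g' \<omega>"
    using g(3) by (rule AE_mp) (intro AE_I2 impI tendsto_mult f)
  show "AE \<omega> in M. norm (f n \<omega> * g n \<omega>) \<le> 1" for n
    using f(2) g(2) by (intro AE_I2) (simp add: mult_le_one)
qed

text \<open>Inner regularity replaces \<open>A\<close>
  by the up-closure of a compact set and \<open>E\<close> by a compact set; both are decreasing limits of cylinder sets.\<close>

lemma limit_inequality:
  fixes wt :: "'s \<Rightarrow> real"
  assumes "prob_space M" and br: "indep_std_bridges M k a b W" and ab: "a < b" and k: "k \<ge> 2"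
    and w: "\<forall>i\<in>{1..<k}. w (Suc i) < w i" and z: "\<forall>i\<in>{1..<k}. z (Suc i) < z i"
    and A: "A \<in> borel_Cab a b" and E: "E \<in> borel_Cab a b" and inc: "increasing_set a b A"
    and q: "dense_seq a b q"
    and U: "\<And>n. finite (U n)" "\<And>n. U n \<subseteq> {a<..<b}" "\<And>n l. l < n \<Longrightarrow> q l \<in> U n"
    and lw: "\<And>n. lattice_weights (U n) (\<Psi> n) (\<kappa> n)"
    and wt: "wt \<in> borel_measurable M" "\<And>\<omega>. 0 \<le> wt \<omega> \<and> wt \<omega> \<le> 1"
    and lim: "AE \<omega> in M. (\<lambda>n. gibbs_weight k (U n) (\<Psi> n) (\<kappa> n) (\<lambda>l. BB a b w z W l \<omega>)) \<longlonglongrightarrow> wt \<omega>"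
  defines "P \<equiv> BBpath a b w z W"
  shows "(\<integral>\<omega>. indicator {\<omega>\<in>space M. P 2 \<omega> \<in> A \<and> P 1 \<omega> \<in> E} \<omega> * wt \<omega> \<partial>M) * (\<integral>\<omega>. wt \<omega> \<partial>M)
    \<le> (\<integral>\<omega>. indicator {\<omega>\<in>space M. P 1 \<omega> \<in> E} \<omega> * wt \<omega> \<partial>M) * (\<integral>\<omega>. indicator {\<omega>\<in>space M. P 1 \<omega> \<in> A} \<omega> * wt \<omega> \<partial>M)"
proof -
  interpret prob_space M by fact
  let ?B = "BB a b w z W"
  define X where "X j \<omega> = (\<lambda>l. ?B j \<omega> (q l))" for j \<omega>
  define r where "r f = (\<lambda>l. f (q l))" for f :: "real \<Rightarrow> real"
  have k12: "1 \<in> {1..k}" "2 \<in> {1..k}" using k by auto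
  note imA = image_borel_Cab[OF ab q A, folded r_def] and imE = image_borel_Cab[OF ab q E, folded r_def]
  have Xm: "X j \<in> borel_measurable M" if "j \<in> {1..k}" for j
  proof -
    have "X j \<in> measurable M (PiM UNIV (\<lambda>_. borel))"
      unfolding X_def by (rule measurable_PiM_single') (auto intro!: BB_measurable[OF br that] dense_seq_in[OF q])
    then show ?thesis unfolding measurable_cong_sets[OF refl sets_PiM_equal_borel] .
  qed
  have XP: "X j \<omega> = r (P j \<omega>)" for j \<omega>
    using dense_seq_in[OF q] by (auto simp: X_def r_def P_def BBpath_def)
  \<comment> \<open>The trace along \<open>q\<close> decides membership, because elements of
    \<open>Cab a b\<close> are determined by their values at these times.\<close>
  have mem: "P j \<omega> \<in> S \<longleftrightarrow> X j \<omega> \<in> r ` S" if "j \<in> {1..k}" "\<omega> \<in> space M" "S \<subseteq> Cab a b" for j \<omega> S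
  proof
    assume "X j \<omega> \<in> r ` S"
    then obtain f where f: "f \<in> S" "r (P j \<omega>) = r f" by (auto simp: XP)
    have "P j \<omega> \<in> Cab a b" unfolding P_def using BBpath_Cab(2)[OF br ab that(1,2)] .
    then have "P j \<omega> = f" using Cab_eqI[OF q, of "P j \<omega>" f] f that(3) by (auto simp: r_def)
    then show "P j \<omega> \<in> S" using f by simp
  qed (simp add: XP)
  have pm: "(\<lambda>\<omega>. P j \<omega> \<in> S) \<in> measurable M (count_space UNIV)"
    if j: "j \<in> {1..k}" and S: "S \<in> borel_Cab a b" for j S
  proof -
    note im = image_borel_Cab[OF ab q S, folded r_def]
    have "(\<lambda>\<omega>. X j \<omega> \<in> r ` S) \<in> measurable M (count_space UNIV)"
      using Xm[OF j] im(1) by measurable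
    then show ?thesis using mem[OF j _ im(2)] by (simp cong: measurable_cong)
  qed
  note pm1 [measurable] = pm[OF k12(1) E] pm[OF k12(1) A] pm[OF k12(2) A]
  define g where "g n \<omega> = gibbs_weight k (U n) (\<Psi> n) (\<kappa> n) (\<lambda>l. ?B l \<omega>)" for n \<omega>
  have gm: "g n \<in> borel_measurable M" for n
    unfolding g_def using k U(2)[of n] by (intro gibbs_weight_measurable[OF lw] BB_measurable[OF br]) (auto intro: less_imp_le)
  have g01: "0 \<le> g n \<omega> \<and> g n \<omega> \<le> 1" for n \<omega>
    unfolding g_def using gibbs_weight_bounds[OF lw] by blast
  have glim: "AE \<omega> in M. (\<lambda>n. g n \<omega>) \<longlonglongrightarrow> wt \<omega>" using lim unfolding g_def .
  have intwt: "integrable M (\<lambda>\<omega>. f \<omega> * wt \<omega>)" if "f \<in> borel_measurable M" "\<And>\<omega>. 0 \<le> f \<omega> \<and> f \<omega> \<le> 1" for f :: "'s \<Rightarrow> real"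
    using that wt by (intro integrable_const_bound[where B=1]) (auto simp: abs_mult mult_le_one)
  have closed_le: "closed {(s, t). s \<le> (t::real)}" and closed_eq: "closed {(s, t). s = (t::real)}"
  proof -
    have "{(s, t). s \<le> (t::real)} = {p. fst p \<le> snd p}" "{(s, t). s = (t::real)} = {p. fst p = snd p}" by auto
    then show "closed {(s, t). s \<le> (t::real)}" "closed {(s, t). s = (t::real)}"
      by (auto intro!: closed_Collect_le closed_Collect_eq continuous_intros)
  qed
  define up where "up K = {x :: nat \<Rightarrow> real. \<exists>h\<in>K. \<forall>l. h l \<le> x l}" for K
  define same where "same K = {x :: nat \<Rightarrow> real. \<exists>h\<in>K. \<forall>l. h l = x l}" for K
  have compact_case: "(\<integral>\<omega>. (indicator (up KA) (X 2 \<omega>) * indicator (same KE) (X 1 \<omega>)) * wt \<omega> \<partial>M) * (\<integral>\<omega>. 1 * wt \<omega> \<partial>M)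
    \<le> (\<integral>\<omega>. indicator (same KE) (X 1 \<omega>) * wt \<omega> \<partial>M) * (\<integral>\<omega>. indicator (up KA) (X 1 \<omega>) * wt \<omega> \<partial>M)"
    if K: "compact KA" "compact KE" for KA KE
  proof -
    define cA where "cA n = (indicator (cyl (\<le>) KA n) :: _ \<Rightarrow> real)" for n
    define cE where "cE n = (indicator (cyl (=) KE n) :: _ \<Rightarrow> real)" for n
    have c01: "0 \<le> cA n x \<and> cA n x \<le> 1" "0 \<le> cE n x \<and> cE n x \<le> 1" for n x
      by (auto simp: cA_def cE_def indicator_def)
    have cm: "cA n \<in> borel_measurable borel" "cE n \<in> borel_measurable borel" for n
      unfolding cA_def cE_def using closed_cyl[OF K(1) closed_le] closed_cyl[OF K(2) closed_eq]
      by (auto intro!: borel_measurable_indicator borel_closed)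
    have cX: "(\<lambda>\<omega>. cA n (X 1 \<omega>)) \<in> borel_measurable M" "(\<lambda>\<omega>. cA n (X 2 \<omega>)) \<in> borel_measurable M" "(\<lambda>\<omega>. cE n (X 1 \<omega>)) \<in> borel_measurable M" for n
      using measurable_compose[OF Xm cm(1)] measurable_compose[OF Xm cm(2)] k12 by auto
    \<comment> \<open>Rebuilds a sequence from grid values. The zeros from index \<open>n\<close> on
      are never read, as the cylinders of stage \<open>n\<close> look only at indices below
      \<open>n\<close>.\<close>
    define fill where "fill n f = (\<lambda>l. if l < n then f (q l) else 0)" for n :: nat and f :: "real \<Rightarrow> real"
    have fillm: "fill n \<in> borel_measurable (PiM (U n) (\<lambda>_. borel))" for n
    proof -
      have "fill n \<in> measurable (PiM (U n) (\<lambda>_. borel)) (PiM UNIV (\<lambda>_. borel))"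
      proof (rule measurable_PiM_single')
        fix l
        show "(\<lambda>f. fill n f l) \<in> borel_measurable (PiM (U n) (\<lambda>_. borel))"
        proof (cases "l < n")
          case True
          then show ?thesis using measurable_component_singleton[OF U(3)[OF True], of "\<lambda>_. borel"] by (simp add: fill_def)
        qed (simp add: fill_def)
      qed auto
      then show ?thesis unfolding measurable_cong_sets[OF refl sets_PiM_equal_borel] .
    qed
    have fillX: "cA n (fill n (\<lambda>u\<in>U n. ?B j \<omega> u)) = cA n (X j \<omega>)"
      "cE n (fill n (\<lambda>u\<in>U n. ?B j \<omega> u)) = cE n (X j \<omega>)" for n j \<omega>
    proof -
      have "fill n (\<lambda>u\<in>U n. ?B j \<omega> u) l = X j \<omega> l" if "l < n" for l
        using U(3)[OF that] that by (simp add: fill_def X_def)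
      then show "cA n (fill n (\<lambda>u\<in>U n. ?B j \<omega> u)) = cA n (X j \<omega>)"
        "cE n (fill n (\<lambda>u\<in>U n. ?B j \<omega> u)) = cE n (X j \<omega>)"
        by (simp_all add: cA_def cE_def indicator_def cyl_def)
    qed
    have step: "(\<integral>\<omega>. (cA n (X 2 \<omega>) * cE n (X 1 \<omega>)) * g n \<omega> \<partial>M) * (\<integral>\<omega>. 1 * g n \<omega> \<partial>M)
      \<le> (\<integral>\<omega>. cE n (X 1 \<omega>) * g n \<omega> \<partial>M) * (\<integral>\<omega>. cA n (X 1 \<omega>) * g n \<omega> \<partial>M)" for n
    proof -
      have "(\<integral>\<omega>. cA n (fill n (\<lambda>u\<in>U n. ?B 2 \<omega> u)) * cE n (fill n (\<lambda>u\<in>U n. ?B 1 \<omega> u)) * g n \<omega> \<partial>M) * (\<integral>\<omega>. g n \<omega> \<partial>M)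
        \<le> (\<integral>\<omega>. cE n (fill n (\<lambda>u\<in>U n. ?B 1 \<omega> u)) * g n \<omega> \<partial>M) * (\<integral>\<omega>. cA n (fill n (\<lambda>u\<in>U n. ?B 1 \<omega> u)) * g n \<omega> \<partial>M)"
        unfolding g_def
      proof (rule finite_grid_inequality[OF assms(1) br ab k w z U(1,2) _ _ _ _ _ lw])
        show "(\<lambda>f. cA n (fill n f)) \<in> borel_measurable (PiM (U n) (\<lambda>_. borel))"
          "(\<lambda>f. cE n (fill n f)) \<in> borel_measurable (PiM (U n) (\<lambda>_. borel))"
          using measurable_compose[OF fillm cm(1)] measurable_compose[OF fillm cm(2)] by auto
        fix f h :: "real \<Rightarrow> real" assume fh: "\<And>u. u \<in> U n \<Longrightarrow> f u \<le> h u"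
        have "fill n f l \<le> fill n h l" for l using fh U(3) by (auto simp: fill_def)
        then have "fill n f \<in> cyl (\<le>) KA n \<Longrightarrow> fill n h \<in> cyl (\<le>) KA n"
          unfolding cyl_def by (blast intro: order_trans)
        then show "cA n (fill n f) \<le> cA n (fill n h)" by (auto simp: cA_def indicator_def)
      qed (use c01 in auto)
      then show ?thesis unfolding fillX by simp
    qed
    have limA: "(\<lambda>n. cA n x) \<longlonglongrightarrow> indicator (up KA) x" and limE: "(\<lambda>n. cE n x) \<longlonglongrightarrow> indicator (same KE) x" for x
      unfolding cA_def cE_def up_def same_def
      using cyl_tendsto[OF K(1) closed_le, of x] cyl_tendsto[OF K(2) closed_eq, of x] by auto
    note T = integral_mult_tendsto[OF assms(1) _ _ _ gm g01 glim wt(1)]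
    have "(\<lambda>n. (\<integral>\<omega>. (cA n (X 2 \<omega>) * cE n (X 1 \<omega>)) * g n \<omega> \<partial>M) * (\<integral>\<omega>. 1 * g n \<omega> \<partial>M))
      \<longlonglongrightarrow> (\<integral>\<omega>. (indicator (up KA) (X 2 \<omega>) * indicator (same KE) (X 1 \<omega>)) * wt \<omega> \<partial>M) * (\<integral>\<omega>. 1 * wt \<omega> \<partial>M)"
      using cX c01 by (intro tendsto_mult T limA limE) (auto intro!: mult_le_one)
    moreover have "(\<lambda>n. (\<integral>\<omega>. cE n (X 1 \<omega>) * g n \<omega> \<partial>M) * (\<integral>\<omega>. cA n (X 1 \<omega>) * g n \<omega> \<partial>M))
      \<longlonglongrightarrow> (\<integral>\<omega>. indicator (same KE) (X 1 \<omega>) * wt \<omega> \<partial>M) * (\<integral>\<omega>. indicator (up KA) (X 1 \<omega>) * wt \<omega> \<partial>M)"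
      using cX c01 by (intro tendsto_mult[of "\<lambda>n. \<integral>\<omega>. cE n (X 1 \<omega>) * g n \<omega> \<partial>M"] T limA limE) auto
    ultimately show ?thesis by (rule LIMSEQ_le) (use step in blast)
  qed
  have sameK: "same K = K" for K by (auto simp: same_def fun_eq_iff[symmetric])
  have law: "finite_measure (distr M borel (X j))" if "j \<in> {1..k}" for j
    using prob_space_distr[OF Xm[OF that]] by (simp add: prob_space_def)
  let ?N = "\<lambda>S. \<integral>\<omega>. indicator S \<omega> * wt \<omega> \<partial>M"
  let ?AE = "{\<omega>\<in>space M. P 2 \<omega> \<in> A \<and> P 1 \<omega> \<in> E}" and ?E = "{\<omega>\<in>space M. P 1 \<omega> \<in> E}" and ?A = "{\<omega>\<in>space M. P 1 \<omega> \<in> A}"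
  have sets [measurable]: "?AE \<in> sets M" "?E \<in> sets M" "?A \<in> sets M" by measurable
  have wt1: "0 \<le> (\<integral>\<omega>. wt \<omega> \<partial>M)" "(\<integral>\<omega>. wt \<omega> \<partial>M) \<le> 1"
  proof -
    show "0 \<le> (\<integral>\<omega>. wt \<omega> \<partial>M)" using wt by simp
    have "(\<integral>\<omega>. wt \<omega> \<partial>M) \<le> (\<integral>\<omega>. 1 \<partial>M)" using intwt[of "\<lambda>_. 1"] wt(2) by (intro integral_mono) auto
    then show "(\<integral>\<omega>. wt \<omega> \<partial>M) \<le> 1" by (simp add: prob_space)
  qed
  show "?N ?AE * (\<integral>\<omega>. wt \<omega> \<partial>M) \<le> ?N ?E * ?N ?A"
  \<comment> \<open>Passing to the up-closure of \<open>KA\<close> and to \<open>KE\<close> can only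
    decrease the right side. It costs the left side at most \<open>e\<close>, half for each set,
    because \<open>wt\<close> is bounded by \<open>1\<close>.\<close>
  proof (rule field_le_epsilon)
    fix e :: real assume e: "0 < e"
    obtain KA where KA: "KA \<subseteq> r ` A" "compact KA" "measure (distr M borel (X 2)) (r ` A - KA) < e / 2"
      by (rule inner_compact[OF law[OF k12(2)] _ imA(1), of "e / 2"]) (use e in auto)
    obtain KE where KE: "KE \<subseteq> r ` E" "compact KE" "measure (distr M borel (X 1)) (r ` E - KE) < e / 2"
      by (rule inner_compact[OF law[OF k12(1)] _ imE(1), of "e / 2"]) (use e in auto)
    have KAm: "KA \<in> sets borel" "KE \<in> sets borel" using KA KE by (auto intro: borel_closed compact_imp_closed)
    have upm: "up KA \<in> sets borel"
    proof -
      have "up KA = (\<Inter>n. cyl (\<le>) KA n)"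
        using cyl_Inter[OF KA(2) closed_le] by (auto simp: up_def) (auto simp: cyl_def)
      then show ?thesis using closed_cyl[OF KA(2) closed_le] by (auto intro!: borel_closed)
    qed
    note Xm1 [measurable] = Xm[OF k12(1)] Xm[OF k12(2)] and [measurable] = KAm upm imA(1) imE(1) wt(1)
    \<comment> \<open>A path that lies above an element of \<open>KA\<close> at all
      \<open>q l\<close> lies above it everywhere, and \<open>A\<close> is increasing.\<close>
    have upA: "P j \<omega> \<in> A" if "X j \<omega> \<in> up KA" "j \<in> {1..k}" "\<omega> \<in> space M" for j \<omega>
    proof -
      obtain h where h: "h \<in> KA" "\<And>l. h l \<le> X j \<omega> l" using \<open>X j \<omega> \<in> up KA\<close> by (auto simp: up_def)
      obtain f where f: "f \<in> A" "h = r f" using h(1) KA(1) by auto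
      have PC: "P j \<omega> \<in> Cab a b" unfolding P_def using BBpath_Cab(2)[OF br ab that(2,3)] .
      have "\<forall>u\<in>{a..b}. f u \<le> P j \<omega> u"
        using le_of_dense[OF q, of f "P j \<omega>"] h(2) f PC imA(2) by (auto simp: Cab_def r_def XP)
      then show ?thesis using inc f(1) PC by (auto simp: increasing_set_def)
    qed
    have EE: "P 1 \<omega> \<in> E" if "X 1 \<omega> \<in> KE" "\<omega> \<in> space M" for \<omega>
      using mem[OF k12(1) that(2) imE(2)] that(1) KE(1) by auto
    let ?a = "\<lambda>j \<omega>. indicator (up KA) (X j \<omega>) :: real" and ?e = "\<lambda>\<omega>. indicator KE (X 1 \<omega>) :: real"
    let ?rA = "\<lambda>\<omega>. indicator (r ` A - KA) (X 2 \<omega>) :: real" and ?rE = "\<lambda>\<omega>. indicator (r ` E - KE) (X 1 \<omega>) :: real"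
    have rA: "(\<integral>\<omega>. ?rA \<omega> \<partial>M) < e / 2" "(\<integral>\<omega>. ?rE \<omega> \<partial>M) < e / 2"
    proof -
      have "(\<integral>\<omega>. ?rA \<omega> \<partial>M) = (\<integral>x. indicator (r ` A - KA) x \<partial>distr M borel (X 2))"
        by (rule integral_distr[symmetric]) measurable
      then show "(\<integral>\<omega>. ?rA \<omega> \<partial>M) < e / 2" using KA(3) by simp
      have "(\<integral>\<omega>. ?rE \<omega> \<partial>M) = (\<integral>x. indicator (r ` E - KE) x \<partial>distr M borel (X 1))"
        by (rule integral_distr[symmetric]) measurable
      then show "(\<integral>\<omega>. ?rE \<omega> \<partial>M) < e / 2" using KE(3) by simp
    qed
    have ir: "integrable M ?rA" "integrable M ?rE"
    proof -
      have "?rA \<in> borel_measurable M" "?rE \<in> borel_measurable M" by measurable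
      then show "integrable M ?rA" "integrable M ?rE"
        by (auto intro!: integrable_const_bound[where B=1] AE_I2 split: split_indicator)
    qed
    have iw: "integrable M (\<lambda>\<omega>. (?a 2 \<omega> * ?e \<omega>) * wt \<omega>)" "integrable M (\<lambda>\<omega>. ?e \<omega> * wt \<omega>)" "integrable M (\<lambda>\<omega>. ?a 1 \<omega> * wt \<omega>)"
      "integrable M (\<lambda>\<omega>. indicator ?AE \<omega> * wt \<omega>)" "integrable M (\<lambda>\<omega>. indicator ?E \<omega> * wt \<omega>)" "integrable M (\<lambda>\<omega>. indicator ?A \<omega> * wt \<omega>)"
    proof -
      have i01: "0 \<le> (indicator S x :: real) \<and> (indicator S x :: real) \<le> 1" for S :: "'c set" and x
        by (simp add: indicator_def)
      have i01': "0 \<le> ?a 2 \<omega> * ?e \<omega> \<and> ?a 2 \<omega> * ?e \<omega> \<le> 1" for \<omega>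
        by (simp add: indicator_def)
      have m: "(\<lambda>\<omega>. ?a 2 \<omega> * ?e \<omega>) \<in> borel_measurable M" "?e \<in> borel_measurable M" "?a 1 \<in> borel_measurable M"
        by measurable
      show "integrable M (\<lambda>\<omega>. (?a 2 \<omega> * ?e \<omega>) * wt \<omega>)" by (rule intwt[OF m(1) i01'])
      show "integrable M (\<lambda>\<omega>. ?e \<omega> * wt \<omega>)" "integrable M (\<lambda>\<omega>. ?a 1 \<omega> * wt \<omega>)"
        by (rule intwt[OF m(2) i01], rule intwt[OF m(3) i01])
      show "integrable M (\<lambda>\<omega>. indicator ?AE \<omega> * wt \<omega>)" "integrable M (\<lambda>\<omega>. indicator ?E \<omega> * wt \<omega>)"
        "integrable M (\<lambda>\<omega>. indicator ?A \<omega> * wt \<omega>)"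
        by (rule intwt[OF borel_measurable_indicator[OF sets(1)] i01], rule intwt[OF borel_measurable_indicator[OF sets(2)] i01],
          rule intwt[OF borel_measurable_indicator[OF sets(3)] i01])
    qed
    have "?N ?AE \<le> (\<integral>\<omega>. (?a 2 \<omega> * ?e \<omega>) * wt \<omega> + (?rA \<omega> + ?rE \<omega>) \<partial>M)"
    proof (rule integral_mono)
      fix \<omega> assume \<omega>: "\<omega> \<in> space M"
      have "indicator ?AE \<omega> * wt \<omega> \<le> (?a 2 \<omega> * ?e \<omega>) * wt \<omega> + (?rA \<omega> + ?rE \<omega>)" if "\<omega> \<in> ?AE"
      proof (cases "X 2 \<omega> \<in> KA \<and> X 1 \<omega> \<in> KE")
        case True
        then have "X 2 \<omega> \<in> up KA" by (auto simp: up_def)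
        then show ?thesis using True that by simp
      next
        case False
        then have "1 \<le> ?rA \<omega> + ?rE \<omega>"
          using that mem[OF k12(2) \<omega> imA(2)] mem[OF k12(1) \<omega> imE(2)] by (auto simp: indicator_def)
        moreover have "0 \<le> (?a 2 \<omega> * ?e \<omega>) * wt \<omega>" using wt(2) by simp
        moreover have "indicator ?AE \<omega> * wt \<omega> = wt \<omega>" using that by simp
        ultimately show ?thesis using wt(2)[of \<omega>] by linarith
      qed
      moreover have "0 \<le> (?a 2 \<omega> * ?e \<omega>) * wt \<omega> + (?rA \<omega> + ?rE \<omega>)" using wt(2) by simp
      ultimately show "indicator ?AE \<omega> * wt \<omega> \<le> (?a 2 \<omega> * ?e \<omega>) * wt \<omega> + (?rA \<omega> + ?rE \<omega>)"
        by (cases "\<omega> \<in> ?AE") (simp_all add: indicator_def)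
    qed (use iw ir in auto)
    also have "\<dots> = (\<integral>\<omega>. (?a 2 \<omega> * ?e \<omega>) * wt \<omega> \<partial>M) + ((\<integral>\<omega>. ?rA \<omega> \<partial>M) + (\<integral>\<omega>. ?rE \<omega> \<partial>M))"
      using iw ir by (simp only: Bochner_Integration.integral_add Bochner_Integration.integrable_add)
    also have "\<dots> \<le> (\<integral>\<omega>. (?a 2 \<omega> * ?e \<omega>) * wt \<omega> \<partial>M) + e" using rA by simp
    finally have "?N ?AE * (\<integral>\<omega>. wt \<omega> \<partial>M) \<le> ((\<integral>\<omega>. (?a 2 \<omega> * ?e \<omega>) * wt \<omega> \<partial>M) + e) * (\<integral>\<omega>. wt \<omega> \<partial>M)"
      using wt1 by (intro mult_right_mono)
    also have "\<dots> \<le> (\<integral>\<omega>. (?a 2 \<omega> * ?e \<omega>) * wt \<omega> \<partial>M) * (\<integral>\<omega>. wt \<omega> \<partial>M) + e"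
      using wt1 e by (simp add: distrib_right mult_left_le)
    also have "\<dots> \<le> (\<integral>\<omega>. ?e \<omega> * wt \<omega> \<partial>M) * (\<integral>\<omega>. ?a 1 \<omega> * wt \<omega> \<partial>M) + e"
      using compact_case[OF KA(2) KE(2)] by (simp add: sameK)
    also have "\<dots> \<le> ?N ?E * ?N ?A + e"
    proof -
      have "(\<integral>\<omega>. ?e \<omega> * wt \<omega> \<partial>M) \<le> ?N ?E"
        using EE wt(2) by (intro integral_mono iw mult_right_mono) (auto simp: indicator_def)
      moreover have "(\<integral>\<omega>. ?a 1 \<omega> * wt \<omega> \<partial>M) \<le> ?N ?A"
        using upA[OF _ k12(1)] wt(2) by (intro integral_mono iw mult_right_mono) (auto simp: indicator_def)
      moreover have "0 \<le> (\<integral>\<omega>. ?a 1 \<omega> * wt \<omega> \<partial>M)" "0 \<le> ?N ?E" using wt(2) by auto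
      ultimately show ?thesis by (simp add: mult_mono)
    qed
    finally show "?N ?AE * (\<integral>\<omega>. wt \<omega> \<partial>M) \<le> ?N ?E * ?N ?A + e" .
  qed
qed

section \<open>Positive temperature\<close>

text \<open>The prescribed set \<open>C\<close> is for zero temperature, where suitably chosen times
  of the barrier must belong to the sequence.\<close>

lemma ex_dense_seq:
  assumes ab: "a < b" and C: "countable C" "C \<subseteq> {a<..<b}"
  shows "\<exists>q. dense_seq a b q \<and> C \<subseteq> range q"
proof -
  define S where "S = C \<union> (\<rat> \<inter> {a<..<b})"
  obtain x where x: "x \<in> \<rat>" "a < x" "x < b" using Rats_dense_in_real[OF ab] by blast
  have S: "countable S" "S \<noteq> {}" using C x countable_rat by (auto simp: S_def)
  define q where "q = from_nat_into S"
  have r: "range q = S" unfolding q_def using S by (rule range_from_nat_into[rotated])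
  have "u \<in> closure S" if u: "u \<in> {a..b}" for u
    unfolding closure_approachable
  proof (intro allI impI)
    fix e :: real assume e: "0 < e"
    have "max a (u - e) < min b (u + e)" using u e ab by (auto simp: max_def min_def)
    then obtain y where "y \<in> \<rat>" "max a (u - e) < y" "y < min b (u + e)" using Rats_dense_in_real by blast
    then show "\<exists>y\<in>S. dist y u < e" by (intro bexI[of _ y]) (auto simp: S_def dist_real_def)
  qed
  moreover have "S \<subseteq> {a<..<b}" using C by (auto simp: S_def)
  ultimately have "dense_seq a b q" unfolding dense_seq_def r by blast
  then show ?thesis using r by (auto simp: S_def)
qed

text \<open>Midpoints of the cells, rather than their ends, keep the grid inside the open
  interval.\<close>

definition midpoints :: "real \<Rightarrow> real \<Rightarrow> nat \<Rightarrow> real set" where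
  "midpoints a b n = (\<lambda>i. a + (b - a) * (real i + 1 / 2) / real n) ` {..<n}"

lemma midpoints_in: "a < b \<Longrightarrow> midpoints a b n \<subseteq> {a<..<b}"
proof
  fix u assume ab: "a < b" and "u \<in> midpoints a b n"
  then obtain i where i: "i < n" "u = a + (b - a) * (real i + 1 / 2) / real n" by (auto simp: midpoints_def)
  have "(b - a) * (real i + 1 / 2) < (b - a) * real n" using ab i by (intro mult_strict_left_mono) auto
  then have "(b - a) * (real i + 1 / 2) / real n < b - a" using i by (simp add: divide_less_eq)
  moreover have "0 < (b - a) * (real i + 1 / 2) / real n" using ab i by (intro divide_pos_pos mult_pos_pos) auto
  ultimately show "u \<in> {a<..<b}" using i by simp
qed

lemma sum_midpoints:
  assumes "a < b"
  shows "(\<Sum>u\<in>midpoints a b n. f u) = (\<Sum>i<n. f (a + (b - a) * (real i + 1 / 2) / real n))"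
  unfolding midpoints_def using assms
  by (subst sum.reindex) (auto simp: inj_on_def)

lemma midpoint_sums_tendsto:
  fixes h :: "real \<Rightarrow> real"
  assumes ab: "a < b" and h: "continuous_on {a..b} h"
  shows "(\<lambda>n. \<Sum>u\<in>midpoints a b n. (b - a) / real n * h u) \<longlonglongrightarrow> integral {a..b} h"
proof (rule LIMSEQ_I)
  fix r :: real assume r: "0 < r"
  define e where "e = r / (2 * (b - a))"
  have e: "0 < e" using r ab by (simp add: e_def)
  have "uniformly_continuous_on {a..b} h" using h by (intro compact_uniformly_continuous) auto
  then obtain d where d: "0 < d" "\<And>u v. u \<in> {a..b} \<Longrightarrow> v \<in> {a..b} \<Longrightarrow> dist v u < d \<Longrightarrow> dist (h v) (h u) < e"
    using e unfolding uniformly_continuous_on_def by metis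
  obtain n0 where n0: "(b - a) / d < real n0" using reals_Archimedean2 by blast
  show "\<exists>n0. \<forall>n\<ge>n0. norm ((\<Sum>u\<in>midpoints a b n. (b - a) / real n * h u) - integral {a..b} h) < r"
  proof (intro exI[of _ "Suc n0"] allI impI)
    fix n assume n: "Suc n0 \<le> n"
    define \<delta> where "\<delta> = (b - a) / real n"
    have np: "0 < real n" using n by auto
    have \<delta>: "0 < \<delta>" "\<delta> < d"
    proof -
      show "0 < \<delta>" using ab np by (simp add: \<delta>_def)
      have "(b - a) / d < real n" using n0 n by (meson less_le_trans Suc_leD of_nat_le_iff order.strict_trans2)
      then show "\<delta> < d" using d(1) np unfolding \<delta>_def by (simp add: divide_less_eq mult.commute)
    qed
    define x where "x i = a + \<delta> * real i" for i
    have xb: "a \<le> x i" "i \<le> n \<Longrightarrow> x i \<le> b" "x i < x (Suc i)" for i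
    proof -
      show "a \<le> x i" using \<delta> by (simp add: x_def)
      show "x i < x (Suc i)" using \<delta> by (simp add: x_def algebra_simps)
      assume "i \<le> n"
      then have "\<delta> * real i \<le> \<delta> * real n" using \<delta> by (intro mult_left_mono) auto
      also have "\<dots> = b - a" using np by (simp add: \<delta>_def)
      finally show "x i \<le> b" by (simp add: x_def)
    qed
    have xn: "x n = b" using np by (simp add: x_def \<delta>_def)
    have int: "h integrable_on {u..v}" if "a \<le> u" "v \<le> b" for u v
      using that by (intro integrable_continuous_real continuous_on_subset[OF h]) auto
    have pieces: "\<bar>(\<Sum>i<m. \<delta> * h (x i + \<delta> / 2)) - integral {a..x m} h\<bar> \<le> real m * (e * \<delta>)" if "m \<le> n" for m
      using that
    proof (induction m)
      case 0
      then show ?case by (simp add: x_def)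
    next
      case (Suc m)
      have I: "integral {a..x (Suc m)} h = integral {a..x m} h + integral {x m..x (Suc m)} h"
        using Suc.prems xb[of m] xb(2)[of "Suc m"] by (intro Henstock_Kurzweil_Integration.integral_combine[symmetric] int) auto
      have sub: "a \<le> x m" "x (Suc m) \<le> b" "x (Suc m) - x m = \<delta>" "x m + \<delta> / 2 \<in> {a..b}"
        using Suc.prems xb[of m] xb(2)[of "Suc m"] \<delta> by (auto simp: x_def algebra_simps)
      have "norm (integral {x m..x (Suc m)} (\<lambda>u. h u - h (x m + \<delta> / 2))) \<le> e * (x (Suc m) - x m)"
      proof (rule integral_bound)
        show "continuous_on {x m..x (Suc m)} (\<lambda>u. h u - h (x m + \<delta> / 2))"
          using sub by (intro continuous_intros continuous_on_subset[OF h]) auto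
        show "norm (h u - h (x m + \<delta> / 2)) \<le> e" if u: "u \<in> {x m..x (Suc m)}" for u
        proof -
          have "\<bar>u - (x m + \<delta> / 2)\<bar> \<le> \<delta> / 2" using u sub(3) by (simp add: abs_le_iff field_simps)
          then have "dist u (x m + \<delta> / 2) < d" using \<delta> by (simp add: dist_real_def)
          then have "dist (h u) (h (x m + \<delta> / 2)) < e" using u sub by (intro d(2)) auto
          then show ?thesis by (simp add: dist_norm)
        qed
      qed (use xb[of m] in auto)
      moreover have "integral {x m..x (Suc m)} (\<lambda>u. h u - h (x m + \<delta> / 2)) = integral {x m..x (Suc m)} h - \<delta> * h (x m + \<delta> / 2)"
        using int[OF sub(1,2)] sub(3) xb(3)[of m] by (subst Henstock_Kurzweil_Integration.integral_diff) auto
      ultimately have "\<bar>\<delta> * h (x m + \<delta> / 2) - integral {x m..x (Suc m)} h\<bar> \<le> e * \<delta>"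
        using sub(3) by (simp add: abs_minus_commute)
      then show ?case using Suc.IH Suc.prems unfolding I by (simp add: algebra_simps abs_le_iff)
    qed
    have "(\<Sum>u\<in>midpoints a b n. (b - a) / real n * h u) = (\<Sum>i<n. \<delta> * h (x i + \<delta> / 2))"
      unfolding sum_midpoints[OF ab] \<delta>_def x_def
      by (intro sum.cong refl arg_cong2[of _ _ _ _ times] arg_cong[of _ _ h]) (simp add: field_simps)
    then have "\<bar>(\<Sum>u\<in>midpoints a b n. (b - a) / real n * h u) - integral {a..b} h\<bar> \<le> real n * (e * \<delta>)"
      using pieces[of n] xn by simp
    also have "real n * (e * \<delta>) = e * (b - a)" using np by (simp add: \<delta>_def)
    also have "\<dots> = r / 2" using ab by (simp add: e_def divide_simps)
    finally show "norm ((\<Sum>u\<in>midpoints a b n. (b - a) / real n * h u) - integral {a..b} h) < r" using r by simp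
  qed
qed

text \<open>The two pairs of arguments have the same sum, and the pair on the left is no more spread
  out than the one on the right. Convexity of the exponential decides.\<close>

lemma Ht_submodular:
  assumes "0 < t"
  shows "Ht t (max x' y' - max x y) + Ht t (min x' y' - min x y) \<le> Ht t (x' - x) + Ht t (y' - y)"
proof -
  have conv: "exp (p + r) + exp (p' - r) \<le> exp p + exp p'" if "0 \<le> r" "p + r \<le> p'" for p p' r :: real
  proof -
    have "0 \<le> (exp p' - exp (p + r)) * (1 - exp (- r))" using that by (intro mult_nonneg_nonneg) auto
    moreover have "exp p' * exp (- r) = exp (p' - r)" "exp (p + r) * exp (- r) = exp p"
      by (simp_all add: exp_add[symmetric])
    ultimately show ?thesis by (simp add: algebra_simps)
  qed
  define s where "s = t powr (1/3)"
  have s: "0 < s" using assms by (simp add: s_def)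
  have key: "exp (s * (max x' y' - max x y)) + exp (s * (min x' y' - min x y)) \<le> exp (s * (x' - x)) + exp (s * (y' - y))"
  proof (cases "(x' \<le> y') = (x \<le> y)")
    case True
    then show ?thesis by (cases "x \<le> y") (simp_all add: max_def min_def)
  next
    case False
    show ?thesis
    proof (cases "x \<le> y")
      case True
      then have "y' < x'" using False by simp
      then show ?thesis
        using conv[of "s * (y - x)" "s * (y' - y)" "s * (x' - x)"] True s
        by (simp add: max_def min_def algebra_simps)
    next
      case f: False
      then have "x' \<le> y'" using False by simp
      then show ?thesis
        using conv[of "s * (x - y)" "s * (x' - x)" "s * (y' - y)"] f s
        by (simp add: max_def min_def algebra_simps)
    qed
  qed
  have "2 * t powr (2/3) * (exp (s * (max x' y' - max x y)) + exp (s * (min x' y' - min x y)))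
    \<le> 2 * t powr (2/3) * (exp (s * (x' - x)) + exp (s * (y' - y)))"
    using key by (intro mult_left_mono) auto
  then show ?thesis unfolding Ht_def s_def[symmetric] by (simp only: distrib_left)
qed

lemma positive_temperature:
  fixes M :: "'s measure"
  assumes "prob_space M" and br: "indep_std_bridges M k a b W" and k: "k \<ge> 2" and ab: "a < b"
    and w: "\<forall>i\<in>{1..<k}. w (Suc i) < w i" and z: "\<forall>i\<in>{1..<k}. z (Suc i) < z i"
    and A: "A \<in> borel_Cab a b" and E: "E \<in> borel_Cab a b" and inc: "increasing_set a b A" and t: "0 < t"
  defines "P \<equiv> prob_t M a b k w z W t" and "B \<equiv> BBpath a b w z W"
  assumes pos: "P {\<omega>\<in>space M. B 1 \<omega> \<in> E} > 0"
  shows "P {\<omega>\<in>space M. B 2 \<omega> \<in> A \<and> B 1 \<omega> \<in> E} / P {\<omega>\<in>space M. B 1 \<omega> \<in> E} \<le> P {\<omega>\<in>space M. B 1 \<omega> \<in> A}"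
proof -
  interpret prob_space M by fact
  let ?B = "BB a b w z W"
  obtain q where q: "dense_seq a b q" using ex_dense_seq[OF ab, of "{}"] by auto
  \<comment> \<open>The sequence points serve the cylinders, the midpoints serve the Riemann sums of
    the energy. \<open>c n\<close> vanishes off the midpoints, so the other points do not disturb
    the sums.\<close>
  define U where "U n = q ` {..<n} \<union> midpoints a b n" for n
  define c where "c n u = (if u \<in> midpoints a b n then (b - a) / real n else 0)" for n u
  define \<Psi> where "\<Psi> n u r = exp (- (c n u * Ht t r))" for n u r
  \<comment> \<open>There is no floor, and the last clause of \<open>lattice_weights\<close> reduces
    to monotonicity of \<open>\<Psi>\<close>.\<close>
  define \<kappa> where "\<kappa> n u r = (1 :: real)" for n :: nat and u r :: real
  define wt where "wt \<omega> = (if \<omega> \<in> space M then weight_t a b k w z W t \<omega> else 0)" for \<omega>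
  have c0: "0 \<le> c n u" for n u using ab by (simp add: c_def)
  have Ht0: "0 \<le> Ht t r" for r by (simp add: Ht_def)
  have Ht_mono: "Ht t r \<le> Ht t s" if "r \<le> s" for r s using that by (simp add: Ht_def mult_left_mono)
  have Htc: "continuous_on S (\<lambda>x. Ht t (f x))" if "continuous_on S f" for S :: "real set" and f
    unfolding Ht_def using that by (intro continuous_intros)
  have Uf: "finite (U n)" "U n \<subseteq> {a<..<b}" "l < n \<Longrightarrow> q l \<in> U n" for n l
    using q midpoints_in[OF ab, of n] by (auto simp: U_def midpoints_def dense_seq_def)
  have lw: "lattice_weights (U n) (\<Psi> n) (\<kappa> n)" for n
  proof -
    have 1: "\<Psi> n u \<in> borel_measurable borel" for u
      unfolding \<Psi>_def Ht_def by measurable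
    have 2: "\<Psi> n u s \<le> \<Psi> n u r" if "r \<le> s" for u r s
      using mult_left_mono[OF Ht_mono[OF that] c0[of n u]] by (simp add: \<Psi>_def)
    have 3: "\<Psi> n u (x' - x) * \<Psi> n u (y' - y) \<le> \<Psi> n u (max x' y' - max x y) * \<Psi> n u (min x' y' - min x y)" for u x x' y y'
      using mult_left_mono[OF Ht_submodular[OF t, of x' y' x y] c0[of n u]]
      by (simp add: \<Psi>_def exp_add[symmetric] distrib_left)
    have 4: "\<Psi> n u (v - y) \<le> \<Psi> n u (v - max x y)" for u v x y by (rule 2) simp
    have 5: "0 \<le> \<Psi> n u r \<and> \<Psi> n u r \<le> 1" for u r using c0 Ht0 by (simp add: \<Psi>_def)
    have 6: "\<kappa> n u \<in> borel_measurable borel" for u by (simp add: \<kappa>_def[abs_def])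
    show ?thesis unfolding lattice_weights_def using 1 2 3 4 5 6 by (simp add: \<kappa>_def)
  qed
  have lim: "(\<lambda>n. gibbs_weight k (U n) (\<Psi> n) (\<kappa> n) (\<lambda>l. ?B l \<omega>)) \<longlonglongrightarrow> wt \<omega>" if \<omega>: "\<omega> \<in> space M" for \<omega>
  proof -
    define h where "h i u = Ht t (?B (Suc i) \<omega> u - ?B i \<omega> u)" for i u
    have hc: "continuous_on {a..b} (h i)" if "i \<in> {1..<k}" for i
      unfolding h_def using that by (intro Htc continuous_on_diff BBpath_Cab(1)[OF br ab _ \<omega>]) auto
    have gw: "gibbs_weight k (U n) (\<Psi> n) (\<kappa> n) (\<lambda>l. ?B l \<omega>)
      = exp (- (\<Sum>i\<in>{1..<k}. \<Sum>u\<in>midpoints a b n. (b - a) / real n * h i u))" for n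
    proof -
      have "gibbs_weight k (U n) (\<Psi> n) (\<kappa> n) (\<lambda>l. ?B l \<omega>) = (\<Prod>u\<in>U n. \<Prod>i\<in>{1..<k}. exp (- (c n u * h i u)))"
        by (simp add: gibbs_weight_def \<kappa>_def \<Psi>_def h_def)
      also have "\<dots> = exp (\<Sum>u\<in>U n. \<Sum>i\<in>{1..<k}. - (c n u * h i u))"
        using Uf(1) by (simp add: exp_sum)
      also have "(\<Sum>u\<in>U n. \<Sum>i\<in>{1..<k}. - (c n u * h i u)) = - (\<Sum>i\<in>{1..<k}. \<Sum>u\<in>U n. c n u * h i u)"
        by (subst sum.swap) (simp add: sum_negf)
      also have "(\<Sum>i\<in>{1..<k}. \<Sum>u\<in>U n. c n u * h i u) = (\<Sum>i\<in>{1..<k}. \<Sum>u\<in>midpoints a b n. (b - a) / real n * h i u)"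
      proof (rule sum.cong[OF refl], rule sum.mono_neutral_cong_right)
        show "finite (U n)" by (rule Uf)
      qed (auto simp: U_def c_def)
      finally show ?thesis .
    qed
    have "(\<lambda>n. exp (- (\<Sum>i\<in>{1..<k}. \<Sum>u\<in>midpoints a b n. (b - a) / real n * h i u)))
      \<longlonglongrightarrow> exp (- (\<Sum>i\<in>{1..<k}. integral {a..b} (h i)))"
      by (intro tendsto_intros midpoint_sums_tendsto ab hc)
    then show ?thesis unfolding gw wt_def weight_t_def using \<omega> by (simp add: h_def[abs_def])
  qed
  have wtm: "wt \<in> borel_measurable M"
  proof (rule borel_measurable_LIMSEQ_metric[OF _ lim])
    show "(\<lambda>\<omega>. gibbs_weight k (U n) (\<Psi> n) (\<kappa> n) (\<lambda>l. ?B l \<omega>)) \<in> borel_measurable M" for n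
      using k Uf(2)[of n] by (intro gibbs_weight_measurable[OF lw] BB_measurable[OF br]) (auto intro: less_imp_le)
  qed
  have wt01: "0 \<le> wt \<omega> \<and> wt \<omega> \<le> 1" for \<omega>
  proof (cases "\<omega> \<in> space M")
    case True
    then show ?thesis
      using LIMSEQ_le_const[OF lim[OF True], of 0] LIMSEQ_le_const2[OF lim[OF True], of 1] gibbs_weight_bounds[OF lw] by blast
  qed (simp add: wt_def)
  have ae: "AE \<omega> in M. (\<lambda>n. gibbs_weight k (U n) (\<Psi> n) (\<kappa> n) (\<lambda>l. ?B l \<omega>)) \<longlonglongrightarrow> wt \<omega>"
    using lim by (intro AE_I2)
  define N where "N S = (\<integral>\<omega>. indicator S \<omega> * wt \<omega> \<partial>M)" for S
  define Z where "Z = (\<integral>\<omega>. wt \<omega> \<partial>M)"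
  have ineq: "N {\<omega>\<in>space M. B 2 \<omega> \<in> A \<and> B 1 \<omega> \<in> E} * Z \<le> N {\<omega>\<in>space M. B 1 \<omega> \<in> E} * N {\<omega>\<in>space M. B 1 \<omega> \<in> A}"
    unfolding N_def Z_def B_def
    by (rule limit_inequality[OF assms(1) br ab k w z A E inc q Uf lw wtm wt01 ae])
  have Pe: "P S = N S / Z" for S
    unfolding P_def prob_t_def N_def Z_def
    by (intro arg_cong2[of _ _ _ _ divide] Bochner_Integration.integral_cong) (auto simp: wt_def)
  have "0 \<le> Z" unfolding Z_def using wt01 by simp
  \<comment> \<open>If the normalization were \<open>0\<close>, the quotient defining
    \<open>P\<close> would be \<open>0\<close> as well, contrary to \<open>pos\<close>.\<close>
  then have Z: "0 < Z" using pos Pe[of "{\<omega>\<in>space M. B 1 \<omega> \<in> E}"] by (cases "Z = 0") auto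
  then have "0 < N {\<omega>\<in>space M. B 1 \<omega> \<in> E}" using pos unfolding Pe by (simp add: zero_less_divide_iff)
  then show ?thesis using ineq Z unfolding Pe by (simp add: field_simps)
qed

section \<open>Touching has probability zero\<close>

text \<open>The identity of characteristic functions says that \<open>Z\<close> is standard normal
  and independent of the family \<open>D\<close>. Given \<open>D\<close>, the bad event places
  \<open>Z\<close> within \<open>e\<close> above the supremum of \<open>D\<close>, for every
  \<open>e\<close>; as the normal density is at most \<open>1\<close>, this has probability at most
  \<open>e\<close>.\<close>

lemma gaussian_barrier_null:
  fixes Z :: "'s \<Rightarrow> real" and D :: "nat \<Rightarrow> 's \<Rightarrow> real"
  assumes "prob_space M" and Zm: "Z \<in> borel_measurable M" and Dm: "\<And>l. l \<in> S \<Longrightarrow> D l \<in> borel_measurable M"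
    and char: "\<And>F t \<theta>. finite F \<Longrightarrow> F \<subseteq> S \<Longrightarrow> (\<integral>\<omega>. cis (t * Z \<omega> + (\<Sum>l\<in>F. \<theta> l * D l \<omega>)) \<partial>M)
      = complex_of_real (exp (- t\<^sup>2 / 2)) * (\<integral>\<omega>. cis (\<Sum>l\<in>F. \<theta> l * D l \<omega>) \<partial>M)"
  shows "AE \<omega> in M. \<not> ((\<forall>l\<in>S. D l \<omega> \<le> Z \<omega>) \<and> (\<forall>e>0. \<exists>l\<in>S. Z \<omega> < D l \<omega> + e))"
proof -
  interpret prob_space M by fact
  let ?N = "std_normal_distribution"
  interpret N: real_distribution ?N by (rule real_dist_normal_dist)
  interpret P: pair_prob_space M ?N by (simp add: pair_prob_space_def pair_sigma_finite_def prob_space_axioms N.prob_space_axioms N.sigma_finite_measure_axioms sigma_finite_measure_axioms)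
  have [measurable]: "cis \<in> borel_measurable borel"
    by (intro borel_measurable_continuous_onI continuous_intros)
  note [measurable] = Zm Dm
  \<comment> \<open>Truncation to finitely many indices: there the joint law is determined by
    characteristic functions, and the supremum is a maximum.\<close>
  define S' where "S' n = {l\<in>S. l < n}" for n
  define T where "T n e = {\<omega>\<in>space M. (\<forall>l\<in>S' n. D l \<omega> \<le> Z \<omega>) \<and> (\<exists>l\<in>S' n. Z \<omega> < D l \<omega> + e)}" for n and e :: real
  have S': "finite (S' n)" "S' n \<subseteq> S" for n by (auto simp: S'_def)
  have Tm: "T n e \<in> sets M" for n e
  proof -
    have [measurable]: "D l \<in> borel_measurable M" if "l \<in> S' n" for l using that S' Dm by blast
    show ?thesis unfolding T_def using S'(1)[of n] by measurable
  qed
  have T_le: "measure M (T n e) \<le> e" if e: "0 < e" for n e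
  proof (cases "S' n = {}")
    case True
    then show ?thesis using e by (simp add: T_def)
  next
    case False
    define F where "F = S' n"
    have F: "finite F" "F \<subseteq> S" "F \<noteq> {}" using S'[of n] False by (auto simp: F_def)
    define I where "I = insert None (Some ` F)"
    let ?PI = "PiM I (\<lambda>_. borel :: real measure)"
    \<comment> \<open>\<open>None\<close> indexes \<open>Z\<close> and \<open>Some l\<close> indexes
      \<open>D l\<close>. In the second family an independent normal coordinate of a product space
      takes the place of \<open>Z\<close>.\<close>
    define X1 where "X1 i \<omega> = (case i of None \<Rightarrow> Z \<omega> | Some l \<Rightarrow> D l \<omega>)" for i \<omega>
    define X2 where "X2 i p = (case i of None \<Rightarrow> snd p | Some l \<Rightarrow> D l (fst p))" for i and p :: "'s \<times> real"
    have fI: "finite I" using F by (simp add: I_def)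
    have sI: "(\<Sum>i\<in>I. \<theta> i * Y i) = \<theta> None * Y None + (\<Sum>l\<in>F. \<theta> (Some l) * Y (Some l))" for \<theta> Y :: "nat option \<Rightarrow> real"
      unfolding I_def using F by (subst sum.insert) (auto simp: sum.reindex)
    have m1: "X1 i \<in> borel_measurable M" if "i \<in> I" for i
      using that F(2) Dm unfolding X1_def I_def by (cases i) auto
    have m2: "X2 i \<in> borel_measurable (M \<Otimes>\<^sub>M ?N)" if "i \<in> I" for i
    proof (cases i)
      case None
      have "snd \<in> borel_measurable (M \<Otimes>\<^sub>M ?N)"
        using measurable_snd[of M ?N] unfolding measurable_cong_sets[OF refl N.events_eq_borel] .
      then show ?thesis using None by (simp add: X2_def[abs_def])
    next
      case (Some l)
      then have "D l \<in> borel_measurable M" using that F(2) Dm by (auto simp: I_def)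
      from measurable_compose[OF measurable_fst this] show ?thesis using Some by (simp add: X2_def[abs_def])
    qed
    have eq: "(\<integral>\<omega>. cis (\<Sum>i\<in>I. \<theta> i * X1 i \<omega>) \<partial>M) = (\<integral>p. cis (\<Sum>i\<in>I. \<theta> i * X2 i p) \<partial>(M \<Otimes>\<^sub>M ?N))" for \<theta>
    proof -
      let ?s = "\<lambda>\<omega>. \<Sum>l\<in>F. \<theta> (Some l) * D l \<omega>"
      have [measurable]: "?s \<in> borel_measurable M" using F(2) Dm by (intro borel_measurable_sum borel_measurable_times) auto
      have "(\<integral>p. cis (\<Sum>i\<in>I. \<theta> i * X2 i p) \<partial>(M \<Otimes>\<^sub>M ?N)) = (\<integral>p. (case p of (\<omega>, x) \<Rightarrow> cis (?s \<omega>) * cis (\<theta> None * x)) \<partial>(M \<Otimes>\<^sub>M ?N))"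
        unfolding sI by (intro Bochner_Integration.integral_cong refl) (auto simp: X2_def cis_mult add.commute)
      also have "\<dots> = (\<integral>\<omega>. (\<integral>x. cis (?s \<omega>) * cis (\<theta> None * x) \<partial>?N) \<partial>M)"
      proof (rule P.integral_fst[symmetric])
        show "integrable (M \<Otimes>\<^sub>M ?N) (\<lambda>(\<omega>, x). cis (?s \<omega>) * cis (\<theta> None * x))"
          by (intro P.P.integrable_const_bound[where B=1]) (auto simp: norm_mult)
      qed
      also have "\<dots> = (\<integral>\<omega>. cis (?s \<omega>) \<partial>M) * (\<integral>x. cis (\<theta> None * x) \<partial>?N)"
        by simp
      also have "(\<integral>x. cis (\<theta> None * x) \<partial>?N) = char ?N (\<theta> None)"
        by (simp add: char_def cis_conv_exp)
      finally show ?thesis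
        unfolding sI using char[OF F(1,2), of "\<theta> None" "\<lambda>l. \<theta> (Some l)"]
        by (simp add: X1_def char_std_normal_distribution mult.commute)
    qed
    define G where "G = {x \<in> space ?PI. (\<forall>l\<in>F. x (Some l) \<le> x None) \<and> (\<exists>l\<in>F. x None < x (Some l) + e)}"
    have Gm: "G \<in> sets ?PI"
    proof -
      have cS: "(\<lambda>x. x (Some l)) \<in> borel_measurable ?PI" if "l \<in> F" for l
        using that by (intro measurable_component_singleton) (auto simp: I_def)
      have cN: "(\<lambda>x. x None) \<in> borel_measurable ?PI"
        by (intro measurable_component_singleton) (auto simp: I_def)
      show ?thesis unfolding G_def
        by (intro sets.sets_Collect_conj sets.sets_Collect_finite_All sets.sets_Collect_finite_Ex F(1)
            borel_measurable_le borel_measurable_less borel_measurable_add borel_measurable_const cS cN)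
    qed
    have M1: "(\<lambda>\<omega>. \<lambda>i\<in>I. X1 i \<omega>) \<in> measurable M ?PI"
      and M2: "(\<lambda>p. \<lambda>i\<in>I. X2 i p) \<in> measurable (M \<Otimes>\<^sub>M ?N) ?PI"
      using m1 m2 by (auto intro!: measurable_restrict)
    let ?G2 = "(\<lambda>p. \<lambda>i\<in>I. X2 i p) -` G \<inter> space (M \<Otimes>\<^sub>M ?N)"
    have "T n e = (\<lambda>\<omega>. \<lambda>i\<in>I. X1 i \<omega>) -` G \<inter> space M"
      using measurable_space[OF M1] by (auto simp: T_def G_def F_def[symmetric] I_def X1_def)
    then have "emeasure M (T n e) = emeasure (distr M ?PI (\<lambda>\<omega>. \<lambda>i\<in>I. X1 i \<omega>)) G"
      by (simp add: emeasure_distr[OF M1 Gm])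
    also have "\<dots> = emeasure (distr (M \<Otimes>\<^sub>M ?N) ?PI (\<lambda>p. \<lambda>i\<in>I. X2 i p)) G"
      using distr_PiM_eq_of_joint_char_eq[OF assms(1) P.P.prob_space_axioms fI m1 m2 eq] by simp
    also have "\<dots> = emeasure (M \<Otimes>\<^sub>M ?N) ?G2"
      by (rule emeasure_distr[OF M2 Gm])
    also have "\<dots> = (\<integral>\<^sup>+\<omega>. emeasure ?N (Pair \<omega> -` ?G2) \<partial>M)"
      using measurable_sets[OF M2 Gm] by (rule N.emeasure_pair_measure_alt)
    also have "\<dots> \<le> (\<integral>\<^sup>+\<omega>. ennreal e \<partial>M)"
    proof (rule nn_integral_mono)
      fix \<omega> assume \<omega>: "\<omega> \<in> space M"
      define c where "c = Max ((\<lambda>l. D l \<omega>) ` F)"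
      have c: "D l \<omega> \<le> c" if "l \<in> F" for l unfolding c_def using F that by auto
      have c': "c \<le> x" if "\<forall>l\<in>F. D l \<omega> \<le> x" for x unfolding c_def using F that by auto
      have "Pair \<omega> -` ?G2 \<subseteq> {c..c + e}"
      proof
        fix x assume "x \<in> Pair \<omega> -` ?G2"
        then have "(\<forall>l\<in>F. D l \<omega> \<le> x)" "\<exists>l\<in>F. x < D l \<omega> + e" by (auto simp: G_def I_def X2_def)
        then show "x \<in> {c..c + e}" using c c'[of x] by force
      qed
      then have "emeasure ?N (Pair \<omega> -` ?G2) \<le> emeasure ?N {c..c + e}"
        by (rule emeasure_mono) simp
      also have "\<dots> = (\<integral>\<^sup>+x. ennreal (std_normal_density x) * indicator {c..c + e} x \<partial>lborel)"
        by (rule emeasure_density) auto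
      also have "\<dots> \<le> (\<integral>\<^sup>+x. indicator {c..c + e} x \<partial>lborel)"
      proof (rule nn_integral_mono)
        fix x :: real
        have "std_normal_density x \<le> 1"
        proof -
          have "1 \<le> sqrt (2 * pi)" using pi_ge_two by simp
          moreover have "exp (- x\<^sup>2 / 2) \<le> 1" by simp
          ultimately have "exp (- x\<^sup>2 / 2) \<le> sqrt (2 * pi)" by (rule order_trans[rotated])
          then show ?thesis by (simp add: std_normal_density_def divide_le_eq)
        qed
        then show "ennreal (std_normal_density x) * indicator {c..c + e} x \<le> indicator {c..c + e} x"
          by (auto split: split_indicator)
      qed
      also have "\<dots> = ennreal e" using e by simp
      finally show "emeasure ?N (Pair \<omega> -` ?G2) \<le> ennreal e" .
    qed
    also have "\<dots> = ennreal e" by (simp add: emeasure_space_1)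
    finally show ?thesis using e by (simp add: emeasure_eq_measure)
  qed
  define R where "R e = {\<omega>\<in>space M. (\<forall>l\<in>S. D l \<omega> \<le> Z \<omega>) \<and> (\<exists>l\<in>S. Z \<omega> < D l \<omega> + e)}" for e :: real
  \<comment> \<open>Only the witness of near touching is restricted to \<open>S' n\<close>. These
    events increase with \<open>n\<close>, and each lies inside the finite event
    \<open>T n e\<close>.\<close>
  define Rn where "Rn e n = {\<omega>\<in>space M. (\<forall>l\<in>S. D l \<omega> \<le> Z \<omega>) \<and> (\<exists>l\<in>S' n. Z \<omega> < D l \<omega> + e)}" for e :: real and n
  have Am: "{\<omega>\<in>space M. \<forall>l\<in>S. D l \<omega> \<le> Z \<omega>} \<in> sets M"
    by (intro sets.sets_Collect_countable_All' borel_measurable_le Dm Zm) auto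
  have Rnm: "Rn e n \<in> sets M" for e n
  proof -
    have "{\<omega>\<in>space M. \<exists>l\<in>S' n. Z \<omega> < D l \<omega> + e} \<in> sets M"
      by (intro sets.sets_Collect_finite_Ex S'(1) borel_measurable_less borel_measurable_add borel_measurable_const Zm Dm)
        (use S'(2) in auto)
    then have "{\<omega>\<in>space M. \<forall>l\<in>S. D l \<omega> \<le> Z \<omega>} \<inter> {\<omega>\<in>space M. \<exists>l\<in>S' n. Z \<omega> < D l \<omega> + e} \<in> sets M"
      using Am by (rule sets.Int[rotated])
    also have "{\<omega>\<in>space M. \<forall>l\<in>S. D l \<omega> \<le> Z \<omega>} \<inter> {\<omega>\<in>space M. \<exists>l\<in>S' n. Z \<omega> < D l \<omega> + e} = Rn e n"
      by (auto simp: Rn_def)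
    finally show ?thesis .
  qed
  have RU: "R e = (\<Union>n. Rn e n)" for e
    by (auto simp: R_def Rn_def S'_def)
  have R_le: "measure M (R e) \<le> e" if "0 < e" for e
  proof -
    have "(\<lambda>n. measure M (Rn e n)) \<longlonglongrightarrow> measure M (\<Union>n. Rn e n)"
      using Rnm by (intro finite_Lim_measure_incseq) (auto simp: incseq_def Rn_def S'_def)
    moreover have "measure M (Rn e n) \<le> e" for n
    proof -
      have "Rn e n \<subseteq> T n e" by (auto simp: Rn_def T_def S'_def)
      then have "measure M (Rn e n) \<le> measure M (T n e)" using Tm by (rule finite_measure_mono)
      then show ?thesis using T_le[OF that, of n] by simp
    qed
    ultimately show ?thesis unfolding RU by (intro LIMSEQ_le_const2) auto
  qed
  define Q where "Q = (\<Inter>n. R (1 / real (Suc n)))"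
  have Rm: "R e \<in> sets M" for e unfolding RU using Rnm by auto
  have Qm: "Q \<in> sets M" unfolding Q_def using Rm by auto
  have "measure M Q \<le> e" if e: "0 < e" for e
  proof -
    obtain n where n: "1 / real (Suc n) < e" using nat_approx_posE[OF e] by blast
    have "measure M Q \<le> measure M (R (1 / real (Suc n)))" using Rm by (intro finite_measure_mono) (auto simp: Q_def)
    also have "\<dots> \<le> 1 / real (Suc n)" by (rule R_le) simp
    finally show ?thesis using n by simp
  qed
  then have "measure M Q \<le> 0" by (rule field_le_epsilon[of _ 0, simplified])
  then have "emeasure M Q = 0" by (simp add: emeasure_eq_measure measure_le_0_iff)
  then show ?thesis
  proof (intro AE_I[where N=Q] Qm)
    show "{\<omega> \<in> space M. \<not> \<not> ((\<forall>l\<in>S. D l \<omega> \<le> Z \<omega>) \<and> (\<forall>e>0. \<exists>l\<in>S. Z \<omega> < D l \<omega> + e))} \<subseteq> Q"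
      by (auto simp: Q_def R_def)
  qed
qed

text \<open>The value \<open>Z\<close> of line \<open>i\<close> at the midpoint is independent of \<open>D\<close>, and given \<open>D\<close>
  the line touches the barrier only if \<open>Z\<close> is exactly \<open>sup D\<close>.\<close>

lemma no_touching:
  fixes p cc :: "nat \<Rightarrow> real" and \<alpha> :: real
  assumes "prob_space M" and br: "indep_std_bridges M k a b W" and ab: "a < b"
    and ij: "i \<in> {1..k}" "j \<in> {1..k}" "i \<noteq> j" and p: "\<And>l. l \<in> S \<Longrightarrow> p l \<in> {a<..<b}"
  defines "m \<equiv> (a + b) / 2"
  defines "gap \<equiv> \<lambda>l \<omega>. cc l + sqrt 2 * W i \<omega> (p l) - \<alpha> * W j \<omega> (p l)"
  shows "AE \<omega> in M. \<not> ((\<forall>l\<in>S. 0 \<le> gap l \<omega>) \<and> (\<forall>e>0. \<exists>l\<in>S. gap l \<omega> < e * bb_cov a b m (p l)))"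
proof -
  interpret prob_space M by fact
  define v where "v = bb_cov a b m m"
  define cv where "cv l = bb_cov a b m (p l)" for l
  have mab: "m \<in> {a<..<b}" using ab by (simp add: m_def)
  have vpos: "0 < v" using mab unfolding v_def bb_cov_def by simp
  have cvpos: "0 < cv l" if "l \<in> S" for l
    using mab p[OF that] ab unfolding cv_def bb_cov_def by (auto simp: min_def max_def)
  have sym: "bb_cov a b x y = bb_cov a b y x" for x y by (simp add: bb_cov_def min.commute max.commute)
  \<comment> \<open>The factor \<open>s l\<close> below makes the covariance of \<open>Z\<close>
    with \<open>s l * gap l\<close> equal to \<open>1\<close>, so \<open>D l\<close> is uncorrelated
    with \<open>Z\<close>. For fixed \<open>D\<close>, raising \<open>Z\<close> moves the gap in
    proportion to \<open>cv l\<close>; this is why closeness is measured against a multiple of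
    \<open>bb_cov a b m (p l)\<close>.\<close>
  define Z where "Z \<omega> = W i \<omega> m / sqrt v" for \<omega>
  define s where "s l = sqrt v / (sqrt 2 * cv l)" for l
  define D where "D l \<omega> = Z \<omega> - s l * gap l \<omega>" for l \<omega>
  have pI: "p l \<in> {a..b}" if "l \<in> S" for l using p[OF that] by auto
  have mI: "m \<in> {a..b}" using mab by auto
  note Wm = W_measurable[OF br]
  have Zm: "Z \<in> borel_measurable M" unfolding Z_def using Wm[OF ij(1) mI] by measurable
  have Dm: "D l \<in> borel_measurable M" if "l \<in> S" for l
    unfolding D_def gap_def using Zm Wm[OF ij(1) pI[OF that]] Wm[OF ij(2) pI[OF that]] by measurable
  have char: "(\<integral>\<omega>. cis (t * Z \<omega> + (\<Sum>l\<in>F. \<theta> l * D l \<omega>)) \<partial>M)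
      = complex_of_real (exp (- t\<^sup>2 / 2)) * (\<integral>\<omega>. cis (\<Sum>l\<in>F. \<theta> l * D l \<omega>) \<partial>M)"
    if F: "finite F" "F \<subseteq> S" for F t \<theta>
  proof -
    define \<Theta> where "\<Theta> = (\<Sum>l\<in>F. \<theta> l)"
    define C where "C = (\<Sum>l\<in>F. \<theta> l * s l * cc l)"
    \<comment> \<open>\<open>None\<close> stands for line \<open>i\<close> at the midpoint;
      \<open>Some (l, True)\<close> and \<open>Some (l, False)\<close> stand for lines
      \<open>i\<close> and \<open>j\<close> at time \<open>p l\<close>.\<close>
    define I where "I = insert None (Some ` (F \<times> (UNIV :: bool set)))"
    define J where "J x = (case x of None \<Rightarrow> i | Some (l, e) \<Rightarrow> if e then i else j)" for x :: "(nat \<times> bool) option"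
    define U where "U x = (case x of None \<Rightarrow> m | Some (l, e) \<Rightarrow> p l)" for x :: "(nat \<times> bool) option"
    define co where "co x = (case x of None \<Rightarrow> 0 | Some (l, e) \<Rightarrow> if e then - \<theta> l * s l * sqrt 2 else \<theta> l * s l * \<alpha>)" for x :: "(nat \<times> bool) option"
    define c where "c t x = (case x of None \<Rightarrow> (t + \<Theta>) / sqrt v | Some _ \<Rightarrow> co x)" for t :: real and x :: "(nat \<times> bool) option"
    have fI: "finite I" using F by (simp add: I_def)
    have sI: "(\<Sum>x\<in>I. f x) = f None + (\<Sum>y\<in>F \<times> UNIV. f (Some y))" for f :: "(nat \<times> bool) option \<Rightarrow> real"
      unfolding I_def using F by (subst sum.insert) (auto simp: sum.reindex)
    have lin: "t * Z \<omega> + (\<Sum>l\<in>F. \<theta> l * D l \<omega>) = (\<Sum>x\<in>I. c t x * W (J x) \<omega> (U x)) - C" for t \<omega>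
    proof -
      have "(\<Sum>y\<in>F \<times> UNIV. c t (Some y) * W (J (Some y)) \<omega> (U (Some y)))
        = (\<Sum>l\<in>F. \<theta> l * s l * \<alpha> * W j \<omega> (p l) - \<theta> l * s l * sqrt 2 * W i \<omega> (p l))"
        by (subst sum.cartesian_product') (simp add: UNIV_bool c_def co_def J_def U_def)
      moreover have "(\<Sum>l\<in>F. \<theta> l * D l \<omega>) = \<Theta> * Z \<omega> - C + (\<Sum>l\<in>F. \<theta> l * s l * \<alpha> * W j \<omega> (p l) - \<theta> l * s l * sqrt 2 * W i \<omega> (p l))"
        unfolding \<Theta>_def C_def sum_distrib_right sum_subtractf[symmetric] sum.distrib[symmetric] D_def gap_def
        by (intro sum.cong refl) (simp add: algebra_simps)
      ultimately show ?thesis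
        unfolding sI by (simp add: c_def J_def U_def Z_def add_divide_distrib distrib_right)
    qed
    define K where "K x y = (if J x = J y then bb_cov a b (U x) (U y) else 0)" for x y
    define R where "R = (\<Sum>x\<in>F \<times> UNIV. \<Sum>y\<in>F \<times> UNIV. co (Some x) * co (Some y) * K (Some x) (Some y))"
    have K0: "K x y = K y x" for x y by (simp add: K_def sym)
    have cross: "(\<Sum>y\<in>F \<times> UNIV. co (Some y) * K None (Some y)) = - \<Theta> * sqrt v"
    proof -
      have "(\<Sum>y\<in>F \<times> UNIV. co (Some y) * K None (Some y)) = (\<Sum>l\<in>F. - \<theta> l * s l * sqrt 2 * cv l)"
        using ij(3) by (subst sum.cartesian_product') (simp add: UNIV_bool co_def K_def J_def U_def cv_def)
      also have "\<dots> = (\<Sum>l\<in>F. - \<theta> l * sqrt v)"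
      proof (intro sum.cong refl)
        fix l assume "l \<in> F"
        then have "0 < cv l" using F cvpos by blast
        then show "- \<theta> l * s l * sqrt 2 * cv l = - \<theta> l * sqrt v" by (simp add: s_def)
      qed
      finally show ?thesis by (simp add: \<Theta>_def sum_distrib_right sum_negf)
    qed
    \<comment> \<open>The form is the square of \<open>t + \<Theta>\<close>, minus twice
      \<open>(t + \<Theta>) * \<Theta>\<close>, plus \<open>R\<close>. The mixed term in
      \<open>t\<close> and \<open>\<Theta>\<close> cancels, which is the independence of
      \<open>Z\<close> and \<open>D\<close>.\<close>
    have quad: "(\<Sum>x\<in>I. \<Sum>y\<in>I. c t x * c t y * K x y) = t\<^sup>2 - \<Theta>\<^sup>2 + R" for t
    proof -
      let ?d = "(t + \<Theta>) / sqrt v"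
      have cs: "c t (Some y) = co (Some y)" "c t None = ?d" for y by (simp_all add: c_def)
      have "(\<Sum>x\<in>I. \<Sum>y\<in>I. c t x * c t y * K x y)
        = (?d * ?d * K None None + (\<Sum>y\<in>F \<times> UNIV. ?d * co (Some y) * K None (Some y)))
          + ((\<Sum>x\<in>F \<times> UNIV. co (Some x) * ?d * K (Some x) None) + R)"
        unfolding sI cs sum.distrib R_def by (simp only: add_ac)
      also have "(\<Sum>x\<in>F \<times> UNIV. co (Some x) * ?d * K (Some x) None) = ?d * (\<Sum>y\<in>F \<times> UNIV. co (Some y) * K None (Some y))"
        unfolding sum_distrib_left K0[of "Some _" None] by (intro sum.cong refl) (simp only: mult_ac)
      also have "(\<Sum>y\<in>F \<times> UNIV. ?d * co (Some y) * K None (Some y)) = ?d * (\<Sum>y\<in>F \<times> UNIV. co (Some y) * K None (Some y))"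
        unfolding sum_distrib_left by (intro sum.cong refl) (simp only: mult_ac)
      also have "K None None = v" by (simp add: K_def U_def v_def)
      also have "?d * ?d * v = (t + \<Theta>)\<^sup>2" using vpos by (simp add: power2_eq_square)
      also have "?d * (\<Sum>y\<in>F \<times> UNIV. co (Some y) * K None (Some y)) = - (t + \<Theta>) * \<Theta>"
        unfolding cross using vpos by (simp add: field_simps)
      finally show ?thesis by (simp add: power2_eq_square algebra_simps)
    qed
    have JU: "J x \<in> {1..k}" "U x \<in> {a..b}" if "x \<in> I" for x
      using that ij mI pI F(2) by (auto simp: I_def J_def U_def split: option.splits)
    have E: "(\<integral>\<omega>. cis (t * Z \<omega> + (\<Sum>l\<in>F. \<theta> l * D l \<omega>)) \<partial>M) = cis (- C) * complex_of_real (exp (- (1 / 2) * (t\<^sup>2 - \<Theta>\<^sup>2 + R)))" for t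
    proof -
      have "(\<integral>\<omega>. cis (t * Z \<omega> + (\<Sum>l\<in>F. \<theta> l * D l \<omega>)) \<partial>M) = (\<integral>\<omega>. cis (- C) * cis (\<Sum>x\<in>I. c t x * W (J x) \<omega> (U x)) \<partial>M)"
        unfolding lin by (simp add: cis_mult add.commute)
      also have "\<dots> = cis (- C) * (\<integral>\<omega>. cis (\<Sum>x\<in>I. c t x * W (J x) \<omega> (U x)) \<partial>M)" by simp
      also have "(\<integral>\<omega>. cis (\<Sum>x\<in>I. c t x * W (J x) \<omega> (U x)) \<partial>M) = complex_of_real (exp (- (1 / 2) * (t\<^sup>2 - \<Theta>\<^sup>2 + R)))"
        using bridge_char_finite[OF br fI, of J U "c t"] JU unfolding K_def[symmetric] quad by simp
      finally show ?thesis .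
    qed
    have "exp (- (1 / 2) * (t\<^sup>2 - \<Theta>\<^sup>2 + R)) = exp (- t\<^sup>2 / 2) * exp (- (1 / 2) * (0\<^sup>2 - \<Theta>\<^sup>2 + R))"
      unfolding exp_add[symmetric] by (simp add: algebra_simps)
    then show ?thesis using E[of t] E[of 0] by (simp add: mult_ac)
  qed
  have "AE \<omega> in M. \<not> ((\<forall>l\<in>S. D l \<omega> \<le> Z \<omega>) \<and> (\<forall>e>0. \<exists>l\<in>S. Z \<omega> < D l \<omega> + e))"
    by (rule gaussian_barrier_null[OF assms(1) Zm Dm char])
  then show ?thesis
  proof (rule AE_mp, intro AE_I2 impI notI, elim notE conjE)
    fix \<omega> assume 1: "\<forall>l\<in>S. 0 \<le> gap l \<omega>" and 2: "\<forall>e>0. \<exists>l\<in>S. gap l \<omega> < e * bb_cov a b m (p l)"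
    have spos: "0 < s l" if "l \<in> S" for l using cvpos[OF that] vpos by (simp add: s_def)
    show "(\<forall>l\<in>S. D l \<omega> \<le> Z \<omega>) \<and> (\<forall>e>0. \<exists>l\<in>S. Z \<omega> < D l \<omega> + e)"
    proof (intro conjI ballI allI impI)
      fix l assume "l \<in> S"
      then show "D l \<omega> \<le> Z \<omega>" using 1 spos[of l] by (simp add: D_def less_imp_le)
    next
      fix e :: real assume "0 < e"
      then have "0 < e * sqrt 2 / sqrt v" using vpos by simp
      then obtain l where l: "l \<in> S" "gap l \<omega> < e * sqrt 2 / sqrt v * cv l" using 2 unfolding cv_def by blast
      have "s l * gap l \<omega> < s l * (e * sqrt 2 / sqrt v * cv l)" using l spos by (intro mult_strict_left_mono) auto
      also have "\<dots> = e" using cvpos[OF l(1)] vpos by (simp add: s_def)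
      finally show "\<exists>l\<in>S. Z \<omega> < D l \<omega> + e" using l(1) by (intro bexI[of _ l]) (simp_all add: D_def)
    qed
  qed
qed

section \<open>Zero temperature\<close>

lemma prod_if_one_zero:
  assumes "finite A"
  shows "(\<Prod>x\<in>A. if P x then 1 else 0) = (if \<forall>x\<in>A. P x then 1 else (0 :: real))"
  using assms by (induction rule: finite_induct) auto

text \<open>The graph of any real function is a separable subset of the plane. So, even without
  continuity, countably many times approximate each time together with its barrier value.\<close>

lemma ex_graph_dense_seq:
  fixes g :: "real \<Rightarrow> real"
  assumes ab: "a < b" and V: "V \<subseteq> {a<..<b}"
  shows "\<exists>q. dense_seq a b q \<and> (\<forall>u\<in>V. \<forall>e>0. \<exists>l. q l \<in> V \<and> \<bar>q l - u\<bar> < e \<and> \<bar>g (q l) - g u\<bar> < e)"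
proof -
  define G where "G = (\<lambda>u. (u, g u)) ` V"
  obtain T where T: "countable T" "T \<subseteq> G" "G \<subseteq> closure T"
    using separable[of G] by metis
  have "countable (fst ` T)" "fst ` T \<subseteq> {a<..<b}" using T V by (auto simp: G_def)
  from ex_dense_seq[OF ab this] obtain q where q: "dense_seq a b q" "fst ` T \<subseteq> range q" by blast
  have "\<exists>l. q l \<in> V \<and> \<bar>q l - u\<bar> < e \<and> \<bar>g (q l) - g u\<bar> < e" if u: "u \<in> V" and e: "0 < e" for u e
  proof -
    have "(u, g u) \<in> closure T" using T(3) u by (auto simp: G_def)
    then obtain t where t: "t \<in> T" "dist t (u, g u) < e" using e unfolding closure_approachable by blast
    then obtain v where v: "v \<in> V" "t = (v, g v)" using T(2) by (auto simp: G_def)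
    have "v \<in> range q" using q(2) t(1) v(2) by (metis fst_conv image_subset_iff)
    then obtain l where l: "q l = v" by blast
    have "dist v u < e" "dist (g v) (g u) < e"
      using dist_fst_le[of t "(u, g u)"] dist_snd_le[of t "(u, g u)"] t(2) v(2) by auto
    then show ?thesis using l v(1) by (intro exI[of _ l]) (simp add: dist_real_def)
  qed
  then show ?thesis using q(1) by blast
qed

lemma zero_temperature:
  fixes M :: "'s measure" and g :: "real \<Rightarrow> ereal"
  assumes "prob_space M" and br: "indep_std_bridges M k a b W" and k: "k \<ge> 2" and ab: "a < b"
    and w: "\<forall>i\<in>{1..<k}. w (Suc i) < w i" and z: "\<forall>i\<in>{1..<k}. z (Suc i) < z i"
    and A: "A \<in> borel_Cab a b" and E: "E \<in> borel_Cab a b" and inc: "increasing_set a b A"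
    and ga: "g a < ereal (w k)" and gb: "g b < ereal (z k)"
  defines "P \<equiv> prob_inf M a b k w z W g" and "B \<equiv> BBpath a b w z W" and "O1 \<equiv> ordered_event M a b k w z W g"
  assumes O_pos: "measure M O1 > 0" and pos: "P {\<omega>\<in>space M. B 1 \<omega> \<in> E} > 0"
  shows "P {\<omega>\<in>space M. B 2 \<omega> \<in> A \<and> B 1 \<omega> \<in> E} / P {\<omega>\<in>space M. B 1 \<omega> \<in> E} \<le> P {\<omega>\<in>space M. B 1 \<omega> \<in> A}"
proof -
  interpret prob_space M by fact
  let ?B = "BB a b w z W"
  \<comment> \<open>A non-measurable set has measure \<open>0\<close> by convention, so positivity
    gives measurability of the event.\<close>
  have Os [measurable]: "O1 \<in> sets M" using O_pos measure_notin_sets[of O1 M] by force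
  have O_iff: "\<omega> \<in> O1 \<longleftrightarrow> \<omega> \<in> space M \<and> (\<forall>u\<in>{a..b}. (\<forall>i\<in>{1..<k}. ?B (Suc i) \<omega> u < ?B i \<omega> u) \<and> g u < ereal (?B k \<omega> u))" for \<omega>
    by (simp add: O1_def ordered_event_def)
  obtain \<omega>0 where "\<omega>0 \<in> O1" using O_pos by fastforce
  then have gfin: "g u \<noteq> \<infinity>" if "u \<in> {a..b}" for u using that O_iff by fastforce
  \<comment> \<open>The interior times with a finite floor: a path in the event excludes the value
    \<open>\<infinity>\<close>, and where the floor is \<open>- \<infinity>\<close> the constraint
    is void.\<close>
  define V where "V = {u\<in>{a<..<b}. g u \<noteq> - \<infinity>}"
  define gr where "gr u = real_of_ereal (g u)" for u
  have g_eq: "g u = ereal (gr u)" if "u \<in> V" for u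
    using that gfin[of u] unfolding V_def gr_def by (cases "g u") auto
  have "V \<subseteq> {a<..<b}" by (auto simp: V_def)
  then obtain q where q: "dense_seq a b q"
    and gq: "\<And>u e. u \<in> V \<Longrightarrow> 0 < e \<Longrightarrow> \<exists>l. q l \<in> V \<and> \<bar>q l - u\<bar> < e \<and> \<bar>gr (q l) - gr u\<bar> < e"
    using ex_graph_dense_seq[OF ab, of V gr] by blast
  have qin: "q l \<in> {a<..<b}" for l using q unfolding dense_seq_def by blast
  have qin': "q l \<in> {a..b}" for l by (rule dense_seq_in[OF q])
  \<comment> \<open>The inequalities are weak, as strict ones would not survive limits along the
    sequence; the difference is the null event of touching.\<close>
  define cond where "cond \<omega> u \<longleftrightarrow> (\<forall>i\<in>{1..<k}. ?B (Suc i) \<omega> u \<le> ?B i \<omega> u) \<and> g u \<le> ereal (?B k \<omega> u)" for \<omega> u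
  define U where "U n = q ` {..<n}" for n
  define \<Psi> where "\<Psi> n u r = (if r \<le> 0 then 1 else 0 :: real)" for n :: nat and u r :: real
  define \<kappa> where "\<kappa> n u x = (if g u \<le> ereal x then 1 else 0 :: real)" for n :: nat and u x :: real
  have Uf: "finite (U n)" "U n \<subseteq> {a<..<b}" "l < n \<Longrightarrow> q l \<in> U n" for n l
    using qin by (auto simp: U_def)
  have lw: "lattice_weights (U n) (\<Psi> n) (\<kappa> n)" for n
  proof -
    have 1: "\<Psi> n u \<in> borel_measurable borel" "\<kappa> n u \<in> borel_measurable borel" for u
      unfolding \<Psi>_def \<kappa>_def by measurable
    have 2: "\<kappa> n u x * \<Psi> n u (v - y) * \<kappa> n u v \<le> \<kappa> n u (min x y) * \<Psi> n u (v - max x y) * \<kappa> n u v" for u x y v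
    proof -
      \<comment> \<open>The floor under \<open>v\<close> together with \<open>v \<le> y\<close> puts
        \<open>y\<close> above the floor too, so \<open>min x y\<close> may become the new bottom
        line.\<close>
      have "g u \<le> ereal (min x y) \<and> v \<le> max x y" if "g u \<le> ereal x" "v \<le> y" "g u \<le> ereal v"
      proof -
        have "g u \<le> ereal y" using that(2,3) by (meson ereal_less_eq(3) order_trans)
        then show ?thesis using that by (simp add: min_def max_def)
      qed
      then show ?thesis by (auto simp: \<Psi>_def \<kappa>_def)
    qed
    have 3: "\<Psi> n u (x' - x) * \<Psi> n u (y' - y) \<le> \<Psi> n u (max x' y' - max x y) * \<Psi> n u (min x' y' - min x y)" for u x x' y y'
      by (auto simp: \<Psi>_def max_def min_def)
    show ?thesis unfolding lattice_weights_def using 1 2 3 by (simp add: \<Psi>_def \<kappa>_def)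
  qed
  have gw: "gibbs_weight k (U n) (\<Psi> n) (\<kappa> n) (\<lambda>l. ?B l \<omega>) = (if \<forall>l<n. cond \<omega> (q l) then 1 else 0)" for n \<omega>
  proof -
    have "(\<Prod>i\<in>{1..<k}. \<Psi> n u (?B (Suc i) \<omega> u - ?B i \<omega> u)) * \<kappa> n u (?B k \<omega> u) = (if cond \<omega> u then 1 else 0)" for u
      unfolding \<Psi>_def \<kappa>_def prod_if_one_zero[OF finite_atLeastLessThan] by (auto simp: cond_def)
    then have "gibbs_weight k (U n) (\<Psi> n) (\<kappa> n) (\<lambda>l. ?B l \<omega>) = (\<Prod>u\<in>U n. if cond \<omega> u then 1 else 0)"
      unfolding gibbs_weight_def by simp
    also have "\<dots> = (if \<forall>u\<in>U n. cond \<omega> u then 1 else 0)" by (rule prod_if_one_zero[OF Uf(1)])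
    also have "(\<forall>u\<in>U n. cond \<omega> u) \<longleftrightarrow> (\<forall>l<n. cond \<omega> (q l))" by (auto simp: U_def)
    finally show ?thesis .
  qed
  have gw_lim: "(\<lambda>n. gibbs_weight k (U n) (\<Psi> n) (\<kappa> n) (\<lambda>l. ?B l \<omega>)) \<longlonglongrightarrow> (if \<forall>l. cond \<omega> (q l) then 1 else 0)" for \<omega>
  proof (cases "\<forall>l. cond \<omega> (q l)")
    case False
    then obtain l where "\<not> cond \<omega> (q l)" by blast
    then have "eventually (\<lambda>n. gibbs_weight k (U n) (\<Psi> n) (\<kappa> n) (\<lambda>l. ?B l \<omega>) = 0) sequentially"
      unfolding gw eventually_sequentially by (intro exI[of _ "Suc l"]) auto
    then show ?thesis unfolding if_not_P[OF False] by (rule tendsto_eventually)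
  qed (simp add: gw)
  define m where "m = (a + b) / 2"
  define cv where "cv u = bb_cov a b m u" for u
  have cv_pos: "0 < cv u" if "u \<in> {a<..<b}" for u
    using that ab by (auto simp: cv_def m_def bb_cov_def min_def max_def)
  have cv_cont: "continuous_on {a..b} cv"
    unfolding cv_def bb_cov_def using ab by (intro continuous_intros) auto
  \<comment> \<open>Absence of touching in quantitative form: either the order fails at some
    sequence time, or the gap is at least a fixed positive multiple of \<open>cv\<close> at all of
    them.\<close>
  have lines: "AE \<omega> in M. \<not> ((\<forall>l. 0 \<le> ?B i \<omega> (q l) - ?B (Suc i) \<omega> (q l)) \<and> (\<forall>e>0. \<exists>l. ?B i \<omega> (q l) - ?B (Suc i) \<omega> (q l) < e * cv (q l)))"
    if i: "i \<in> {1..<k}" for i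
  proof -
    have "AE \<omega> in M. \<not> ((\<forall>l\<in>UNIV. 0 \<le> ((w i + (q l - a) / (b - a) * (z i - w i)) - (w (Suc i) + (q l - a) / (b - a) * (z (Suc i) - w (Suc i))))
        + sqrt 2 * W i \<omega> (q l) - sqrt 2 * W (Suc i) \<omega> (q l))
      \<and> (\<forall>e>0. \<exists>l\<in>UNIV. ((w i + (q l - a) / (b - a) * (z i - w i)) - (w (Suc i) + (q l - a) / (b - a) * (z (Suc i) - w (Suc i))))
        + sqrt 2 * W i \<omega> (q l) - sqrt 2 * W (Suc i) \<omega> (q l) < e * bb_cov a b ((a + b) / 2) (q l)))"
      using i qin by (intro no_touching[OF assms(1) br ab]) auto
    then show ?thesis by (simp add: BB_def cv_def m_def algebra_simps)
  qed
  have bottom: "AE \<omega> in M. \<not> ((\<forall>l\<in>{l. q l \<in> V}. 0 \<le> ?B k \<omega> (q l) - gr (q l)) \<and> (\<forall>e>0. \<exists>l\<in>{l. q l \<in> V}. ?B k \<omega> (q l) - gr (q l) < e * cv (q l)))"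
  proof -
    \<comment> \<open>With \<open>\<alpha> = 0\<close> the second line drops out and the floor
      enters through the constants \<open>cc\<close>. Line \<open>1\<close> is only a dummy,
      distinct from line \<open>k\<close> since \<open>k \<ge> 2\<close>.\<close>
    have "AE \<omega> in M. \<not> ((\<forall>l\<in>{l. q l \<in> V}. 0 \<le> ((w k + (q l - a) / (b - a) * (z k - w k)) - gr (q l)) + sqrt 2 * W k \<omega> (q l) - 0 * W 1 \<omega> (q l))
      \<and> (\<forall>e>0. \<exists>l\<in>{l. q l \<in> V}. ((w k + (q l - a) / (b - a) * (z k - w k)) - gr (q l)) + sqrt 2 * W k \<omega> (q l) - 0 * W 1 \<omega> (q l) < e * bb_cov a b ((a + b) / 2) (q l)))"
      using k qin by (intro no_touching[OF assms(1) br ab]) auto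
    then show ?thesis by (simp add: BB_def cv_def m_def algebra_simps)
  qed
  have ends: "AE \<omega> in M. \<forall>j\<in>{1..k}. W j \<omega> a = 0 \<and> W j \<omega> b = 0"
  proof (rule AE_finite_allI)
    fix j assume j: "j \<in> {1..k}"
    show "AE \<omega> in M. W j \<omega> a = 0 \<and> W j \<omega> b = 0"
      using AE_bridge_start[OF assms(1) br j, of a] AE_bridge_start[OF assms(1) br j, of b] ab by auto
  qed simp
  have lines': "AE \<omega> in M. \<forall>i\<in>{1..<k}. \<not> ((\<forall>l. 0 \<le> ?B i \<omega> (q l) - ?B (Suc i) \<omega> (q l)) \<and> (\<forall>e>0. \<exists>l. ?B i \<omega> (q l) - ?B (Suc i) \<omega> (q l) < e * cv (q l)))"
    using lines by (intro AE_finite_allI) auto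
  have "AE \<omega> in M. (\<forall>l. cond \<omega> (q l)) \<longleftrightarrow> \<omega> \<in> O1"
    using AE_space ends lines' bottom
  proof eventually_elim
    case (elim \<omega>)
    have cont: "continuous_on {a..b} (?B i \<omega>)" if "i \<in> {1..k}" for i
      by (rule BBpath_Cab(1)[OF br ab that elim(1)])
    show "(\<forall>l. cond \<omega> (q l)) \<longleftrightarrow> \<omega> \<in> O1"
    proof
      assume "\<omega> \<in> O1"
      then show "\<forall>l. cond \<omega> (q l)"
        using qin' unfolding O_iff cond_def by (blast intro: less_imp_le)
    next
      assume c: "\<forall>l. cond \<omega> (q l)"
      have "(\<forall>i\<in>{1..<k}. ?B (Suc i) \<omega> u < ?B i \<omega> u) \<and> g u < ereal (?B k \<omega> u)" if u: "u \<in> {a..b}" for u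
      proof (cases "u = a \<or> u = b")
        case True
        \<comment> \<open>At the ends \<open>cv\<close> vanishes and yields no strict inequality;
          there the prescribed values decide.\<close>
        have "?B j \<omega> a = w j" "?B j \<omega> b = z j" if "j \<in> {1..k}" for j
          using elim(2) that ab by (auto simp: BB_def)
        then show ?thesis using True w z ga gb k by auto
      next
        case False
        then have u': "u \<in> {a<..<b}" using u by auto
        have "?B (Suc i) \<omega> u < ?B i \<omega> u" if i: "i \<in> {1..<k}" for i
        proof -
          have "\<forall>l. 0 \<le> ?B i \<omega> (q l) - ?B (Suc i) \<omega> (q l)" using c i by (auto simp: cond_def)
          then obtain e where e: "0 < e" "\<And>l. e * cv (q l) \<le> ?B i \<omega> (q l) - ?B (Suc i) \<omega> (q l)"
            using elim(3) i by (meson not_less)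
          \<comment> \<open>The bound by \<open>e * cv\<close> is a closed condition between
            continuous functions, so it extends from the sequence to every time, and it is positive
            in the interior.\<close>
          have "e * cv u \<le> ?B i \<omega> u - ?B (Suc i) \<omega> u"
            by (rule le_of_dense[where f="\<lambda>u. e * cv u" and h="\<lambda>u. ?B i \<omega> u - ?B (Suc i) \<omega> u", OF q _ _ e(2) u])
              (use i in \<open>auto intro!: continuous_intros cont cv_cont\<close>)
          moreover have "0 < e * cv u" using e(1) cv_pos[OF u'] by simp
          ultimately show ?thesis by simp
        qed
        moreover have "g u < ereal (?B k \<omega> u)"
        proof (cases "u \<in> V")
          case True
          have "\<forall>l\<in>{l. q l \<in> V}. 0 \<le> ?B k \<omega> (q l) - gr (q l)"
          proof
            fix l assume "l \<in> {l. q l \<in> V}"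
            then have "g (q l) = ereal (gr (q l))" by (intro g_eq) simp
            moreover have "g (q l) \<le> ereal (?B k \<omega> (q l))" using c by (simp add: cond_def)
            ultimately show "0 \<le> ?B k \<omega> (q l) - gr (q l)" by simp
          qed
          then obtain e where e: "0 < e" "\<And>l. q l \<in> V \<Longrightarrow> e * cv (q l) \<le> ?B k \<omega> (q l) - gr (q l)"
            using elim(4) by (metis (mono_tags, lifting) mem_Collect_eq not_less)
          define f where "f x = ?B k \<omega> x - e * cv x" for x
          have fc: "continuous_on {a..b} f" unfolding f_def using k by (intro continuous_intros cont cv_cont) auto
          \<comment> \<open>The floor need not be continuous. A sequence time in \<open>V\<close> is
            taken at which both the time and the floor value are close to those at \<open>u\<close>,
            and only \<open>f\<close> is moved by continuity.\<close>
          have "gr u \<le> f u"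
          proof (rule ccontr)
            assume "\<not> gr u \<le> f u"
            define \<eta> where "\<eta> = (gr u - f u) / 2"
            have \<eta>: "0 < \<eta>" using \<open>\<not> gr u \<le> f u\<close> by (simp add: \<eta>_def)
            obtain d where d: "0 < d" "\<And>x. x \<in> {a..b} \<Longrightarrow> dist x u < d \<Longrightarrow> dist (f x) (f u) < \<eta>"
              using fc[unfolded continuous_on_iff, rule_format, OF u \<eta>] by blast
            obtain l where l: "q l \<in> V" "\<bar>q l - u\<bar> < min d \<eta>" "\<bar>gr (q l) - gr u\<bar> < min d \<eta>"
              using gq[OF True, of "min d \<eta>"] d(1) \<eta> by auto
            have "dist (f (q l)) (f u) < \<eta>" using l(2) qin' by (intro d(2)) (auto simp: dist_real_def)
            moreover have "gr (q l) \<le> f (q l)" using e(2)[OF l(1)] by (simp add: f_def)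
            moreover have "\<bar>gr (q l) - gr u\<bar> < \<eta>" "gr u = f u + 2 * \<eta>" using l(3) by (simp_all add: \<eta>_def field_simps)
            ultimately show False unfolding dist_real_def by linarith
          qed
          moreover have "0 < e * cv u" using e(1) cv_pos[OF u'] by simp
          ultimately show ?thesis using g_eq[OF True] by (simp add: f_def)
        next
          case False
          then have "g u = - \<infinity>" using u' by (simp add: V_def)
          then show ?thesis by simp
        qed
        ultimately show ?thesis by blast
      qed
      then show "\<omega> \<in> O1" using elim(1) unfolding O_iff by blast
    qed
  qed
  then have lim: "AE \<omega> in M. (\<lambda>n. gibbs_weight k (U n) (\<Psi> n) (\<kappa> n) (\<lambda>l. ?B l \<omega>)) \<longlonglongrightarrow> indicator O1 \<omega>"
  proof eventually_elim
    case (elim \<omega>)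
    then show ?case using gw_lim[of \<omega>] by (simp only: indicator_def of_bool_def)
  qed
  have ineq: "(\<integral>\<omega>. indicator {\<omega>\<in>space M. B 2 \<omega> \<in> A \<and> B 1 \<omega> \<in> E} \<omega> * indicator O1 \<omega> \<partial>M) * (\<integral>\<omega>. indicator O1 \<omega> \<partial>M)
    \<le> (\<integral>\<omega>. indicator {\<omega>\<in>space M. B 1 \<omega> \<in> E} \<omega> * indicator O1 \<omega> \<partial>M) * (\<integral>\<omega>. indicator {\<omega>\<in>space M. B 1 \<omega> \<in> A} \<omega> * (indicator O1 \<omega> :: real) \<partial>M)"
    unfolding B_def
    by (rule limit_inequality[OF assms(1) br ab k w z A E inc q Uf lw _ _ lim]) (auto simp: indicator_def)
  have N: "(\<integral>\<omega>. indicator S \<omega> * (indicator O1 \<omega> :: real) \<partial>M) = measure M (S \<inter> O1)" for S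
  proof -
    have "S \<inter> O1 \<inter> space M = S \<inter> O1" using sets.sets_into_space[OF Os] by auto
    then show ?thesis by (simp add: indicator_inter_arith[symmetric])
  qed
  have "(\<integral>\<omega>. (indicator O1 \<omega> :: real) \<partial>M) = measure M O1"
    using sets.sets_into_space[OF Os] by (simp add: Int_absorb2)
  with ineq have ineq': "measure M ({\<omega>\<in>space M. B 2 \<omega> \<in> A \<and> B 1 \<omega> \<in> E} \<inter> O1) * measure M O1
    \<le> measure M ({\<omega>\<in>space M. B 1 \<omega> \<in> E} \<inter> O1) * measure M ({\<omega>\<in>space M. B 1 \<omega> \<in> A} \<inter> O1)"
    unfolding N by simp
  have Pe: "P S = measure M (S \<inter> O1) / measure M O1" for S by (simp add: P_def prob_inf_def O1_def)
  have "0 < measure M ({\<omega>\<in>space M. B 1 \<omega> \<in> E} \<inter> O1)"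
    using pos O_pos unfolding Pe by (simp add: zero_less_divide_iff)
  then show ?thesis using ineq' O_pos unfolding Pe by (simp add: field_simps)
qed

theorem mainTheorem19:
  fixes M :: "'s measure" and k :: nat and a b :: real and w z :: "nat \<Rightarrow> real"
    and W :: "nat \<Rightarrow> 's \<Rightarrow> real \<Rightarrow> real" and A E :: "(real \<Rightarrow> real) set"
  assumes "prob_space M"
    and "indep_std_bridges M k a b W"
    and "k \<ge> 2" and "a < b"
    and "\<forall>i\<in>{1..<k}. w (Suc i) < w i"
    and "\<forall>i\<in>{1..<k}. z (Suc i) < z i"
    and "A \<in> borel_Cab a b" and "E \<in> borel_Cab a b"
    and "increasing_set a b A"
  shows
    "(\<forall>t::real. t > 0 \<longrightarrow>
        prob_t M a b k w z W t {\<omega>\<in>space M. BBpath a b w z W 1 \<omega> \<in> E} > 0 \<longrightarrow>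
        prob_t M a b k w z W t {\<omega>\<in>space M. BBpath a b w z W 2 \<omega> \<in> A \<and> BBpath a b w z W 1 \<omega> \<in> E}
          / prob_t M a b k w z W t {\<omega>\<in>space M. BBpath a b w z W 1 \<omega> \<in> E}
        \<le> prob_t M a b k w z W t {\<omega>\<in>space M. BBpath a b w z W 1 \<omega> \<in> A})
     \<and>
     (\<forall>g::real \<Rightarrow> ereal.
        g \<in> borel_measurable (restrict_space borel {a..b}) \<longrightarrow>
        g a < ereal (w k) \<longrightarrow> g b < ereal (z k) \<longrightarrow>
        measure M (ordered_event M a b k w z W g) > 0 \<longrightarrow>
        prob_inf M a b k w z W g {\<omega>\<in>space M. BBpath a b w z W 1 \<omega> \<in> E} > 0 \<longrightarrow>
        prob_inf M a b k w z W g {\<omega>\<in>space M. BBpath a b w z W 2 \<omega> \<in> A \<and> BBpath a b w z W 1 \<omega> \<in> E}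
          / prob_inf M a b k w z W g {\<omega>\<in>space M. BBpath a b w z W 1 \<omega> \<in> E}
        \<le> prob_inf M a b k w z W g {\<omega>\<in>space M. BBpath a b w z W 1 \<omega> \<in> A})"
  using positive_temperature[OF assms(1,2,3,4,5,6,7,8,9)] zero_temperature[OF assms(1,2,3,4,5,6,7,8,9)]
  by blast

end
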